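(* There is a deterministic polynomial-time algorithm that, given a configuration $C$ of g-2PATH (in a standard encoding), decides whether $C$ satisfies the condition of noninterference of extensions (CNI).
   Context: Positions are elements of $\mathbb{Z}^2$; with $\epsilon_0=(1,0),\epsilon_1=(0,1),\epsilon_2=(-1,0),\epsilon_3=(0,-1)$, positions $p,p'$ are adjacent if $p'-p$ is some $\epsilon_i$. A configuration of g-2PATH is a sequence $C=p_r\dots p_s$ ($r\le0\le s$) of positions with $p_0=(0,0)$, consecutive positions adjacent, all positions distinct, and $p_l,p_m$ not adjacent whenever $|l-m|\ge2$; it is encoded e.g. by the list of coordinates of $p_r,\dots,p_s$ together with the index of the origin. For $p\in C$, $\mathrm{bc}_C(p)=(b_0,\dots,b_3)$ with $b_i=1$ iff $p+\epsilon_i\in C$. For $r\le i\le0\le j\le s$: $W(i,j)$ is the set of pairs $(x_0,x_1)$ of finite, possibly empty, sequences of positions such that $x_0p_i\dots p_jx_1$ is a configuration $C'$ of g-2PATH (general at $p_0$) with $\mathrm{bc}_{C'}(p_l)=\mathrm{bc}_C(p_l)$ for $i\le l\le j$; $U(i,j)$, $V(i,j)$ are the sets of first, resp. second, components of its elements. $\mathrm{NI}(i,j)$ means $W(i,j)=U(i,j)\times V(i,j)$. $I=\{(i,j): r\le i-1,\ W(i,j)$ infinite, $W(i-1,j)$ finite$\}$, $J=\{(i,j): j+1\le s,\ W(i,j)$ infinite, $W(i,j+1)$ finite$\}$, $K=\{(i,j): W(i,j)$ finite$\}$. $C$ satisfies CNI if $\mathrm{NI}(i,j)$ holds for all $(i,j)\in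 I\cup J\cup K$. *)

theory Defs
  imports Main
begin

type_synonym pos = "int \<times> int"

definition adj :: "pos \<Rightarrow> pos \<Rightarrow> bool" where
  "adj p q \<longleftrightarrow> \<bar>fst q - fst p\<bar> + \<bar>snd q - snd p\<bar> = 1"

definition epsl :: "pos list" where
  "epsl = [(1,0), (0,1), (-1,0), (0,-1)]"

text \<open>A configuration p_r ... p_s is represented by the list [p_r, ..., p_s] together
  with the list index o = -r of the origin p_0.  Paper index l corresponds to list index og + l.\<close>
definition is_config :: "pos list \<Rightarrow> nat \<Rightarrow> bool" where
  "is_config ps og \<longleftrightarrow>
     og < length ps \<and> ps ! og = (0,0) \<and>
     (\<forall>l. Suc l < length ps \<longrightarrow> adj (ps ! l) (ps ! Suc l)) \<and>
     distinct ps \<and>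
     (\<forall>l m. l < length ps \<longrightarrow> m < length ps \<longrightarrow> l + 2 \<le> m \<longrightarrow> \<not> adj (ps ! l) (ps ! m))"

definition bc :: "pos list \<Rightarrow> pos \<Rightarrow> bool list" where
  "bc C p = map (\<lambda>e. (fst p + fst e, snd p + snd e) \<in> set C) epsl"

text \<open>W(i,j) with i = a - og, j = b - og (list indices a \<le> og \<le> b).  The extended configuration
  x0 p_i ... p_j x1 is general at p_0, i.e. its origin is at list index length x0 + (og - a).\<close>
definition Wset :: "pos list \<Rightarrow> nat \<Rightarrow> nat \<Rightarrow> nat \<Rightarrow> (pos list \<times> pos list) set" where
  "Wset ps og a b = {(x0, x1).
     let C' = x0 @ take (Suc b - a) (drop a ps) @ x1 in
       is_config C' (length x0 + (og - a)) \<and>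
       (\<forall>l. a \<le> l \<and> l \<le> b \<longrightarrow> bc C' (ps ! l) = bc ps (ps ! l))}"

definition Uset :: "pos list \<Rightarrow> nat \<Rightarrow> nat \<Rightarrow> nat \<Rightarrow> pos list set" where
  "Uset ps og a b = fst ` Wset ps og a b"

definition Vset :: "pos list \<Rightarrow> nat \<Rightarrow> nat \<Rightarrow> nat \<Rightarrow> pos list set" where
  "Vset ps og a b = snd ` Wset ps og a b"

definition NI :: "pos list \<Rightarrow> nat \<Rightarrow> nat \<Rightarrow> nat \<Rightarrow> bool" where
  "NI ps og a b \<longleftrightarrow> Wset ps og a b = Uset ps og a b \<times> Vset ps og a b"

definition valid_range :: "pos list \<Rightarrow> nat \<Rightarrow> nat \<Rightarrow> nat \<Rightarrow> bool" where
  "valid_range ps og a b \<longleftrightarrow> a \<le> og \<and> og \<le> b \<and> b < length ps"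

definition inI :: "pos list \<Rightarrow> nat \<Rightarrow> nat \<Rightarrow> nat \<Rightarrow> bool" where
  "inI ps og a b \<longleftrightarrow> valid_range ps og a b \<and> 1 \<le> a \<and>
     infinite (Wset ps og a b) \<and> finite (Wset ps og (a - 1) b)"

definition inJ :: "pos list \<Rightarrow> nat \<Rightarrow> nat \<Rightarrow> nat \<Rightarrow> bool" where
  "inJ ps og a b \<longleftrightarrow> valid_range ps og a b \<and> Suc b < length ps \<and>
     infinite (Wset ps og a b) \<and> finite (Wset ps og a (Suc b))"

definition inK :: "pos list \<Rightarrow> nat \<Rightarrow> nat \<Rightarrow> nat \<Rightarrow> bool" where
  "inK ps og a b \<longleftrightarrow> valid_range ps og a b \<and> finite (Wset ps og a b)"

definition CNI :: "pos list \<Rightarrow> nat \<Rightarrow> bool" where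
  "CNI ps og \<longleftrightarrow> (\<forall>a b. inI ps og a b \<or> inJ ps og a b \<or> inK ps og a b \<longrightarrow> NI ps og a b)"

text \<open>Symbols: 0 blank, 1 bit '0', 2 bit '1', 3 separator, 4 minus sign.\<close>
fun bits :: "nat \<Rightarrow> nat list" where
  "bits n = (if n < 2 then [Suc (n mod 2)] else bits (n div 2) @ [Suc (n mod 2)])"

definition enc_int :: "int \<Rightarrow> nat list" where
  "enc_int z = (if z < 0 then [4] else []) @ bits (nat \<bar>z\<bar>) @ [3]"

definition enc_config :: "pos list \<Rightarrow> nat \<Rightarrow> nat list" where
  "enc_config ps og = enc_int (int og) @ concat (map (\<lambda>p. enc_int (fst p) @ enc_int (snd p)) ps)"

datatype move = MoveL | MoveR | MoveN

text \<open>States 0..<nst (0 start, 1 accept, 2 reject), tape symbols 0..<nsym (0 blank).\<close>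
record tm =
  nst :: nat
  nsym :: nat
  delta :: "nat \<Rightarrow> nat \<Rightarrow> nat \<times> nat \<times> move"

definition wf_tm :: "tm \<Rightarrow> bool" where
  "wf_tm M \<longleftrightarrow> 3 \<le> nst M \<and> 5 \<le> nsym M \<and>
     (\<forall>q s. q < nst M \<longrightarrow> s < nsym M \<longrightarrow>
        fst (delta M q s) < nst M \<and> fst (snd (delta M q s)) < nsym M)"

text \<open>Configuration: (state, cells left of head in reverse order, cells from head on).\<close>
type_synonym tmconf = "nat \<times> nat list \<times> nat list"

definition head_sym :: "nat list \<Rightarrow> nat" where
  "head_sym r = (case r of [] \<Rightarrow> 0 | x # _ \<Rightarrow> x)"

definition halted :: "tmconf \<Rightarrow> bool" where
  "halted c \<longleftrightarrow> fst c = 1 \<or> fst c = 2"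

definition tm_step :: "tm \<Rightarrow> tmconf \<Rightarrow> tmconf" where
  "tm_step M c = (if halted c then c else
     (case c of (q, l, r) \<Rightarrow>
       (case delta M q (head_sym r) of (q', s', m) \<Rightarrow>
         let r' = s' # tl r in
         (case m of
            MoveN \<Rightarrow> (q', l, r')
          | MoveR \<Rightarrow> (q', s' # l, tl r)
          | MoveL \<Rightarrow> (case l of [] \<Rightarrow> (q', [], 0 # r') | x # l' \<Rightarrow> (q', l', x # r'))))))"

definition tm_run :: "tm \<Rightarrow> nat \<Rightarrow> nat list \<Rightarrow> tmconf" where
  "tm_run M t w = (tm_step M ^^ t) (0, [], w)"

definition decides_in_polytime ::
  "tm \<Rightarrow> ('x \<Rightarrow> bool) \<Rightarrow> ('x \<Rightarrow> nat list) \<Rightarrow> ('x \<Rightarrow> bool) \<Rightarrow> bool" where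
  "decides_in_polytime M Q enc P \<longleftrightarrow>
     (\<exists>c d::nat. \<forall>x. Q x \<longrightarrow>
        (\<exists>t. t \<le> c * length (enc x) ^ d + c \<and> halted (tm_run M t (enc x)) \<and>
             (fst (tm_run M t (enc x)) = 1 \<longleftrightarrow> P x)))"

end

theory Submission
  imports Defs "HOL-Library.Nat_Bijection" "HOL-Library.Numeral_Type"
begin

text \<open>\<open>W(i,j)\<close> consists of the pairs of compatible extensions of the segment \<open>p\<^sub>i \<dots> p\<^sub>j\<close>
  beyond \<open>p\<^bsub>i-1\<^esub>\<close> and \<open>p\<^bsub>j+1\<^esub>\<close>. A point lies on some first component iff it can be reached from
  \<open>p\<^bsub>i-1\<^esub>\<close> without touching \<open>p\<^sub>i \<dots> p\<^bsub>j+1\<^esub>\<close>, because every walk contains a chordless path; likewise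
  for second components. Hence \<open>W(i,j)\<close> is finite iff both reachable regions are bounded, and
  \<open>NI(i,j)\<close> holds iff the two regions do not touch (the case \<open>i = j = 0\<close> is special, since there the
  two neighbours of the origin may be exchanged). Reachability can be decided in a box around the path,
  onto which the plane retracts.

  Turing machines enter through a small programming language whose variables are finite sets of tape
  positions, stored on parallel tracks, and whose only loops repeat their body as often as the input is
  long. Every program therefore runs in polynomial time, and its meaning is a total function.\<close>


subsection \<open>Extensions of a path and reachability\<close>

text \<open>Extensions cannot be listed, as there may be infinitely many, so the proof works with
  the points they cover. This loses nothing because the nonempty segment keeps the two extensions at
  least two places apart along the path: they restrict each other only by not touching.

  The box turns boundedness into a question about one corner: the points far from the path are all
  connected to each other, hence a region is unbounded iff it contains this corner. With
  \<open>L\<close> the length of the input, which exceeds the number of points of the path, rows of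
  the box have length \<open>3 * L\<close>; the padding makes the false adjacency between the end of
  a row and the start of the next harmless.

  Programs have no arithmetic. The directions of the path are therefore found by a finite automaton
  working modulo 3, the path is redrawn by shifts from its first point, and the bounds
  \<open>L ^ 4\<close> and \<open>L ^ 5\<close> are iteration counts of nested loops, chosen to be
  large enough for the number of cells concerned.\<close>

lemma abs_sum_eq_1:
  "\<bar>s\<bar> + \<bar>t\<bar> = 1 \<longleftrightarrow> s = 1 \<and> t = 0 \<or> s = 0 \<and> t = 1 \<or> s = -1 \<and> t = 0 \<or> s = 0 \<and> t = -1"
  for s t :: int
  by linarith

text \<open>Distinctness and absence of chords are both instances of not touching, so one relation
  expresses the path condition.\<close>

definition touch :: "pos \<Rightarrow> pos \<Rightarrow> bool" where
  "touch u v \<longleftrightarrow> u = v \<or> adj u v"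

definition separate :: "pos set \<Rightarrow> pos set \<Rightarrow> bool" where
  "separate A B \<longleftrightarrow> (\<forall>u\<in>A. \<forall>v\<in>B. \<not> touch u v)"

lemma adj_sym: "adj u v \<longleftrightarrow> adj v u"
  by (auto simp: adj_def)

lemma adj_irrefl [simp]: "\<not> adj u u"
  by (simp add: adj_def)

lemma touch_sym: "touch u v \<longleftrightarrow> touch v u"
  by (auto simp: touch_def adj_sym)

lemma touch_refl [simp]: "touch u u"
  by (simp add: touch_def)

lemma separate_simps [simp]:
  "separate {} B" "separate A {}"
  "separate (insert u A) B \<longleftrightarrow> (\<forall>v\<in>B. \<not> touch u v) \<and> separate A B"
  "separate A (insert v B) \<longleftrightarrow> (\<forall>u\<in>A. \<not> touch u v) \<and> separate A B"
  "separate (A \<union> A') B \<longleftrightarrow> separate A B \<and> separate A' B"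
  "separate A (B \<union> B') \<longleftrightarrow> separate A B \<and> separate A B'"
  by (auto simp: separate_def)

fun chordless :: "pos list \<Rightarrow> bool" where
  "chordless [] = True"
| "chordless [x] = True"
| "chordless (x # y # zs) = (adj x y \<and> separate {x} (set zs) \<and> chordless (y # zs))"

lemma all_nat_split: "(\<forall>l. Q l) \<longleftrightarrow> Q 0 \<and> (\<forall>l. Q (Suc l))"
  by (metis not0_implies_Suc)

text \<open>Passes from index conditions to recursion on the list: quantifiers over indices are
  split into 0 and successors, which sorts the conditions into those on the head and those on the
  tail.\<close>

lemma chordless_iff_nth:
  "(\<forall>l. Suc l < length ps \<longrightarrow> adj (ps ! l) (ps ! Suc l)) \<and> distinct ps \<and>
     (\<forall>l m. l < length ps \<longrightarrow> m < length ps \<longrightarrow> l + 2 \<le> m \<longrightarrow> \<not> adj (ps ! l) (ps ! m))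
   \<longleftrightarrow> chordless ps"
proof (induction ps rule: chordless.induct)
  case (3 x y zs)
  let ?ys = "y # zs"
  have 1: "(\<forall>l. Suc l < length (x # ?ys) \<longrightarrow> adj ((x # ?ys) ! l) ((x # ?ys) ! Suc l))
    \<longleftrightarrow> adj x y \<and> (\<forall>l. Suc l < length ?ys \<longrightarrow> adj (?ys ! l) (?ys ! Suc l))"
    by (subst all_nat_split) simp
  have x: "(\<forall>m. m < length (x # ?ys) \<longrightarrow> 2 \<le> m \<longrightarrow> \<not> adj x ((x # ?ys) ! m)) \<longleftrightarrow> (\<forall>v\<in>set zs. \<not> adj x v)"
    by (subst all_nat_split, simp, subst all_nat_split) (auto simp: all_set_conv_all_nth)
  have 2: "(\<forall>l m. l < length (x # ?ys) \<longrightarrow> m < length (x # ?ys) \<longrightarrow> l + 2 \<le> m \<longrightarrow> \<not> adj ((x # ?ys) ! l) ((x # ?ys) ! m))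
    \<longleftrightarrow> (\<forall>v\<in>set zs. \<not> adj x v) \<and>
      (\<forall>l m. l < length ?ys \<longrightarrow> m < length ?ys \<longrightarrow> l + 2 \<le> m \<longrightarrow> \<not> adj (?ys ! l) (?ys ! m))"
    (is "?L \<longleftrightarrow> _ \<and> ?R")
  proof -
    have "?L \<longleftrightarrow> (\<forall>m. m < length (x # ?ys) \<longrightarrow> 2 \<le> m \<longrightarrow> \<not> adj x ((x # ?ys) ! m)) \<and>
      (\<forall>l m. Suc l < length (x # ?ys) \<longrightarrow> m < length (x # ?ys) \<longrightarrow> Suc l + 2 \<le> m \<longrightarrow> \<not> adj (?ys ! l) ((x # ?ys) ! m))"
      by (subst all_nat_split) (simp add: numeral_2_eq_2)
    also have "(\<forall>l m. Suc l < length (x # ?ys) \<longrightarrow> m < length (x # ?ys) \<longrightarrow> Suc l + 2 \<le> m \<longrightarrow> \<not> adj (?ys ! l) ((x # ?ys) ! m)) \<longleftrightarrow> ?R"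
    proof -
      have "(\<forall>m. Suc l < length (x # ?ys) \<longrightarrow> m < length (x # ?ys) \<longrightarrow> Suc l + 2 \<le> m \<longrightarrow> \<not> adj (?ys ! l) ((x # ?ys) ! m))
        \<longleftrightarrow> (\<forall>m. l < length ?ys \<longrightarrow> m < length ?ys \<longrightarrow> l + 2 \<le> m \<longrightarrow> \<not> adj (?ys ! l) (?ys ! m))" for l
        by (subst all_nat_split) simp
      then show ?thesis by simp
    qed
    finally show ?thesis unfolding x .
  qed
  \<comment> \<open>That \<open>x\<close> is not in \<open>zs\<close> is contained in
    \<open>separate\<close>; that it differs from \<open>y\<close> follows from adjacency.\<close>
  have 3: "separate {x} (set zs) \<longleftrightarrow> x \<notin> set zs \<and> (\<forall>v\<in>set zs. \<not> adj x v)"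
    by (auto simp: separate_def touch_def)
  have 4: "adj x y \<Longrightarrow> x \<noteq> y" by auto
  show ?case unfolding chordless.simps(3) "3.IH"[symmetric] 1 2 3 distinct.simps(2)[of x] list.set(2)[of y]
    using 4 by blast
qed simp_all

lemma is_config_iff: "is_config ps og \<longleftrightarrow> og < length ps \<and> ps ! og = (0, 0) \<and> chordless ps"
  unfolding is_config_def chordless_iff_nth[symmetric] by blast

lemma chordless_Cons:
  "chordless (x # xs) \<longleftrightarrow> chordless xs \<and> (xs \<noteq> [] \<longrightarrow> adj x (hd xs)) \<and> separate {x} (set (tl xs))"
  by (cases xs) auto

text \<open>The only points of the two parts that may touch are the last of \<open>xs\<close> and
  the first of \<open>ys\<close>; the two separations cover all other pairs.\<close>

lemma chordless_append:
  "chordless (xs @ ys) \<longleftrightarrow> chordless xs \<and> chordless ys \<and> (xs \<noteq> [] \<and> ys \<noteq> [] \<longrightarrow>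
     adj (last xs) (hd ys) \<and> separate (set (butlast xs)) (set ys) \<and> separate (set xs) (set (tl ys)))"
proof (induction xs)
  case (Cons x xs)
  show ?case
  proof (cases "xs = []")
    case True
    then show ?thesis by (auto simp: chordless_Cons)
  next
    case False
    have "\<forall>v\<in>set (tl ys). v \<in> set ys" by (cases ys) auto
    then show ?thesis using False Cons by (cases "ys = []") (simp_all add: chordless_Cons ball_Un, blast)
  qed
qed simp

lemma chordless_rev [simp]: "chordless (rev xs) = chordless xs"
proof (induction xs)
  case (Cons x xs)
  have "butlast (rev xs) = rev (tl xs)" by (cases xs) auto
  then show ?case using Cons
    by (auto simp: chordless_append chordless_Cons last_rev adj_sym[of x] touch_sym[of x])
qed simp

lemma chordless_distinct: "chordless xs \<Longrightarrow> distinct xs"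
  using chordless_iff_nth by blast

text \<open>Across a nonempty middle part, points of \<open>xs\<close> and \<open>zs\<close> are
  never consecutive, so their mutual condition is plain separation. This is why compatibility of two
  extensions reduces to not touching.\<close>

lemma chordless_append3:
  assumes "ys \<noteq> []"
  shows "chordless (xs @ ys @ zs) \<longleftrightarrow> chordless (xs @ ys) \<and> chordless (ys @ zs) \<and> separate (set xs) (set zs)"
proof (induction xs)
  case Nil
  then show ?case by (simp add: chordless_append)
next
  case (Cons x xs)
  show ?case
  proof (cases "xs = []")
    case True
    then show ?thesis using assms chordless_append[of ys zs] by (auto simp: chordless_Cons ball_Un)
  next
    case False
    then show ?thesis using Cons by (simp add: chordless_Cons ball_Un) blast
  qed
qed

text \<open>Starting points are exempt from the separation: they will be the neighbours of the
  segment on the path and so touch the segment, which is part of \<open>B\<close>.\<close>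

inductive_set reach :: "pos set \<Rightarrow> pos set \<Rightarrow> pos set" for S B where
  start: "s \<in> S \<Longrightarrow> s \<in> reach S B"
| step: "u \<in> reach S B \<Longrightarrow> adj u v \<Longrightarrow> separate {v} B \<Longrightarrow> v \<in> reach S B"

lemma reach_empty [simp]: "reach {} B = {}"
proof -
  have "u \<in> reach {} B \<Longrightarrow> False" for u by (induction rule: reach.induct) auto
  then show ?thesis by blast
qed

lemma chordless_path_reach:
  "chordless (ys @ [s]) \<Longrightarrow> separate (set ys) B \<Longrightarrow> set (ys @ [s]) \<subseteq> reach {s} B"
proof (induction ys)
  case (Cons y ys)
  then have IH: "set (ys @ [s]) \<subseteq> reach {s} B" by (auto simp: chordless_Cons)
  moreover have "hd (ys @ [s]) \<in> set (ys @ [s])" by (intro hd_in_set) simp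
  ultimately have "hd (ys @ [s]) \<in> reach {s} B" by blast
  moreover have "adj (hd (ys @ [s])) y" using Cons.prems(1) by (simp add: chordless_Cons adj_sym)
  moreover have "separate {y} B" using Cons.prems(2) by simp
  ultimately have "y \<in> reach {s} B" by (rule reach.step)
  then show ?case using IH by simp
qed (auto intro: reach.start)

text \<open>A walk is turned into a chordless path by cutting it at the last point touching the new end.\<close>
lemma reach_chordless_path:
  assumes "u \<in> reach {s} B"
  shows "\<exists>ys. chordless (ys @ [s]) \<and> separate (set ys) B \<and> hd (ys @ [s]) = u"
  using assms
proof (induction rule: reach.induct)
  case (start s')
  then show ?case by (intro exI[of _ "[]"]) simp
next
  case (step u v)
  then obtain ys where ys: "chordless (ys @ [s])" "separate (set ys) B" "hd (ys @ [s]) = u" by blast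
  have "u \<in> set (ys @ [s])" using ys(3) hd_in_set[of "ys @ [s]"] by simp
  then have "\<exists>z\<in>set (ys @ [s]). touch v z" using step.hyps(2) by (auto simp: touch_def adj_sym)
  then obtain as z bs where z: "ys @ [s] = as @ z # bs" "touch v z" "\<forall>w\<in>set bs. \<not> touch v w"
    using split_list_last_prop[of "ys @ [s]" "touch v"] by blast
  obtain cs where cs: "z # bs = cs @ [s]" "set cs \<subseteq> set ys"
  proof (cases bs rule: rev_cases)
    case Nil
    then show ?thesis using z(1) that[of "[]"] by simp
  next
    case (snoc bs' b)
    then show ?thesis using z(1) that[of "z # bs'"] by auto
  qed
  have c: "chordless (z # bs)" using ys(1) unfolding z(1) by (simp add: chordless_append)
  have sep: "separate (set cs) B" using cs(2) ys(2) by (auto simp: separate_def)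
  \<comment> \<open>If the last touching point is \<open>v\<close> itself, the path from there on
    suffices; otherwise \<open>v\<close> touches only \<open>z\<close> in the remainder, and
    prepending it creates no chord.\<close>
  show ?case
  proof (cases "z = v")
    case True
    then show ?thesis using c sep cs(1) by (metis list.sel(1))
  next
    case False
    then have "adj v z" using z(2) by (simp add: touch_def)
    then have "chordless (v # z # bs)" using c z(3) by (simp add: separate_def)
    then show ?thesis using cs(1) sep step.hyps(3) by (intro exI[of _ "v # cs"]) simp
  qed
qed

text \<open>\<open>pre\<close> will have length at most one: it is the prescribed neighbour of the
  segment, and \<open>[]\<close> stands for an end of the path, where only the empty extension is
  allowed.\<close>

definition extensions :: "pos list \<Rightarrow> pos list \<Rightarrow> pos list set" where
  "extensions pre mid = {x. take 1 (rev x) = pre \<and> chordless (x @ mid)}"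

lemma extensions_Nil: "chordless mid \<Longrightarrow> extensions [] mid = {[]}"
  by (auto simp: extensions_def take_Suc)

text \<open>By \<open>chordless_append3\<close> with \<open>s\<close> alone in the middle, the part
  beyond \<open>s\<close> only has to keep away from \<open>mid\<close>; chordless paths of this
  kind cover the same points as walks.\<close>

lemma Union_extensions:
  assumes "chordless (pre @ mid)" "length pre \<le> 1" "mid \<noteq> []"
  shows "\<Union> (set ` extensions pre mid) = reach (set pre) (set mid)"
proof (cases pre)
  case Nil
  then show ?thesis using assms by (simp add: extensions_Nil)
next
  case (Cons s t)
  then have pre: "pre = [s]" using assms(2) by simp
  have "x \<in> extensions pre mid \<longleftrightarrow> (\<exists>ys. x = ys @ [s] \<and> chordless (ys @ [s]) \<and> separate (set ys) (set mid))" for x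
  proof (cases x rule: rev_cases)
    case (snoc ys y)
    then show ?thesis using assms(1,3) chordless_append3[of "[s]" ys mid]
      by (auto simp: extensions_def pre)
  qed (simp add: extensions_def pre)
  then have ext: "extensions pre mid = {ys @ [s] | ys. chordless (ys @ [s]) \<and> separate (set ys) (set mid)}"
    by blast
  show ?thesis
  proof (rule subset_antisym; rule subsetI)
    fix u assume "u \<in> \<Union> (set ` extensions pre mid)"
    then obtain ys where "chordless (ys @ [s])" "separate (set ys) (set mid)" "u \<in> set (ys @ [s])"
      unfolding ext by blast
    then show "u \<in> reach (set pre) (set mid)"
      using chordless_path_reach[of ys s "set mid"] by (auto simp: pre)
  next
    fix u assume "u \<in> reach (set pre) (set mid)"
    then obtain ys where ys: "chordless (ys @ [s])" "separate (set ys) (set mid)" "hd (ys @ [s]) = u"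
      using reach_chordless_path[of u s "set mid"] by (auto simp: pre)
    moreover have "u \<in> set (ys @ [s])" using ys(3) hd_in_set[of "ys @ [s]"] by simp
    ultimately show "u \<in> \<Union> (set ` extensions pre mid)" unfolding ext by blast
  qed
qed

text \<open>A chordless path repeats no point, so a finite region contains only finitely many of
  them.\<close>

lemma finite_extensions:
  "finite (extensions pre mid) \<longleftrightarrow> finite (\<Union> (set ` extensions pre mid))"
proof
  assume fin: "finite (\<Union> (set ` extensions pre mid))"
  have "extensions pre mid \<subseteq> {x. set x \<subseteq> \<Union> (set ` extensions pre mid) \<and> distinct x}"
    using chordless_distinct by (auto simp: extensions_def chordless_append)
  then show "finite (extensions pre mid)"
    using finite_subset_distinct[OF fin] finite_subset by blast
qed auto

definition ext_pairs :: "pos list \<Rightarrow> pos list \<Rightarrow> pos list \<Rightarrow> (pos list \<times> pos list) set" where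
  "ext_pairs pre mid post = {(x, y). take 1 (rev x) = pre \<and> take 1 y = post \<and> chordless (x @ mid @ y)}"

context
  fixes pre mid post :: "pos list"
  assumes ch: "chordless (pre @ mid @ post)" and len: "length pre \<le> 1" "length post \<le> 1" and mid: "mid \<noteq> []"
begin

text \<open>Each component alone must suit the segment and the prescribed point on the other side;
  the only joint condition is separation. Reversing the second component makes it an extension in
  the sense of \<open>extensions\<close>.\<close>

lemma ext_pairs_iff:
  "(x, y) \<in> ext_pairs pre mid post \<longleftrightarrow>
    x \<in> extensions pre (mid @ post) \<and> rev y \<in> extensions post (rev mid @ rev pre) \<and> separate (set x) (set y)"
proof -
  have y: "chordless (rev y @ rev mid @ rev pre) = chordless (pre @ mid @ y)"
    using chordless_rev[of "pre @ mid @ y"] by simp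
  have "separate (set x) (set post)" if "separate (set x) (set y)" "take 1 y = post"
    using that in_set_takeD[of _ 1 y] by (auto simp: separate_def)
  moreover have "separate (set pre) (set y)" if "separate (set x) (set y)" "take 1 (rev x) = pre"
    using that in_set_takeD[of _ 1 "rev x"] by (fastforce simp: separate_def)
  moreover have "(x, y) \<in> ext_pairs pre mid post \<longleftrightarrow> take 1 (rev x) = pre \<and> take 1 y = post \<and>
      chordless (x @ mid) \<and> chordless (mid @ y) \<and> separate (set x) (set y)"
    unfolding ext_pairs_def using chordless_append3[OF mid, of x y] by simp
  moreover have "x \<in> extensions pre (mid @ post) \<longleftrightarrow> take 1 (rev x) = pre \<and>
      chordless (x @ mid) \<and> chordless (mid @ post) \<and> separate (set x) (set post)"
    unfolding extensions_def using chordless_append3[OF mid, of x post] by simp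
  moreover have "rev y \<in> extensions post (rev mid @ rev pre) \<longleftrightarrow> take 1 y = post \<and>
      chordless (pre @ mid) \<and> chordless (mid @ y) \<and> separate (set pre) (set y)"
    unfolding extensions_def using chordless_append3[OF mid, of pre y] y by simp
  moreover have "chordless (pre @ mid)" "chordless (mid @ post)"
    using ch chordless_append3[OF mid, of pre post] by simp_all
  ultimately show ?thesis by blast
qed

lemma pre_mem: "pre \<in> extensions pre (mid @ post)"
  using ch len by (cases pre) (auto simp: extensions_def)

lemma post_mem: "rev post \<in> extensions post (rev mid @ rev pre)"
  using ch len chordless_rev[of "pre @ mid @ post"] by (cases post) (auto simp: extensions_def)

lemma ext_separate_post: "x \<in> extensions pre (mid @ post) \<Longrightarrow> separate (set x) (set post)"
  using chordless_append3[OF mid, of x post] by (simp add: extensions_def)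

lemma ext_separate_pre: "rev y \<in> extensions post (rev mid @ rev pre) \<Longrightarrow> separate (set pre) (set y)"
  using chordless_append3[OF mid, of pre y] chordless_rev[of "pre @ mid @ y"] by (simp add: extensions_def)

text \<open>Every admissible first component occurs, because it can be paired with the shortest
  second one, \<open>post\<close>.\<close>

lemma fst_ext_pairs: "fst ` ext_pairs pre mid post = extensions pre (mid @ post)"
proof -
  have "(x, post) \<in> ext_pairs pre mid post" if "x \<in> extensions pre (mid @ post)" for x
    using that post_mem ext_separate_post by (simp add: ext_pairs_iff)
  then show ?thesis using ext_pairs_iff by force
qed

lemma snd_ext_pairs: "snd ` ext_pairs pre mid post = rev ` extensions post (rev mid @ rev pre)"
proof -
  have "(pre, y) \<in> ext_pairs pre mid post" if "rev y \<in> extensions post (rev mid @ rev pre)" for y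
    using that pre_mem ext_separate_pre by (simp add: ext_pairs_iff)
  then have "snd ` ext_pairs pre mid post = {y. rev y \<in> extensions post (rev mid @ rev pre)}"
    using ext_pairs_iff by force
  also have "\<dots> = rev ` extensions post (rev mid @ rev pre)"
  proof -
    have "y \<in> rev ` F" if "rev y \<in> F" for y :: "pos list" and F
      using imageI[OF that, of rev] by simp
    then show ?thesis by auto
  qed
  finally show ?thesis .
qed

lemma reach_pre: "\<Union> (set ` extensions pre (mid @ post)) = reach (set pre) (set mid \<union> set post)"
  using Union_extensions[of pre "mid @ post"] ch len mid by simp

lemma reach_post: "\<Union> (set ` extensions post (rev mid @ rev pre)) = reach (set post) (set mid \<union> set pre)"
proof -
  have "chordless (post @ rev mid @ rev pre)"
  proof (cases post)
    case Nil
    then show ?thesis using ch chordless_rev[of "pre @ mid"] by simp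
  next
    case (Cons p t)
    then show ?thesis using len(2) ch chordless_rev[of "pre @ mid @ post"] by simp
  qed
  then show ?thesis using Union_extensions[of post "rev mid @ rev pre"] len mid by simp
qed

lemma finite_ext_pairs:
  "finite (ext_pairs pre mid post) \<longleftrightarrow>
     finite (reach (set pre) (set mid \<union> set post)) \<and> finite (reach (set post) (set mid \<union> set pre))"
proof -
  let ?E = "extensions pre (mid @ post)" and ?F = "extensions post (rev mid @ rev pre)"
  have "finite (ext_pairs pre mid post) \<longleftrightarrow> finite ?E \<and> finite ?F"
  proof
    assume fin: "finite (ext_pairs pre mid post)"
    then have "finite ?E" using fst_ext_pairs by (metis finite_imageI)
    moreover have "finite (rev ` ?F)" using fin snd_ext_pairs by (metis finite_imageI)
    then have "finite ?F" by (rule finite_imageD) simp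
    ultimately show "finite ?E \<and> finite ?F" ..
  next
    assume "finite ?E \<and> finite ?F"
    moreover have "ext_pairs pre mid post \<subseteq> ?E \<times> rev ` ?F"
      using subset_fst_snd[of "ext_pairs pre mid post"] unfolding fst_ext_pairs snd_ext_pairs .
    ultimately show "finite (ext_pairs pre mid post)"
      by (meson finite_SigmaI finite_imageI finite_subset)
  qed
  then show ?thesis unfolding finite_extensions reach_pre reach_post .
qed

text \<open>Both projections being full, the product is attained iff any two components are
  separate. Separation quantifies over points, so it passes to the unions, which are the reachable
  regions.\<close>

lemma product_ext_pairs:
  "ext_pairs pre mid post = fst ` ext_pairs pre mid post \<times> snd ` ext_pairs pre mid post \<longleftrightarrow>
     separate (reach (set pre) (set mid \<union> set post)) (reach (set post) (set mid \<union> set pre))"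
proof -
  let ?E = "extensions pre (mid @ post)" and ?F = "extensions post (rev mid @ rev pre)"
  have "ext_pairs pre mid post = ?E \<times> rev ` ?F \<longleftrightarrow> (\<forall>x\<in>?E. \<forall>y\<in>?F. separate (set x) (set y))"
  proof -
    have "ext_pairs pre mid post \<subseteq> ?E \<times> rev ` ?F"
      using subset_fst_snd[of "ext_pairs pre mid post"] unfolding fst_ext_pairs snd_ext_pairs .
    then have "ext_pairs pre mid post = ?E \<times> rev ` ?F \<longleftrightarrow> (\<forall>x\<in>?E. \<forall>y\<in>rev ` ?F. (x, y) \<in> ext_pairs pre mid post)"
      by blast
    also have "\<dots> \<longleftrightarrow> (\<forall>x\<in>?E. \<forall>y\<in>?F. separate (set x) (set y))"
      by (simp add: ext_pairs_iff cong: ball_cong)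
    finally show ?thesis .
  qed
  also have "\<dots> \<longleftrightarrow> separate (\<Union> (set ` ?E)) (\<Union> (set ` ?F))"
    unfolding separate_def by blast
  finally show ?thesis unfolding fst_ext_pairs snd_ext_pairs reach_pre reach_post .
qed

end

section \<open>Boundary codes and the sets W(i,j) of a fixed configuration\<close>

lemma bc_eq_iff: "bc C p = bc C' p \<longleftrightarrow> {q \<in> set C. adj p q} = {q \<in> set C'. adj p q}"
proof -
  obtain x y where p: "p = (x, y)" by (cases p)
  have adj: "adj p q \<longleftrightarrow> q \<in> {(x + 1, y), (x, y + 1), (x - 1, y), (x, y - 1)}" for q
  proof -
    obtain u v where q: "q = (u, v)" by (cases q)
    from abs_sum_eq_1[of "u - x" "v - y"] show ?thesis
      unfolding p q adj_def fst_conv snd_conv insert_iff prod.inject by (simp add: algebra_simps)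
  qed
  have "{q \<in> set C. adj p q} = {q \<in> set C'. adj p q} \<longleftrightarrow>
      (\<forall>q\<in>{(x + 1, y), (x, y + 1), (x - 1, y), (x, y - 1)}. q \<in> set C \<longleftrightarrow> q \<in> set C')"
    unfolding adj by blast
  then show ?thesis unfolding bc_def epsl_def p by simp
qed

lemma neighbours_Cons: "chordless (p # ys) \<Longrightarrow> {q \<in> set ys. adj p q} = set (take 1 ys)"
  by (cases ys) (auto simp: separate_def touch_def)

text \<open>Chords being excluded, only predecessor and successor are adjacent to \<open>p\<close>;
  a boundary code thus tells who these are, but not in which order they come.\<close>

lemma neighbours:
  assumes "chordless (xs @ p # ys)"
  shows "{q \<in> set (xs @ p # ys). adj p q} = set (take 1 (rev xs)) \<union> set (take 1 ys)"
proof -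
  have "chordless (p # ys)" "chordless (xs @ [p])"
    using assms chordless_append[of xs "p # ys"] chordless_append[of "xs @ [p]" ys] by auto
  moreover from this have "chordless (p # rev xs)" using chordless_rev[of "xs @ [p]"] by simp
  ultimately have "{q \<in> set ys. adj p q} = set (take 1 ys)" "{q \<in> set (rev xs). adj p q} = set (take 1 (rev xs))"
    using neighbours_Cons[of p ys] neighbours_Cons[of p "rev xs"] by simp_all
  moreover have "{q \<in> set (xs @ p # ys). adj p q} = {q \<in> set (rev xs). adj p q} \<union> {q \<in> set ys. adj p q}"
    by auto
  ultimately show ?thesis by simp
qed

lemma set_eq_length_le_1: "set xs = set ys \<Longrightarrow> length xs \<le> 1 \<Longrightarrow> length ys \<le> 1 \<Longrightarrow> xs = ys"
  by (cases xs; cases ys) auto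

lemma take_1_conv: "take 1 xs = (if xs = [] then [] else [hd xs])"
  by (cases xs) auto

locale config =
  fixes ps :: "pos list" and og :: nat
  assumes config: "is_config ps og"
begin

abbreviation "m \<equiv> length ps"

definition pre :: "nat \<Rightarrow> pos list" where "pre a = (if a = 0 then [] else [ps ! (a - 1)])"

definition post :: "nat \<Rightarrow> pos list" where "post b = (if Suc b < m then [ps ! Suc b] else [])"

definition seg :: "nat \<Rightarrow> nat \<Rightarrow> pos list" where "seg a b = take (Suc b - a) (drop a ps)"

lemma chordless_ps: "chordless ps" and og: "og < m" "ps ! og = (0, 0)"
  using config by (auto simp: is_config_iff)

lemma length_pre: "length (pre a) \<le> 1" and length_post: "length (post b) \<le> 1"
  by (auto simp: pre_def post_def)

lemma length_seg: "a \<le> b \<Longrightarrow> b < m \<Longrightarrow> length (seg a b) = Suc b - a"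
  by (simp add: seg_def)

lemma seg_nth: "i \<le> b - a \<Longrightarrow> a \<le> b \<Longrightarrow> b < m \<Longrightarrow> seg a b ! i = ps ! (a + i)"
  by (simp add: seg_def)

lemma seg_ne: "a \<le> b \<Longrightarrow> b < m \<Longrightarrow> seg a b \<noteq> []"
  using length_seg[of a b] by fastforce

lemma set_seg: "a \<le> b \<Longrightarrow> b < m \<Longrightarrow> set (seg a b) = (!) ps ` {a..b}"
proof -
  assume ab: "a \<le> b" "b < m"
  have "seg a b = map ((!) ps) [a..<Suc b]"
    by (rule nth_equalityI) (use ab in \<open>simp_all add: length_seg seg_nth del: upt_Suc\<close>)
  then show ?thesis by (simp add: atLeastLessThanSuc_atLeastAtMost del: upt_Suc)
qed

lemma take_1_rev_take: "l < m \<Longrightarrow> take 1 (rev (take l ps)) = pre l"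
  by (cases l) (auto simp: pre_def take_Suc_conv_app_nth)

lemma take_1_drop: "take 1 (drop (Suc l) ps) = post l"
proof (cases "Suc l < m")
  case True
  then have "drop (Suc l) ps = ps ! Suc l # drop (Suc (Suc l)) ps" by (simp add: Cons_nth_drop_Suc)
  then show ?thesis using True by (simp add: post_def)
qed (simp add: post_def)

lemma split_ps:
  assumes "a \<le> b" "b < m"
  shows "ps = take a ps @ seg a b @ drop (Suc b) ps"
proof -
  have "drop (Suc b) ps = drop (Suc b - a) (drop a ps)" using assms by simp
  then show ?thesis unfolding seg_def by (metis append_take_drop_id)
qed

lemma chordless_pre_seg_post:
  assumes "a \<le> b" "b < m"
  shows "chordless (pre a @ seg a b @ post b)"
proof -
  obtain t where t: "take a ps = t @ pre a"
    using assms by (cases a) (auto simp: pre_def take_Suc_conv_app_nth)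
  obtain d where d: "drop (Suc b) ps = post b @ d"
    using take_1_drop[of b] append_take_drop_id[of 1 "drop (Suc b) ps"] by metis
  have "chordless (t @ (pre a @ seg a b @ post b) @ d)"
    using chordless_ps split_ps[OF assms] unfolding t d by simp
  then show ?thesis using chordless_append by blast
qed

text \<open>Strictly inside the segment both codes see the same two neighbours, so the code
  condition has content only at \<open>a\<close> and \<open>b\<close>. The origin lies in the
  segment and hence at the right place of every extension.\<close>

lemma mem_Wset:
  assumes "valid_range ps og a b"
  shows "(x, y) \<in> Wset ps og a b \<longleftrightarrow> chordless (x @ seg a b @ y) \<and>
    (\<forall>l. a \<le> l \<and> l \<le> b \<longrightarrow> set (if l = a then take 1 (rev x) else [ps ! (l - 1)]) \<union>
      set (if l = b then take 1 y else [ps ! Suc l]) = set (pre l) \<union> set (post l))"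
proof -
  have ab: "a \<le> og" "og \<le> b" "a \<le> b" "b < m" using assms by (auto simp: valid_range_def)
  let ?C = "x @ seg a b @ y"
  have "og - a < Suc b - a" using ab by linarith
  then have "(seg a b @ y) ! (og - a) = seg a b ! (og - a)" using ab by (simp add: nth_append length_seg)
  then have "?C ! (length x + (og - a)) = seg a b ! (og - a)" by (simp only: nth_append_length_plus)
  also have "\<dots> = (0, 0)" using seg_nth[of "og - a" b a] ab og by simp
  finally have "?C ! (length x + (og - a)) = (0, 0)" .
  moreover have "length x + (og - a) < length ?C"
    unfolding length_append length_seg[OF ab(3,4)] using ab by linarith
  ultimately have cfg: "is_config ?C (length x + (og - a)) \<longleftrightarrow> chordless ?C"
    unfolding is_config_iff by blast
  have bc: "bc ?C (ps ! l) = bc ps (ps ! l) \<longleftrightarrow> set (if l = a then take 1 (rev x) else [ps ! (l - 1)]) \<union>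
      set (if l = b then take 1 y else [ps ! Suc l]) = set (pre l) \<union> set (post l)"
    if ch: "chordless ?C" and l: "a \<le> l" "l \<le> b" for l
  proof -
    let ?i = "l - a"
    have "seg a b = take ?i (seg a b) @ seg a b ! ?i # drop (Suc ?i) (seg a b)"
      using l ab length_seg[of a b] by (intro id_take_nth_drop) auto
    then have C: "?C = (x @ take ?i (seg a b)) @ ps ! l # (drop (Suc ?i) (seg a b) @ y)"
      using seg_nth[of ?i b a] l ab by simp
    have "take 1 (rev (x @ take ?i (seg a b))) = (if l = a then take 1 (rev x) else [ps ! (l - 1)])"
    proof (cases "l = a")
      case False
      define j where "j = l - a - 1"
      have j: "?i = Suc j" using False l by (simp add: j_def)
      then have "take ?i (seg a b) = take j (seg a b) @ [seg a b ! j]"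
        using ab l length_seg[of a b] by (simp add: take_Suc_conv_app_nth)
      moreover have "seg a b ! j = ps ! (l - 1)" 
      proof -
        have "a + j = l - 1" "j \<le> b - a" using j l by linarith+
        then show ?thesis using seg_nth[of j b a] ab by simp
      qed
      ultimately show ?thesis using False by simp
    qed simp
    moreover have "take 1 (drop (Suc ?i) (seg a b) @ y) = (if l = b then take 1 y else [ps ! Suc l])"
    proof (cases "l = b")
      case False
      then have "Suc ?i < length (seg a b)" using l ab length_seg[of a b] by simp
      moreover have "seg a b ! Suc ?i = ps ! Suc l" using seg_nth[of "Suc ?i" b a] False l ab by simp
      ultimately have "drop (Suc ?i) (seg a b) = ps ! Suc l # drop (Suc (Suc ?i)) (seg a b)"
        by (metis Cons_nth_drop_Suc)
      then show ?thesis using False by simp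
    qed (use length_seg[of a b] ab in simp)
    moreover have "{q \<in> set ?C. adj (ps ! l) q} = set (take 1 (rev (x @ take ?i (seg a b)))) \<union> set (take 1 (drop (Suc ?i) (seg a b) @ y))"
      using neighbours ch unfolding C by blast
    moreover have "{q \<in> set ps. adj (ps ! l) q} = set (pre l) \<union> set (post l)"
    proof -
      have lm: "l < m" using l ab by simp
      then have ps: "ps = take l ps @ ps ! l # drop (Suc l) ps" by (rule id_take_nth_drop)
      then have "{q \<in> set ps. adj (ps ! l) q} = set (take 1 (rev (take l ps))) \<union> set (take 1 (drop (Suc l) ps))"
        using neighbours[of "take l ps" "ps ! l" "drop (Suc l) ps"] chordless_ps by simp
      then show ?thesis unfolding take_1_rev_take[OF lm] take_1_drop .
    qed
    ultimately show ?thesis unfolding bc_eq_iff by simp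
  qed
  have "(x, y) \<in> Wset ps og a b \<longleftrightarrow> chordless ?C \<and>
      (\<forall>l. a \<le> l \<and> l \<le> b \<longrightarrow> bc ?C (ps ! l) = bc ps (ps ! l))"
    unfolding Wset_def Let_def mem_Collect_eq prod.case cfg[symmetric] seg_def[symmetric] ..
  then show ?thesis
    by (simp only:) (intro conj_cong refl all_cong1 imp_cong, elim conjE, rule bc)
qed

text \<open>If \<open>a < b\<close>, each end of the segment has a known neighbour inside it,
  distinct from the outer one; cancelling it identifies the outer neighbour.\<close>

lemma Wset_eq_ext_pairs:
  assumes "valid_range ps og a b" "a < b"
  shows "Wset ps og a b = ext_pairs (pre a) (seg a b) (post b)"
proof -
  have ab: "b < m" using assms by (auto simp: valid_range_def)
  have dist: "distinct ps" using chordless_ps chordless_distinct by blast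
  have in_seg: "ps ! i \<in> set (seg a b)" if "a \<le> i" "i \<le> b" for i
    using that set_seg[of a b] ab by simp
  have "(x, y) \<in> Wset ps og a b \<longleftrightarrow> (x, y) \<in> ext_pairs (pre a) (seg a b) (post b)" for x y
  proof
    assume xy: "(x, y) \<in> ext_pairs (pre a) (seg a b) (post b)"
    then show "(x, y) \<in> Wset ps og a b"
      unfolding mem_Wset[OF assms(1)] ext_pairs_def using assms(2) ab by (auto simp: pre_def post_def)
  next
    assume "(x, y) \<in> Wset ps og a b"
    then have ch: "chordless (x @ seg a b @ y)" and
      l: "\<And>l. a \<le> l \<Longrightarrow> l \<le> b \<Longrightarrow> set (if l = a then take 1 (rev x) else [ps ! (l - 1)]) \<union>
      set (if l = b then take 1 y else [ps ! Suc l]) = set (pre l) \<union> set (post l)"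
      unfolding mem_Wset[OF assms(1)] by auto
    have d: "distinct (x @ seg a b @ y)" using ch chordless_distinct by blast
    have "ps ! Suc a \<notin> set (take 1 (rev x))"
      using d in_seg[of "Suc a"] assms(2) set_take_subset[of 1 "rev x"] by auto
    moreover have "ps ! Suc a \<notin> set (pre a)"
      using dist assms(2) ab by (auto simp: pre_def nth_eq_iff_index_eq)
    moreover have "set (take 1 (rev x)) \<union> {ps ! Suc a} = set (pre a) \<union> {ps ! Suc a}"
      using l[of a] assms(2) ab by (simp add: post_def)
    ultimately have "set (take 1 (rev x)) = set (pre a)" by blast
    then have 1: "take 1 (rev x) = pre a" using length_pre by (intro set_eq_length_le_1) auto
    have le_pred: "a \<le> b - 1" using assms(2) by simp
    have "ps ! (b - 1) \<notin> set (take 1 y)"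
      using d in_seg[of "b - 1", OF le_pred] assms(2) set_take_subset[of 1 y] by auto
    moreover have "ps ! (b - 1) \<notin> set (post b)"
      using dist assms(2) ab by (auto simp: post_def nth_eq_iff_index_eq)
    moreover have "{ps ! (b - 1)} \<union> set (take 1 y) = {ps ! (b - 1)} \<union> set (post b)"
      using l[of b] assms(2) ab by (simp add: pre_def)
    ultimately have "set (take 1 y) = set (post b)" by (metis Diff_insert_absorb insert_is_Un)
    then have "take 1 y = post b" using length_post by (intro set_eq_length_le_1) auto
    then show "(x, y) \<in> ext_pairs (pre a) (seg a b) (post b)" using 1 ch by (simp add: ext_pairs_def)
  qed
  then show ?thesis by auto
qed

definition ext_pre :: "nat \<Rightarrow> nat \<Rightarrow> pos set" where
  "ext_pre a b = reach (set (pre a)) (set (seg a b) \<union> set (post b))"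

definition ext_post :: "nat \<Rightarrow> nat \<Rightarrow> pos set" where
  "ext_post a b = reach (set (post b)) (set (seg a b) \<union> set (pre a))"

definition bounded_ext :: "nat \<Rightarrow> nat \<Rightarrow> bool" where
  "bounded_ext a b \<longleftrightarrow> finite (ext_pre a b) \<and> finite (ext_post a b)"

text \<open>For \<open>a = b\<close> only the two neighbours of the origin are prescribed, not their order along the path:
  besides the expected pairs, \<open>Wset\<close> contains their mirror images.\<close>
lemma Wset_origin:
  "Wset ps og og og = ext_pairs (pre og) (seg og og) (post og) \<union>
     (\<lambda>(x, y). (rev y, rev x)) ` ext_pairs (pre og) (seg og og) (post og)" (is "_ = ?E \<union> ?F")
proof -
  have v: "valid_range ps og og og" using og by (simp add: valid_range_def)
  have seg: "seg og og = [ps ! og]" using og by (simp add: seg_def take_Suc_conv_app_nth take_1_conv hd_drop_conv_nth)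
  have dist: "distinct (pre og @ seg og og @ post og)"
    using chordless_pre_seg_post[of og og] og chordless_distinct by blast
  have "(x, y) \<in> Wset ps og og og \<longleftrightarrow> (x, y) \<in> ?E \<or> (rev y, rev x) \<in> ?E" for x y
  proof -
    have W: "(x, y) \<in> Wset ps og og og \<longleftrightarrow> chordless (x @ seg og og @ y) \<and>
      set (take 1 (rev x)) \<union> set (take 1 y) = set (pre og) \<union> set (post og)"
    proof -
      have "og \<le> l \<and> l \<le> og \<longleftrightarrow> l = og" for l by auto
      then show ?thesis unfolding mem_Wset[OF v] by (simp only: simp_thms if_True)
    qed
    have E: "(rev y, rev x) \<in> ?E \<longleftrightarrow> chordless (x @ seg og og @ y) \<and> take 1 (rev x) = post og \<and> take 1 y = pre og"
      using chordless_rev[of "x @ seg og og @ y"] by (auto simp: ext_pairs_def seg)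
    have "set (take 1 (rev x)) \<union> set (take 1 y) = set (pre og) \<union> set (post og) \<longleftrightarrow>
      take 1 (rev x) = pre og \<and> take 1 y = post og \<or> take 1 (rev x) = post og \<and> take 1 y = pre og"
      if "chordless (x @ seg og og @ y)"
    proof -
      \<comment> \<open>Two disjoint sets with at most one element each and a given union are
        determined up to exchange.\<close>
      have "distinct (x @ seg og og @ y)" using that chordless_distinct by blast
      then have "set (take 1 (rev x)) \<inter> set (take 1 y) = {}"
        using set_take_subset[of 1 "rev x"] set_take_subset[of 1 y] by auto
      moreover have "set (pre og) \<inter> set (post og) = {}" using dist by auto
      ultimately show ?thesis
        unfolding take_1_conv pre_def post_def by (auto simp: doubleton_eq_iff split: if_splits)
    qed
    then show ?thesis unfolding W E by (auto simp: ext_pairs_def)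
  qed
  then show ?thesis by (force simp: image_iff)
qed

lemma original_mem: "(take og ps, drop (Suc og) ps) \<in> ext_pairs (pre og) (seg og og) (post og)"
  using split_ps[of og og] chordless_ps take_1_rev_take[of og] take_1_drop[of og] og
  by (simp add: ext_pairs_def)

lemma finite_Wset:
  assumes "valid_range ps og a b"
  shows "finite (Wset ps og a b) \<longleftrightarrow> bounded_ext a b"
proof -
  have ab: "a \<le> b" "b < m" using assms by (auto simp: valid_range_def)
  have "finite (Wset ps og a b) \<longleftrightarrow> finite (ext_pairs (pre a) (seg a b) (post b))"
  proof (cases "a = b")
    case True
    then have "a = og" "b = og" using assms by (auto simp: valid_range_def)
    then show ?thesis using finite_imageI by (auto simp: Wset_origin)
  next
    case False
    then show ?thesis using Wset_eq_ext_pairs[OF assms] ab by simp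
  qed
  then show ?thesis
    using finite_ext_pairs[OF chordless_pre_seg_post[OF ab] length_pre length_post seg_ne[OF ab]]
    by (simp add: bounded_ext_def ext_pre_def ext_post_def)
qed

text \<open>For \<open>a = b\<close> and more than one point, \<open>Wset\<close> contains the
  original pair and its mirror image. A product would also contain \<open>(x, rev x)\<close>, formed
  from the first component of one and the second of the other, and this is not a path unless
  \<open>x\<close> is empty.\<close>

lemma NI_iff:
  assumes "valid_range ps og a b"
  shows "NI ps og a b \<longleftrightarrow> (if a = b then m = 1 else separate (ext_pre a b) (ext_post a b))"
proof (cases "a = b")
  case False
  have ab: "a \<le> b" "b < m" using assms by (auto simp: valid_range_def)
  have less: "a < b" using False ab by simp
  have "NI ps og a b \<longleftrightarrow> separate (ext_pre a b) (ext_post a b)"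
    unfolding NI_def Uset_def Vset_def Wset_eq_ext_pairs[OF assms less] ext_pre_def ext_post_def
    by (rule product_ext_pairs[OF chordless_pre_seg_post[OF ab] length_pre length_post seg_ne[OF ab]])
  then show ?thesis using False by simp
next
  case True
  then have [simp]: "a = og" "b = og" using assms by (auto simp: valid_range_def)
  let ?W = "Wset ps og og og"
  let ?x = "take og ps" and ?y = "drop (Suc og) ps"
  have W1: "(?x, ?y) \<in> ?W" and W2: "(rev ?y, rev ?x) \<in> ?W"
    unfolding Wset_origin using original_mem by force+
  show ?thesis
  proof (cases "m = 1")
    case True
    then have "pre og = []" "post og = []" using og by (auto simp: pre_def post_def)
    then have "ext_pairs (pre og) (seg og og) (post og) \<subseteq> {([], [])}"
      by (auto simp: ext_pairs_def take_1_conv split: if_splits)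
    then have "?W \<subseteq> {([], [])}" unfolding Wset_origin by auto
    moreover have "?x = []" "?y = []" using True og by auto
    ultimately have "?W = {([], [])}" using W1 by auto
    then show ?thesis using True by (simp add: NI_def Uset_def Vset_def)
  next
    case False
    have v: "valid_range ps og og og" using og by (simp add: valid_range_def)
    have disj: "set x \<inter> set y = {}" if "(x, y) \<in> ?W" for x y
      using that chordless_distinct unfolding mem_Wset[OF v] by fastforce
    have "\<not> NI ps og og og"
    proof
      assume "NI ps og og og"
      then have "(?x, rev ?x) \<in> ?W" "(rev ?y, ?y) \<in> ?W"
        using imageI[OF W1, of fst] imageI[OF W1, of snd] imageI[OF W2, of fst] imageI[OF W2, of snd]
        unfolding NI_def Uset_def Vset_def fst_conv snd_conv by (metis mem_Sigma_iff)+
      then have "set ?x = {}" "set ?y = {}" using disj[of ?x "rev ?x"] disj[of "rev ?y" ?y] by auto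
      then have "?x = []" "?y = []" by (simp_all only: set_empty)
      then show False using False og by auto
    qed
    then show ?thesis using False by simp
  qed
qed

text \<open>The three index sets are merged: a pair with a finite extension set lies in K, so their
  union consists of the pairs for which this set or that of a one-point enlargement is
  finite.\<close>

lemma CNI_iff:
  "CNI ps og \<longleftrightarrow> (\<forall>a b. a \<le> og \<and> og \<le> b \<and> b < m \<and>
     (bounded_ext a b \<or> (1 \<le> a \<and> bounded_ext (a - 1) b) \<or> (Suc b < m \<and> bounded_ext a (Suc b))) \<longrightarrow>
     (if a = b then m = 1 else separate (ext_pre a b) (ext_post a b)))"
proof -
  have "inI ps og a b \<or> inJ ps og a b \<or> inK ps og a b \<longleftrightarrow> valid_range ps og a b \<and>
     (bounded_ext a b \<or> (1 \<le> a \<and> bounded_ext (a - 1) b) \<or> (Suc b < m \<and> bounded_ext a (Suc b)))" for a b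
  proof (cases "valid_range ps og a b")
    case True
    have "1 \<le> a \<Longrightarrow> valid_range ps og (a - 1) b" "Suc b < m \<Longrightarrow> valid_range ps og a (Suc b)"
      using True by (auto simp: valid_range_def)
    then show ?thesis using True finite_Wset unfolding inI_def inJ_def inK_def by blast
  qed (simp add: inI_def inJ_def inK_def)
  then show ?thesis unfolding CNI_def using NI_iff by (auto simp: valid_range_def)
qed

end

subsection \<open>Reachability on a linearised grid\<close>

text \<open>Adjacency of cells numbered row by row with rows of length \<open>w\<close>, including
  the false adjacency of the last cell of a row and the first of the next.\<close>

definition nbr :: "nat \<Rightarrow> nat \<Rightarrow> nat \<Rightarrow> bool" where
  "nbr w u v \<longleftrightarrow> v = Suc u \<or> u = Suc v \<or> v = u + w \<or> u = v + w"

definition nbh :: "nat \<Rightarrow> nat set \<Rightarrow> nat set" where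
  "nbh w X = X \<union> {v. \<exists>u\<in>X. nbr w u v}"

inductive_set flood :: "nat \<Rightarrow> nat set \<Rightarrow> nat set \<Rightarrow> nat set" for w S F where
  start: "s \<in> S \<Longrightarrow> s \<in> flood w S F"
| step: "u \<in> flood w S F \<Longrightarrow> nbr w u v \<Longrightarrow> v \<in> F \<Longrightarrow> v \<in> flood w S F"

text \<open>The iterates increase inside the finite set \<open>B\<close>, and once two consecutive
  ones agree they stay constant, so \<open>card B\<close> rounds suffice.\<close>

lemma flood_iterate:
  assumes "S \<subseteq> B" "F \<subseteq> B" "finite B" "card B \<le> n"
  shows "((\<lambda>M. M \<union> (nbh w M \<inter> F)) ^^ n) S = flood w S F"
proof -
  let ?f = "\<lambda>M. M \<union> (nbh w M \<inter> F)"
  have sub: "(?f ^^ i) S \<subseteq> flood w S F" for i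
  proof (induction i)
    case 0
    then show ?case by (auto intro: flood.start)
  next
    case (Suc i)
    then show ?case by (auto simp: nbh_def intro: flood.step)
  qed
  have B: "(?f ^^ i) S \<subseteq> B" for i
    by (induction i) (use assms in auto)
  have inc: "(?f ^^ i) S \<subseteq> (?f ^^ Suc i) S" for i by auto
  \<comment> \<open>By counting: \<open>i\<close> strict increases would produce at least
    \<open>i\<close> elements.\<close>
  have card: "\<exists>j<i. (?f ^^ Suc j) S = (?f ^^ j) S" if "card ((?f ^^ i) S) < i" for i
    using that
  proof (induction i)
    case (Suc i)
    show ?case
    proof (cases "(?f ^^ Suc i) S = (?f ^^ i) S")
      case False
      then have "(?f ^^ i) S \<subset> (?f ^^ Suc i) S" using inc by blast
      then have "card ((?f ^^ i) S) < card ((?f ^^ Suc i) S)"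
        by (rule psubset_card_mono[rotated]) (rule finite_subset[OF B assms(3)])
      then have "card ((?f ^^ i) S) < i" using Suc.prems by linarith
      then show ?thesis using Suc.IH less_SucI by blast
    qed blast
  qed simp
  have "card ((?f ^^ Suc n) S) < Suc n"
    using card_mono[OF assms(3) B] assms(4) by (meson le_imp_less_Suc le_trans)
  then obtain j where j: "j \<le> n" "(?f ^^ Suc j) S = (?f ^^ j) S" using card by (meson less_Suc_eq_le)
  have fix_j: "(?f ^^ (k + j)) S = (?f ^^ j) S" for k
  proof (induction k)
    case (Suc k)
    have "(?f ^^ (Suc k + j)) S = ?f ((?f ^^ (k + j)) S)" by simp
    also have "\<dots> = (?f ^^ Suc j) S" unfolding Suc.IH by simp
    finally show ?case unfolding j(2) .
  qed simp
  have n: "(?f ^^ n) S = (?f ^^ j) S" using fix_j[of "n - j"] j(1) by simp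
  have "u \<in> (?f ^^ j) S" if "u \<in> flood w S F" for u
    using that
  proof (induction rule: flood.induct)
    case (start s)
    have "S \<subseteq> (?f ^^ i) S" for i by (induction i) auto
    then show ?case using start by blast
  next
    case (step u v)
    then have "v \<in> (?f ^^ Suc j) S" by (auto simp: nbh_def)
    then show ?case by (simp only: j(2))
  qed
  then show ?thesis using sub n by blast
qed

lemma reach_line:
  assumes "\<And>i. i \<le> n \<Longrightarrow> separate {f i} B" "\<And>i. i < n \<Longrightarrow> adj (f i) (f (Suc i))" "f (0::nat) \<in> reach S B"
  shows "f n \<in> reach S B"
  using assms by (induction n) (auto intro: reach.step)

section \<open>A box of the plane with cells numbered row by row\<close>

locale grid =
  fixes L :: nat and base :: pos
  assumes L: "3 \<le> L"
begin

definition dx :: "pos \<Rightarrow> int" where "dx p = fst p - fst base"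

definition dy :: "pos \<Rightarrow> int" where "dy p = snd p - snd base"

text \<open>The obstacles and all points touching them will lie in \<open>core\<close>, so its
  outside is free. \<open>window\<close> adds the surrounding ring of cells, onto which the outside
  is retracted.\<close>

definition core :: "pos set" where "core = {p. \<bar>dx p\<bar> < int L \<and> \<bar>dy p\<bar> < int L}"

definition window :: "pos set" where "window = {p. \<bar>dx p\<bar> \<le> int L \<and> \<bar>dy p\<bar> \<le> int L}"

text \<open>The window has \<open>2 * L + 1\<close> columns, so rows of length \<open>3 * L\<close>
  leave a gap before the next row begins.\<close>

definition index :: "pos \<Rightarrow> nat" where
  "index p = nat (dx p + int L + 3 * int L * (dy p + int L))"

definition pos_at :: "nat \<Rightarrow> pos" where
  "pos_at k = (fst base + int (k mod (3 * L)) - int L, snd base + int (k div (3 * L)) - int L)"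

definition clamp :: "pos \<Rightarrow> pos" where
  "clamp p = (fst base + max (- int L) (min (int L) (dx p)), snd base + max (- int L) (min (int L) (dy p)))"

abbreviation "nb \<equiv> nbh (3 * L)"

lemma dx_pos_at: "dx (pos_at k) = int (k mod (3 * L)) - int L" and dy_pos_at: "dy (pos_at k) = int (k div (3 * L)) - int L"
  by (auto simp: dx_def dy_def pos_at_def)

lemma dx_clamp: "dx (clamp p) = max (- int L) (min (int L) (dx p))" and dy_clamp: "dy (clamp p) = max (- int L) (min (int L) (dy p))"
  by (auto simp: dx_def dy_def clamp_def)

lemma adj_iff: "adj p q \<longleftrightarrow> \<bar>dx q - dx p\<bar> + \<bar>dy q - dy p\<bar> = 1"
  by (simp add: adj_def dx_def dy_def)

lemma pos_eq_iff: "p = q \<longleftrightarrow> dx p = dx q \<and> dy p = dy q"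
  by (auto simp: dx_def dy_def prod_eq_iff)

lemma touch_iff: "touch p q \<longleftrightarrow> \<bar>dx q - dx p\<bar> + \<bar>dy q - dy p\<bar> \<le> 1"
  unfolding touch_def pos_eq_iff[of p q] adj_iff by linarith

lemma core_window: "core \<subseteq> window"
  by (auto simp: core_def window_def)

lemma clamp_window: "clamp p \<in> window"
  by (auto simp: window_def dx_clamp dy_clamp)

lemma clamp_id: "p \<in> window \<Longrightarrow> clamp p = p"
  by (auto simp: pos_eq_iff[of "clamp p"] dx_clamp dy_clamp window_def)

lemma clamp_core: "clamp p \<in> core \<longleftrightarrow> p \<in> core"
  by (auto simp: core_def dx_clamp dy_clamp)

text \<open>Cutting off each coordinate does not increase distances, so the retraction maps walks to
  walks with pauses.\<close>

lemma clamp_touch: "touch p q \<Longrightarrow> touch (clamp p) (clamp q)"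
proof -
  assume "touch p q"
  moreover have "\<bar>max (- int L) (min (int L) x) - max (- int L) (min (int L) y)\<bar> \<le> \<bar>x - y\<bar>" for x y
    by (simp add: max_def min_def)
  from this[of "dx q" "dx p"] this[of "dy q" "dy p"]
  have "\<bar>dx (clamp q) - dx (clamp p)\<bar> + \<bar>dy (clamp q) - dy (clamp p)\<bar> \<le> \<bar>dx q - dx p\<bar> + \<bar>dy q - dy p\<bar>"
    unfolding dx_clamp dy_clamp by (rule add_mono)
  ultimately show ?thesis unfolding touch_iff by linarith
qed

lemma index_pos_at [simp]: "index (pos_at k) = k"
proof -
  have "int (k mod (3 * L) + 3 * L * (k div (3 * L))) = int k" by (simp only: mod_mult_div_eq)
  then have "int (k mod (3 * L)) + 3 * int L * int (k div (3 * L)) = int k"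
    by (simp only: of_nat_add of_nat_mult of_nat_numeral)
  then show ?thesis unfolding index_def dx_pos_at dy_pos_at by simp
qed

lemma index_int: "p \<in> window \<Longrightarrow> int (index p) = dx p + int L + 3 * int L * (dy p + int L)"
  by (auto simp: index_def window_def)

text \<open>The number of cells is quadratic in \<open>L\<close>; the bound \<open>L ^ 4\<close> is
  taken because four nested loops produce the set \<open>{..L ^ 4}\<close>, and
  \<open>3 \<le> L\<close> absorbs the constants.\<close>

lemma index_le: "p \<in> window \<Longrightarrow> index p \<le> L ^ 4"
proof -
  assume p: "p \<in> window"
  have "3 * int L * (dy p + int L) \<le> 3 * int L * (2 * int L)" using p by (intro mult_left_mono) (auto simp: window_def)
  then have "int (index p) \<le> 2 * int L + 6 * (int L * int L)"
    using index_int[OF p] p by (auto simp: window_def)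
  also have "\<dots> \<le> 9 * (int L * int L)"
    using L mult_right_mono[of 3 "int L" "int L"] by simp
  also have "\<dots> \<le> (int L * int L) * (int L * int L)"
    using L mult_mono[of 3 "int L" 3 "int L"] by (intro mult_right_mono) auto
  finally have "int (index p) \<le> int (L ^ 4)" by (simp add: power4_eq_xxxx)
  then show ?thesis by simp
qed

text \<open>Rows have length \<open>3 * L\<close>, so indices of nearby points in the window determine them.\<close>
lemma small_combination: "\<bar>a\<bar> < 3 * int L \<Longrightarrow> a + 3 * int L * b = 0 \<Longrightarrow> a = 0 \<and> b = 0"
proof -
  assume a: "\<bar>a\<bar> < 3 * int L" and e: "a + 3 * int L * b = 0"
  have "b = 0"
  proof (rule ccontr)
    assume "b \<noteq> 0"
    then have "3 * int L * 1 \<le> 3 * int L * \<bar>b\<bar>" by (intro mult_left_mono) auto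
    also have "\<dots> = \<bar>a\<bar>" using e by (simp add: abs_mult eq_neg_iff_add_eq_0[symmetric])
    finally show False using a by simp
  qed
  then show ?thesis using e by simp
qed

lemma touch_index:
  assumes "p \<in> window" "q \<in> window" "touch p q"
  shows "index p = index q \<or> nbr (3 * L) (index p) (index q)"
proof (cases "p = q")
  case False
  define a c where "a = dx q - dx p" and "c = dy q - dy p"
  have d: "int (index q) - int (index p) = a + 3 * int L * c"
    using index_int[OF assms(1)] index_int[OF assms(2)] by (simp add: algebra_simps a_def c_def)
  have "\<bar>a\<bar> + \<bar>c\<bar> = 1" using False assms(3) by (simp add: touch_def adj_iff a_def c_def)
  then consider "a = 1" "c = 0" | "a = 0" "c = 1" | "a = -1" "c = 0" | "a = 0" "c = -1"
    unfolding abs_sum_eq_1 by blast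
  then show ?thesis unfolding nbr_def by cases (use d in simp_all)
qed simp

text \<open>The horizontal difference is below \<open>2 * L\<close> in absolute value; corrected by
  1 it is still below the row length, so \<open>small_combination\<close> determines both
  differences.\<close>

lemma index_touch:
  assumes "p \<in> window" "q \<in> core" "index p = index q \<or> nbr (3 * L) (index p) (index q)"
  shows "touch p q"
proof -
  have q: "q \<in> window" using assms(2) core_window by blast
  have b: "\<bar>dx p\<bar> \<le> int L" "\<bar>dx q\<bar> < int L" using assms(1,2) by (auto simp: window_def core_def)
  define a c where "a = dx q - dx p" and "c = dy q - dy p"
  have d: "int (index q) - int (index p) = a + 3 * int L * c"
    unfolding index_int[OF assms(1)] index_int[OF q] a_def c_def by (simp add: algebra_simps)
  consider "int (index q) - int (index p) = 0" | "int (index q) - int (index p) = 1"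
    | "int (index q) - int (index p) = -1" | "int (index q) - int (index p) = 3 * int L"
    | "int (index q) - int (index p) = - (3 * int L)"
    using assms(3) unfolding nbr_def by (elim disjE) auto
  then have "\<bar>a\<bar> + \<bar>c\<bar> \<le> 1"
  proof cases
    case 1
    then have "a = 0 \<and> c = 0" using small_combination[of a c] d b by (simp add: a_def)
    then show ?thesis by simp
  next
    case 2
    then have "a - 1 = 0 \<and> c = 0" using small_combination[of "a - 1" c] d b by (simp add: a_def)
    then show ?thesis by simp
  next
    case 3
    then have "a + 1 = 0 \<and> c = 0" using small_combination[of "a + 1" c] d b by (simp add: a_def)
    then show ?thesis by simp
  next
    case 4
    then have "a = 0 \<and> c - 1 = 0" using small_combination[of a "c - 1"] d b by (simp add: a_def algebra_simps)
    then show ?thesis by simp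
  next
    case 5
    then have "a = 0 \<and> c + 1 = 0" using small_combination[of a "c + 1"] d b by (simp add: a_def algebra_simps)
    then show ?thesis by simp
  qed
  then show ?thesis unfolding touch_iff a_def c_def .
qed

text \<open>A false adjacency joins column \<open>3 * L - 1\<close> to column 0, at horizontal
  offsets \<open>2 * L - 1\<close> and \<open>- L\<close> from the base, and both columns miss the
  core.\<close>

lemma nbr_pos_at:
  assumes "nbr (3 * L) u v"
  shows "touch (pos_at u) (pos_at v) \<or> pos_at u \<notin> core \<and> pos_at v \<notin> core"
proof -
  have 1: "touch (pos_at k) (pos_at (Suc k)) \<or> pos_at k \<notin> core \<and> pos_at (Suc k) \<notin> core" for k
  proof (cases "Suc (k mod (3 * L)) = 3 * L")
    case True
    then have "Suc k mod (3 * L) = 0" by (simp add: mod_Suc)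
    moreover have "int (k mod (3 * L)) = 3 * int L - 1" using True by linarith
    ultimately show ?thesis using L by (auto simp: core_def dx_pos_at)
  next
    case False
    then show ?thesis
      by (auto simp: touch_def adj_iff dx_pos_at dy_pos_at mod_Suc div_Suc)
  qed
  have 2: "touch (pos_at k) (pos_at (k + 3 * L))" for k
  proof -
    have "(k + 3 * L) div (3 * L) = Suc (k div (3 * L))" using L by (subst div_add_self2) auto
    then show ?thesis by (simp add: touch_def adj_iff dx_pos_at dy_pos_at)
  qed
  show ?thesis using assms 1[of u] 1[of v] 2[of u] 2[of v] touch_sym unfolding nbr_def by metis
qed

lemma pos_at_index: "p \<in> window \<Longrightarrow> pos_at (index p) = p"
proof -
  assume p: "p \<in> window"
  let ?a = "dx p + int L" and ?w = "int (3 * L)"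
  have a: "0 \<le> ?a" "?a < ?w" using p L by (auto simp: window_def)
  have i: "int (index p) = ?a + ?w * (dy p + int L)" using index_int[OF p] by simp
  have "int (index p mod (3 * L)) = ?a" "int (index p div (3 * L)) = dy p + int L"
    unfolding zmod_int zdiv_int i using a by simp_all
  then show ?thesis unfolding pos_eq_iff dx_pos_at dy_pos_at by simp
qed

lemma touch_core_window: "p \<in> core \<Longrightarrow> touch p q \<Longrightarrow> q \<in> window"
  by (auto simp: touch_def adj_iff core_def window_def)

definition free :: "pos set \<Rightarrow> nat set" where "free B = {..L ^ 4} - nb (index ` B)"

context
  fixes S B :: "pos set"
  assumes S: "S \<subseteq> core" and B: "B \<subseteq> core" and sep: "\<And>p. p \<notin> core \<Longrightarrow> separate {p} B"
begin

lemma reach_x: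
  assumes "p \<in> reach S B" "\<And>x. (x, snd p) \<notin> core"
  shows "(x, snd p) \<in> reach S B"
proof (cases "fst p \<le> x")
  case True
  have "(\<lambda>i. (fst p + int i, snd p)) (nat (x - fst p)) \<in> reach S B"
    by (rule reach_line) (use assms sep in \<open>auto simp: adj_def\<close>)
  then show ?thesis using True by simp
next
  case False
  have "(\<lambda>i. (fst p - int i, snd p)) (nat (fst p - x)) \<in> reach S B"
    by (rule reach_line) (use assms sep in \<open>auto simp: adj_def\<close>)
  then show ?thesis using False by simp
qed

lemma reach_y:
  assumes "p \<in> reach S B" "\<And>y. (fst p, y) \<notin> core"
  shows "(fst p, y) \<in> reach S B"
proof (cases "snd p \<le> y")
  case True
  have "(\<lambda>i. (fst p, snd p + int i)) (nat (y - snd p)) \<in> reach S B"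
    by (rule reach_line) (use assms sep in \<open>auto simp: adj_def\<close>)
  then show ?thesis using True by simp
next
  case False
  have "(\<lambda>i. (fst p, snd p - int i)) (nat (snd p - y)) \<in> reach S B"
    by (rule reach_line) (use assms sep in \<open>auto simp: adj_def\<close>)
  then show ?thesis using False by simp
qed

text \<open>The outside of the core is connected: row and column through the corner at offset
  \<open>(L, L)\<close> miss the core, and every outside point lies on a row or column that misses
  the core and meets one of them.\<close>

lemma reach_far:
  assumes "p \<in> reach S B" "p \<notin> core" "q \<notin> core"
  shows "q \<in> reach S B"
proof -
  have x: "(x, y) \<notin> core" if "int L \<le> \<bar>x - fst base\<bar>" for x y using that by (auto simp: core_def dx_def)
  have y: "(x, y) \<notin> core" if "int L \<le> \<bar>y - snd base\<bar>" for x y using that by (auto simp: core_def dy_def)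
  let ?X = "fst base + int L" and ?Y = "snd base + int L"
  have corner: "(?X, ?Y) \<in> reach S B"
  proof (cases "int L \<le> \<bar>fst p - fst base\<bar>")
    case True
    then have "(fst p, ?Y) \<in> reach S B" using reach_y[OF assms(1)] x by blast
    then show ?thesis using reach_x[of "(fst p, ?Y)" ?X] y by simp
  next
    case False
    then have "int L \<le> \<bar>snd p - snd base\<bar>" using assms(2) by (auto simp: core_def dx_def dy_def)
    then have "(?X, snd p) \<in> reach S B" using reach_x[OF assms(1)] y by blast
    then show ?thesis using reach_y[of "(?X, snd p)" ?Y] x by simp
  qed
  show ?thesis
  proof (cases "int L \<le> \<bar>fst q - fst base\<bar>")
    case True
    have "(fst q, ?Y) \<in> reach S B" using reach_x[OF corner, of "fst q"] y by simp
    then show ?thesis using reach_y[of "(fst q, ?Y)" "snd q"] x True by simp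
  next
    case False
    then have "int L \<le> \<bar>snd q - snd base\<bar>" using assms(3) by (auto simp: core_def dx_def dy_def)
    moreover have "(?X, snd q) \<in> reach S B" using reach_y[OF corner, of "snd q"] x by simp
    ultimately show ?thesis using reach_x[of "(?X, snd q)" "fst q"] y by simp
  qed
qed

text \<open>Flooding may use a false adjacency, but this joins two points outside the core, and by
  \<open>reach_far\<close> reaching one of them means reaching the other.\<close>

lemma flood_reach:
  assumes "k \<in> flood (3 * L) (index ` S) (free B)"
  shows "pos_at k \<in> reach S B"
  using assms
proof (induction rule: flood.induct)
  case (start k)
  then obtain p where p: "p \<in> S" "k = index p" by blast
  moreover have "p \<in> window" using p(1) S core_window by blast
  ultimately show ?case using pos_at_index[of p] by (simp add: reach.start)
next
  case (step u v)
  have "separate {pos_at v} B"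
  proof -
    have "\<not> touch (pos_at v) b" if "b \<in> B" for b
    proof
      assume t: "touch (pos_at v) b"
      have b: "b \<in> core" using that B by blast
      then have "pos_at v \<in> window" using touch_core_window[OF b] t touch_sym by blast
      then have "index b = v \<or> nbr (3 * L) (index b) v"
        using touch_index[of b "pos_at v"] b core_window t touch_sym by auto
      then show False using step.hyps(3) that by (auto simp: free_def nbh_def)
    qed
    then show ?thesis by (simp add: separate_def)
  qed
  then show ?case using nbr_pos_at[OF step.hyps(2)] step.IH reach_far reach.step
    unfolding touch_def by metis
qed

text \<open>The walk is clamped: each step becomes a step of the grid or a pause, and a clamped
  point outside the core is separate from \<open>B\<close> by assumption.\<close>

lemma reach_flood:
  assumes "p \<in> reach S B"
  shows "index (clamp p) \<in> flood (3 * L) (index ` S) (free B)"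
  using assms
proof (induction rule: reach.induct)
  case (start p)
  then have "clamp p = p" using S core_window clamp_id by blast
  then show ?case using start by (auto intro: flood.start)
next
  case (step u v)
  have "separate {clamp v} B"
  proof (cases "v \<in> core")
    case True
    then show ?thesis using step.hyps(3) clamp_id core_window by (metis subsetD)
  next
    case False
    then show ?thesis using sep clamp_core by blast
  qed
  then have "index (clamp v) \<notin> nb (index ` B)"
  proof -
    have "\<not> (index (clamp v) = index b \<or> nbr (3 * L) (index b) (index (clamp v)))" if "b \<in> B" for b
    proof
      assume "index (clamp v) = index b \<or> nbr (3 * L) (index b) (index (clamp v))"
      then have "touch (clamp v) b" using index_touch[OF clamp_window, of b v] that B by (auto simp: nbr_def)
      then show False using \<open>separate {clamp v} B\<close> that by simp
    qed
    then show ?thesis unfolding nbh_def by blast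
  qed
  then have "index (clamp v) \<in> free B" using index_le[OF clamp_window] by (simp add: free_def)
  moreover have "touch (clamp u) (clamp v)" using step.hyps(2) clamp_touch by (simp add: touch_def)
  then have "index (clamp u) = index (clamp v) \<or> nbr (3 * L) (index (clamp u)) (index (clamp v))"
    using touch_index[OF clamp_window clamp_window] by blast
  ultimately show ?case using step.IH flood.step by metis
qed

text \<open>Index 0 is the corner of the window at offset \<open>(- L, - L)\<close>, outside the
  core. The outside is infinite and is reached entirely or not at all, so this cell decides.\<close>

lemma finite_reach_iff: "finite (reach S B) \<longleftrightarrow> 0 \<notin> flood (3 * L) (index ` S) (free B)"
proof
  assume fin: "finite (reach S B)"
  show "0 \<notin> flood (3 * L) (index ` S) (free B)"
  proof
    assume "0 \<in> flood (3 * L) (index ` S) (free B)"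
    then have "pos_at 0 \<in> reach S B" by (rule flood_reach)
    moreover have "pos_at 0 \<notin> core" using L by (simp add: core_def dx_pos_at)
    ultimately have "- core \<subseteq> reach S B" using reach_far by blast
    moreover have "(\<lambda>i. (fst base + int L + int i, snd base)) ` UNIV \<subseteq> - core"
      by (auto simp: core_def dx_def)
    moreover have "infinite ((\<lambda>i. (fst base + int L + int i, snd base)) ` UNIV)"
      by (subst finite_image_iff) (auto simp: inj_on_def)
    ultimately show False using fin finite_subset by (meson order_trans)
  qed
next
  assume 0: "0 \<notin> flood (3 * L) (index ` S) (free B)"
  have "reach S B \<subseteq> core"
  proof (rule ccontr)
    assume "\<not> reach S B \<subseteq> core"
    then obtain p where p: "p \<in> reach S B" "p \<notin> core" by blast
    have far: "pos_at 0 \<notin> core" and win: "pos_at 0 \<in> window"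
      using L by (simp_all add: core_def window_def dx_pos_at dy_pos_at)
    have "pos_at 0 \<in> reach S B" by (rule reach_far[OF p far])
    then have "index (clamp (pos_at 0)) \<in> flood (3 * L) (index ` S) (free B)" by (rule reach_flood)
    then show False using 0 clamp_id[OF win] by simp
  qed
  moreover have "core \<subseteq> pos_at ` {..L ^ 4}"
    using core_window index_le pos_at_index by (force simp: image_iff)
  ultimately show "finite (reach S B)" by (meson finite_atMost finite_imageI finite_subset)
qed

end

text \<open>A contact survives clamping. Conversely, a contact through a false adjacency shows that
  both regions reach the outside of the core, where the first then contains the point reached by the
  second.\<close>

lemma separate_reach_iff:
  assumes "S \<subseteq> core" "B \<subseteq> core" "\<And>p. p \<notin> core \<Longrightarrow> separate {p} B"
    and "S' \<subseteq> core" "B' \<subseteq> core" "\<And>p. p \<notin> core \<Longrightarrow> separate {p} B'"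
  shows "separate (reach S B) (reach S' B') \<longleftrightarrow>
    nb (flood (3 * L) (index ` S) (free B)) \<inter> flood (3 * L) (index ` S') (free B') = {}"
    (is "?sep \<longleftrightarrow> nb ?A \<inter> ?A' = {}")
proof
  assume sep: ?sep
  show "nb ?A \<inter> ?A' = {}"
  proof (rule ccontr)
    assume "nb ?A \<inter> ?A' \<noteq> {}"
    then obtain j k where jk: "j \<in> ?A" "k \<in> ?A'" "k = j \<or> nbr (3 * L) j k"
      unfolding nbh_def by blast
    have j: "pos_at j \<in> reach S B" using flood_reach[OF assms(1-3) jk(1)] .
    have k: "pos_at k \<in> reach S' B'" using flood_reach[OF assms(4-6) jk(2)] .
    have "touch (pos_at j) (pos_at k) \<or> pos_at j \<notin> core \<and> pos_at k \<notin> core"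
      using jk(3) nbr_pos_at by auto
    then show False
    proof
      assume "touch (pos_at j) (pos_at k)"
      then show False using sep j k by (auto simp: separate_def)
    next
      assume "pos_at j \<notin> core \<and> pos_at k \<notin> core"
      then have "pos_at k \<in> reach S B" using reach_far[OF assms(1-3) j] by blast
      then show False using sep k touch_refl unfolding separate_def by blast
    qed
  qed
next
  assume e: "nb ?A \<inter> ?A' = {}"
  have "\<not> touch u v" if u: "u \<in> reach S B" and v: "v \<in> reach S' B'" for u v
  proof
    assume "touch u v"
    then have "index (clamp u) = index (clamp v) \<or> nbr (3 * L) (index (clamp u)) (index (clamp v))"
      using touch_index[OF clamp_window clamp_window clamp_touch] by blast
    moreover have "index (clamp u) \<in> ?A" using reach_flood[OF assms(1-3) u] .
    moreover have "index (clamp v) \<in> ?A'" using reach_flood[OF assms(4-6) v] .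
    ultimately have "index (clamp v) \<in> nb ?A \<inter> ?A'" unfolding nbh_def by auto
    then show False using e by blast
  qed
  then show ?sep unfolding separate_def by blast
qed

end

section \<open>Programs on sets of tape positions\<close>

type_synonym store = "nat \<Rightarrow> nat set"

datatype exp = V nat | Or exp exp | And exp exp | Diff exp exp

primrec ev :: "exp \<Rightarrow> store \<Rightarrow> nat set" where
  "ev (V x) s = s x"
| "ev (Or a b) s = ev a s \<union> ev b s"
| "ev (And a b) s = ev a s \<inter> ev b s"
| "ev (Diff a b) s = ev a s - ev b s"

text \<open>The value of an expression at a single position, where \<open>g\<close> is the set of
  variables containing that position: assignments can be carried out cell by cell.\<close>

primrec holds :: "exp \<Rightarrow> nat set \<Rightarrow> bool" where
  "holds (V x) g = (x \<in> g)"
| "holds (Or a b) g = (holds a g \<or> holds b g)"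
| "holds (And a b) g = (holds a g \<and> holds b g)"
| "holds (Diff a b) g = (holds a g \<and> \<not> holds b g)"

primrec evars :: "exp \<Rightarrow> nat set" where
  "evars (V x) = {x}"
| "evars (Or a b) = evars a \<union> evars b"
| "evars (And a b) = evars a \<union> evars b"
| "evars (Diff a b) = evars a \<union> evars b"

text \<open>\<open>Up\<close> and \<open>Dn\<close> shift a set by one position; \<open>Scan\<close>
  runs an automaton with states in \<open>'a\<close> along the input and adds the marks it
  emits.\<close>

datatype 'a com =
    Asn nat exp
  | Up nat
  | Dn nat
  | Scan "'a \<Rightarrow> nat set \<Rightarrow> 'a \<times> nat set" 'a
  | Seq "'a com" "'a com" (infixr ";;" 60)
  | If nat "'a com" "'a com"
  | Rep "'a com"

definition tracks :: "nat \<Rightarrow> store \<Rightarrow> nat \<Rightarrow> nat set" where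
  "tracks K s p = {x. x < K \<and> p \<in> s x}"

primrec scan_state :: "('a \<Rightarrow> nat set \<Rightarrow> 'a \<times> nat set) \<Rightarrow> 'a \<Rightarrow> store \<Rightarrow> nat \<Rightarrow> 'a" where
  "scan_state h q s 0 = q"
| "scan_state h q s (Suc p) = fst (h (scan_state h q s p) (tracks 3 s p))"

text \<open>\<open>L\<close> enters only as the repetition count of \<open>Rep\<close>; it will be
  the length of the input.\<close>

primrec exec :: "nat \<Rightarrow> 'a com \<Rightarrow> store \<Rightarrow> store" where
  "exec L (Asn x e) s = s(x := ev e s)"
| "exec L (Up x) s = s(x := Suc ` s x)"
| "exec L (Dn x) s = s(x := {p. Suc p \<in> s x})"
| "exec L (Scan h q) s = (\<lambda>x. s x \<union> {p. x \<in> snd (h (scan_state h q s p) (tracks 3 s p))})"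
| "exec L (c ;; d) s = exec L d (exec L c s)"
| "exec L (If x c d) s = (if s x \<noteq> {} then exec L c s else exec L d s)"
| "exec L (Rep c) s = (exec L c ^^ L) s"

text \<open>Tracks 0, 1, 2 hold the bits of the input symbols, track 3 the set {0} and track 4 the
  set of positions of the input; programs may read but not write them.\<close>
primrec wf_com :: "nat \<Rightarrow> 'a com \<Rightarrow> bool" where
  "wf_com K (Asn x e) = (5 \<le> x \<and> x < K \<and> evars e \<subseteq> {..<K})"
| "wf_com K (Up x) = (5 \<le> x \<and> x < K)"
| "wf_com K (Dn x) = (5 \<le> x \<and> x < K)"
| "wf_com K (Scan h q) = (\<forall>q g. snd (h q g) \<subseteq> {5..<K} \<and> snd (h q {}) = {})"
| "wf_com K (c ;; d) = (wf_com K c \<and> wf_com K d)"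
| "wf_com K (If x c d) = (x < K \<and> wf_com K c \<and> wf_com K d)"
| "wf_com K (Rep c) = wf_com K c"

lemma holds_tracks: "evars e \<subseteq> {..<K} \<Longrightarrow> K \<le> K' \<Longrightarrow> holds e (insert K' (tracks K' s p)) \<longleftrightarrow> p \<in> ev e s"
  by (induction e) (auto simp: tracks_def)

lemma ev_cong: "evars e \<subseteq> {..<K} \<Longrightarrow> (\<And>x. x < K \<Longrightarrow> s x = s' x) \<Longrightarrow> ev e s = ev e s'"
  by (induction e) auto

lemma scan_state_cong: "(\<And>x. x < 3 \<Longrightarrow> s x = s' x) \<Longrightarrow> scan_state h q s p = scan_state h q s' p"
proof (induction p)
  case (Suc p)
  have "tracks 3 s p = tracks 3 s' p" using Suc.prems by (auto simp: tracks_def)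
  then show ?case using Suc by simp
qed simp

text \<open>The machine keeps its loop counters on tracks from \<open>K\<close> on; a program with
  variables below \<open>K\<close> does not see them.\<close>

lemma exec_cong:
  assumes "wf_com K c" "5 \<le> K" "\<And>x. x < K \<Longrightarrow> s x = s' x" "x < K"
  shows "exec L c s x = exec L c s' x"
  using assms(1,3,4)
proof (induction c arbitrary: s s' x)
  case (Asn y e) then show ?case using ev_cong[of e K s s'] by auto
next
  case (Scan h q)
  have "tracks 3 s p = tracks 3 s' p" for p using Scan(2) assms(2) by (auto simp: tracks_def)
  moreover have "scan_state h q s p = scan_state h q s' p" for p
    by (rule scan_state_cong) (use Scan(2) assms(2) in auto)
  ultimately show ?case using Scan by simp
next
  case (Seq c d)
  show ?case unfolding exec.simps
    by (intro Seq.IH(2) Seq.IH(1)) (use Seq.prems in simp_all)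
next
  case (If y c d)
  have "s y = s' y" using If.prems by simp
  moreover have "exec L c s x = exec L c s' x" "exec L d s x = exec L d s' x"
    by (rule If.IH; use If.prems in simp)+
  ultimately show ?case by simp
next
  case (Rep c)
  have "\<forall>x<K. (exec L c ^^ n) s x = (exec L c ^^ n) s' x" for n
  proof (induction n)
    case (Suc n)
    show ?case unfolding funpow.simps o_apply
      by (intro allI impI, rule Rep.IH) (use Rep.prems Suc in simp_all)
  qed (use Rep.prems in simp)
  then show ?case using Rep.prems by simp
qed auto

lemma exec_funpow_cong:
  assumes "wf_com K c" "5 \<le> K" "\<And>x. x < K \<Longrightarrow> s x = s' x" "x < K"
  shows "(exec L c ^^ n) s x = (exec L c ^^ n) s' x"
  using assms(4)
proof (induction n arbitrary: x)
  case (Suc n)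
  show ?case unfolding funpow.simps o_apply
    by (rule exec_cong[OF assms(1,2)]) (use Suc in simp_all)
qed (use assms(3) in simp)

lemma exec_const: "wf_com K c \<Longrightarrow> x < 5 \<Longrightarrow> exec L c s x = s x"
proof (induction c arbitrary: s)
  case (Scan h q)
  have "x \<notin> snd (h r g)" for r g
    using Scan.prems by (auto dest!: spec[of _ r] spec[of _ g])
  then show ?case by simp
next
  case (Rep c)
  have "(exec L c ^^ n) s x = s x" for n by (induction n) (use Rep in auto)
  then show ?case by simp
qed auto

subsection \<open>The control of the machine\<close>

text \<open>The control is a stack of pending work: a command still to be executed, or a running
  loop with the track of its counter.\<close>

datatype 'a item = C "'a com" | W nat "'a com"

fun nW :: "'a item list \<Rightarrow> nat" where
  "nW [] = 0"
| "nW (C c # k) = nW k"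
| "nW (W x c # k) = Suc (nW k)"

text \<open>The loop with \<open>i\<close> enclosing loops counts on track \<open>K + i\<close>.\<close>
fun next_ctl :: "nat \<Rightarrow> 'a item list \<Rightarrow> bool \<Rightarrow> 'a item list" where
  "next_ctl K (C (c ;; d) # k) b = C c # C d # k"
| "next_ctl K (C (If x c d) # k) b = (if b then C c else C d) # k"
| "next_ctl K (C (Rep c) # k) b = W (K + nW k) c # k"
| "next_ctl K (W x c # k) b = (if b then C c # W x c # k else k)"
| "next_ctl K (_ # k) b = k"
| "next_ctl K [] b = []"

text \<open>The set whose emptiness decides the next move. For the empty stack this is variable 5,
  the answer of the program.\<close>

fun flag_var :: "'a item list \<Rightarrow> nat option" where
  "flag_var (C (If x c d) # k) = Some x"
| "flag_var (W x c # k) = Some x"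
| "flag_var (_ # k) = None"
| "flag_var [] = Some 5"

definition flag :: "'a item list \<Rightarrow> store \<Rightarrow> bool" where
  "flag k s = (case flag_var k of None \<Rightarrow> False | Some x \<Rightarrow> s x \<noteq> {})"

text \<open>Counters are unary: a loop starts with all input positions, taken from track 4, and each
  test removes the least one left. Primitive commands do not depend on the loop bound, hence
  \<open>exec 0\<close>.\<close>

fun next_store :: "nat \<Rightarrow> 'a item list \<Rightarrow> store \<Rightarrow> store" where
  "next_store K (C (c ;; d) # k) s = s"
| "next_store K (C (If x c d) # k) s = s"
| "next_store K (C (Rep c) # k) s = s(K + nW k := s 4)"
| "next_store K (W x c # k) s = s(x := s x - {LEAST p. p \<in> s x})"
| "next_store K (C c # k) s = exec 0 c s"
| "next_store K [] s = s"

definition ctl_step :: "nat \<Rightarrow> 'a item list \<times> store \<Rightarrow> 'a item list \<times> store" where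
  "ctl_step K = (\<lambda>(k, s). (next_ctl K k (flag k s), next_store K k s))"

primrec cost :: "nat \<Rightarrow> 'a com \<Rightarrow> nat" where
  "cost L (Asn x e) = 1"
| "cost L (Up x) = 1"
| "cost L (Dn x) = 1"
| "cost L (Scan h q) = 1"
| "cost L (c ;; d) = 1 + cost L c + cost L d"
| "cost L (If x c d) = 1 + cost L c + cost L d"
| "cost L (Rep c) = 2 + L * (1 + cost L c)"

definition reaches :: "nat \<Rightarrow> nat \<Rightarrow> 'a item list \<times> store \<Rightarrow> 'a item list \<times> store \<Rightarrow> bool" where
  "reaches K n c d \<longleftrightarrow> (\<exists>i\<le>n. (ctl_step K ^^ i) c = d)"

lemma reaches_step:
  assumes "ctl_step K c = d" "reaches K n d e"
  shows "reaches K (Suc n) c e"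
proof -
  obtain i where "i \<le> n" "(ctl_step K ^^ i) d = e" using assms(2) by (auto simp: reaches_def)
  then have "Suc i \<le> Suc n" "(ctl_step K ^^ Suc i) c = e"
    using assms(1) by (auto simp: funpow_swap1)
  then show ?thesis unfolding reaches_def by blast
qed

lemma reaches_refl: "reaches K n c c"
  unfolding reaches_def by (rule exI[of _ 0]) auto

lemma reaches_trans:
  assumes "reaches K m c d" "reaches K n d e"
  shows "reaches K (m + n) c e"
proof -
  obtain i j where "i \<le> m" "(ctl_step K ^^ i) c = d" "j \<le> n" "(ctl_step K ^^ j) d = e"
    using assms by (auto simp: reaches_def)
  then have "j + i \<le> m + n" "(ctl_step K ^^ (j + i)) c = e" by (auto simp: funpow_add)
  then show ?thesis unfolding reaches_def by blast
qed

lemma reaches_mono: "reaches K m c d \<Longrightarrow> m \<le> n \<Longrightarrow> reaches K n c d"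
  unfolding reaches_def using le_trans by blast

lemma reaches_primitive:
  assumes "ctl_step K (C c # k, s) = (k, exec L c s)" "cost L c = 1" "\<And>x. K \<le> x \<Longrightarrow> exec L c s x = s x"
  shows "\<exists>s'. reaches K (cost L c) (C c # k, s) (k, s') \<and> (\<forall>x<K. s' x = exec L c s x)
    \<and> (\<forall>x. K \<le> x \<and> x < K + nW k \<longrightarrow> s' x = s x)"
proof (intro exI conjI)
  show "reaches K (cost L c) (C c # k, s) (k, exec L c s)"
    unfolding assms(2) One_nat_def by (rule reaches_step[OF assms(1) reaches_refl])
qed (use assms(3) in auto)

text \<open>The induction also needs that the counters of the enclosing loops, on tracks below
  \<open>K + nW k\<close>, survive; those of finished inner loops are left unspecified.\<close>

lemma ctl_exec:
  assumes "wf_com K c" "5 \<le> K" "s 4 = {..<L}"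
  shows "\<exists>s'. reaches K (cost L c) (C c # k, s) (k, s') \<and> (\<forall>x<K. s' x = exec L c s x)
    \<and> (\<forall>x. K \<le> x \<and> x < K + nW k \<longrightarrow> s' x = s x)"
  using assms(1,3)
proof (induction c arbitrary: s k)
  case (Asn x e)
  show ?case by (rule reaches_primitive) (use Asn in \<open>simp_all add: ctl_step_def\<close>)
next
  case (Up x)
  show ?case by (rule reaches_primitive) (use Up in \<open>simp_all add: ctl_step_def\<close>)
next
  case (Dn x)
  show ?case by (rule reaches_primitive) (use Dn in \<open>simp_all add: ctl_step_def\<close>)
next
  case (Scan h q)
  have "y \<notin> snd (h r g)" if "K \<le> y" for r g y
    using Scan.prems(1) that by (auto dest!: spec[of _ r] spec[of _ g])
  then show ?case by (intro reaches_primitive) (simp_all add: ctl_step_def)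
next
  case (Seq c d)
  obtain s1 where s1: "reaches K (cost L c) (C c # C d # k, s) (C d # k, s1)"
    "\<forall>x<K. s1 x = exec L c s x" "\<forall>x. K \<le> x \<and> x < K + nW k \<longrightarrow> s1 x = s x"
    using Seq.IH(1)[of s "C d # k"] Seq.prems by auto
  have "s1 4 = {..<L}" using s1(2) assms(2) Seq.prems exec_const[of K c 4] by simp
  then obtain s2 where s2: "reaches K (cost L d) (C d # k, s1) (k, s2)"
    "\<forall>x<K. s2 x = exec L d s1 x" "\<forall>x. K \<le> x \<and> x < K + nW k \<longrightarrow> s2 x = s1 x"
    using Seq.IH(2)[of s1 k] Seq.prems by auto
  have "reaches K (Suc (cost L c + cost L d)) (C (c ;; d) # k, s) (k, s2)"
    by (rule reaches_step[OF _ reaches_trans[OF s1(1) s2(1)]]) (auto simp: ctl_step_def)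
  moreover have "exec L d s1 x = exec L d (exec L c s) x" if "x < K" for x
    using exec_cong[of K d s1 "exec L c s" x L] Seq.prems s1(2) assms(2) that by auto
  ultimately show ?case using s1 s2 by (intro exI[of _ s2]) auto
next
  case (If x c d)
  show ?case
  proof (cases "s x = {}")
    case True
    obtain s1 where s1: "reaches K (cost L d) (C d # k, s) (k, s1)"
    "\<forall>x<K. s1 x = exec L d s x" "\<forall>x. K \<le> x \<and> x < K + nW k \<longrightarrow> s1 x = s x"
      using If.IH(2)[of s "k"] If.prems by auto
    have "reaches K (Suc (cost L d)) (C (If x c d) # k, s) (k, s1)"
      by (rule reaches_step[OF _ s1(1)]) (auto simp: ctl_step_def flag_def True)
    then have "reaches K (cost L (If x c d)) (C (If x c d) # k, s) (k, s1)"
      by (rule reaches_mono) auto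
    then show ?thesis using s1 True by auto
  next
    case False
    obtain s1 where s1: "reaches K (cost L c) (C c # k, s) (k, s1)"
    "\<forall>x<K. s1 x = exec L c s x" "\<forall>x. K \<le> x \<and> x < K + nW k \<longrightarrow> s1 x = s x"
      using If.IH(1)[of s "k"] If.prems by auto
    have "reaches K (Suc (cost L c)) (C (If x c d) # k, s) (k, s1)"
      by (rule reaches_step[OF _ s1(1)]) (auto simp: ctl_step_def flag_def False)
    then have "reaches K (cost L (If x c d)) (C (If x c d) # k, s) (k, s1)"
      by (rule reaches_mono) auto
    then show ?thesis using s1 False by auto
  qed
next
  case (Rep c)
  let ?x = "K + nW k"
  let ?W = "W ?x c"
  \<comment> \<open>With \<open>j\<close> iterations to go the counter holds
    \<open>{L - j..<L}\<close>, since removal starts from the least position; one more test finds it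
    empty.\<close>
  have loop: "\<exists>s'. reaches K (j * (1 + cost L c) + 1) (?W # k, s) (k, s')
    \<and> (\<forall>x<K. s' x = (exec L c ^^ j) s x) \<and> (\<forall>x. K \<le> x \<and> x < ?x \<longrightarrow> s' x = s x)"
    if "s ?x = {L - j..<L}" "j \<le> L" "s 4 = {..<L}" for j s
    using that
  proof (induction j arbitrary: s)
    case 0
    have "reaches K (Suc 0) (?W # k, s) (k, s(?x := {}))"
      by (rule reaches_step[OF _ reaches_refl]) (use 0 in \<open>auto simp: ctl_step_def flag_def\<close>)
    then have "reaches K (0 * (1 + cost L c) + 1) (?W # k, s) (k, s(?x := {}))" by simp
    then show ?case by (intro exI conjI) (assumption, simp_all)
  next
    case (Suc j)
    have least: "(LEAST p. p \<in> {L - Suc j..<L}) = L - Suc j"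
      using Suc.prems(2) by (intro Least_equality) auto
    have del: "{L - Suc j..<L} - {L - Suc j} = {L - j..<L}"
      using Suc.prems(2) by auto
    define s0 where "s0 = s(?x := {L - j..<L})"
    have s04: "s0 4 = {..<L}" using Suc.prems(3) assms(2) by (simp add: s0_def)
    have st: "ctl_step K (?W # k, s) = (C c # ?W # k, s0)"
      unfolding ctl_step_def flag_def s0_def using Suc.prems least del by auto
    obtain s1 where s1: "reaches K (cost L c) (C c # ?W # k, s0) (?W # k, s1)"
    "\<forall>x<K. s1 x = exec L c s0 x" "\<forall>x. K \<le> x \<and> x < K + nW (?W # k) \<longrightarrow> s1 x = s0 x"
      using Rep.IH[of s0 "?W # k"] Rep.prems(1) s04 unfolding wf_com.simps by blast
    have s1x: "s1 ?x = {L - j..<L}" using s1(3) by (simp add: s0_def)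
    have s14: "s1 4 = {..<L}" using s1(2) exec_const[of K c 4] Rep.prems Suc.prems assms(2)
      by (auto simp: s0_def)
    obtain s2 where s2: "reaches K (j * (1 + cost L c) + 1) (?W # k, s1) (k, s2)"
    "\<forall>x<K. s2 x = (exec L c ^^ j) s1 x" "\<forall>x. K \<le> x \<and> x < K + nW k \<longrightarrow> s2 x = s1 x"
      using Suc.IH[OF s1x Suc_leD[OF Suc.prems(2)] s14] by blast
    have "reaches K (Suc (cost L c + (j * (1 + cost L c) + 1))) (?W # k, s) (k, s2)"
      by (rule reaches_step[OF st reaches_trans[OF s1(1) s2(1)]])
    moreover have "\<forall>x<K. s1 x = exec L c s x"
      using s1(2) exec_cong[of K c s0 s _ L] assms(2) Rep.prems by (auto simp: s0_def)
    then have "\<forall>x<K. (exec L c ^^ j) s1 x = (exec L c ^^ j) (exec L c s) x"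
      using exec_funpow_cong[of K c s1 "exec L c s"] Rep.prems assms(2) by simp
    then have "\<forall>x<K. (exec L c ^^ j) s1 x = (exec L c ^^ Suc j) s x"
      by (simp add: funpow_swap1)
    ultimately show ?case using s1 s2
      by (intro exI[of _ s2]) (auto simp: algebra_simps s0_def)
  qed
  define s0 where "s0 = s(?x := {..<L})"
  have s04: "s0 ?x = {L - L..<L}" "s0 4 = {..<L}"
    using Rep.prems(2) assms(2) by (simp_all add: s0_def atLeast0LessThan)
  have st: "ctl_step K (C (Rep c) # k, s) = (?W # k, s0)"
    unfolding ctl_step_def s0_def using Rep.prems(2) by simp
  obtain s1 where s1: "reaches K (L * (1 + cost L c) + 1) (?W # k, s0) (k, s1)"
    "\<forall>x<K. s1 x = (exec L c ^^ L) s0 x" "\<forall>x. K \<le> x \<and> x < ?x \<longrightarrow> s1 x = s0 x"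
    using loop[OF s04(1) le_refl s04(2)] by (elim exE conjE) (rule that; assumption)
  have "reaches K (Suc (L * (1 + cost L c) + 1)) (C (Rep c) # k, s) (k, s1)"
    by (rule reaches_step[OF st s1(1)])
  moreover have "\<forall>x<K. exec L (Rep c) s0 x = exec L (Rep c) s x"
    using exec_cong[of K "Rep c" s0 s _ L] Rep.prems assms(2) by (auto simp: s0_def)
  moreover have "cost L (Rep c) = Suc (L * (1 + cost L c) + 1)" by simp
  ultimately show ?case using s1 by (intro exI[of _ s1]) (simp add: s0_def)
qed

lemma poly_bound_add:
  fixes f g :: "nat \<Rightarrow> nat"
  assumes "\<exists>k d. \<forall>L. f L \<le> k * (L + 1) ^ d" "\<exists>k d. \<forall>L. g L \<le> k * (L + 1) ^ d"
  shows "\<exists>k d. \<forall>L. 1 + f L + g L \<le> k * (L + 1) ^ d"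
proof -
  obtain k e k' e' where h: "\<And>L. f L \<le> k * (L + 1) ^ e" "\<And>L. g L \<le> k' * (L + 1) ^ e'"
    using assms by blast
  have "1 + f L + g L \<le> (1 + k + k') * (L + 1) ^ (e + e')" for L
  proof -
    have "k * (L + 1) ^ e \<le> k * (L + 1) ^ (e + e')" "k' * (L + 1) ^ e' \<le> k' * (L + 1) ^ (e + e')"
      by (auto intro!: mult_le_mono power_increasing)
    then have "f L \<le> k * (L + 1) ^ (e + e')" "g L \<le> k' * (L + 1) ^ (e + e')"
      using h[of L] le_trans by blast+
    moreover have "1 \<le> (L + 1) ^ (e + e')" by simp
    ultimately show ?thesis unfolding distrib_right by linarith
  qed
  then show ?thesis by blast
qed

text \<open>The program is fixed and each enclosing loop raises the degree by one.\<close>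

lemma cost_poly: "\<exists>k d. \<forall>L. cost L c \<le> k * (L + 1) ^ d"
proof (induction c)
  case (Seq c d)
  then show ?case unfolding cost.simps by (rule poly_bound_add)
next
  case (If x c d)
  then show ?case unfolding cost.simps by (rule poly_bound_add)
next
  case (Rep c)
  then obtain k e where h: "\<And>L. cost L c \<le> k * (L + 1) ^ e" by blast
  have "cost L (Rep c) \<le> (3 + k) * (L + 1) ^ (Suc e)" for L
  proof -
    let ?P = "(L + 1) ^ e"
    have p: "1 \<le> ?P" by simp
    have "L * (1 + cost L c) \<le> L * (?P + k * ?P)" using h[of L] p by (intro mult_le_mono add_mono) auto
    moreover have "(3 + k) * (L + 1) ^ Suc e = 3 * ?P + 3 * (L * ?P) + k * ?P + L * (k * ?P)"
      by (simp add: algebra_simps)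
    ultimately show ?thesis using p unfolding cost.simps add_mult_distrib add_mult_distrib2 by linarith
  qed
  then show ?case by blast
qed (rule exI[of _ 1], rule exI[of _ 0], simp)+

subsection \<open>Simulation by a Turing machine\<close>

lemma set_encode_less: "A \<subseteq> {..<n} \<Longrightarrow> set_encode A < 2 ^ n"
proof -
  assume "A \<subseteq> {..<n}"
  then have "set_encode A \<le> set_encode {..<n}"
    unfolding set_encode_def by (intro sum_mono2) auto
  also have "set_encode {..<n} < 2 ^ n"
    unfolding set_encode_def by (induction n) auto
  finally show ?thesis .
qed

fun start_state :: "'a item list \<Rightarrow> 'a" where
  "start_state (C (Scan h q) # k) = q"
| "start_state k = undefined"

text \<open>The right sweep at a cell \<open>g\<close>, with carried scan state \<open>a\<close> and
  bit \<open>b\<close>. For \<open>Up\<close> the bit is that of the cell just left; for tests it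
  records whether the variable has occurred, which lets \<open>W\<close> delete only the first
  occurrence. \<open>Dn\<close> waits for the left sweep.\<close>

fun cell_step :: "nat \<Rightarrow> 'a item list \<Rightarrow> 'a \<Rightarrow> bool \<Rightarrow> nat set \<Rightarrow> ('a \<times> bool) \<times> nat set" where
  "cell_step K (C (Asn x e) # k) a b g = ((a, b), if holds e g then insert x g else g - {x})"
| "cell_step K (C (Up x) # k) a b g = ((a, x \<in> g), if b then insert x g else g - {x})"
| "cell_step K (C (Dn x) # k) a b g = ((a, b), g)"
| "cell_step K (C (Scan h q) # k) a b g =
    ((fst (h a (g \<inter> {..<3})), b), g \<union> snd (h a (g \<inter> {..<3})))"
| "cell_step K (C (c ;; d) # k) a b g = ((a, b), g)"
| "cell_step K (C (If x c d) # k) a b g = ((a, b \<or> x \<in> g), g)"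
| "cell_step K (C (Rep c) # k) a b g =
    ((a, b), if 4 \<in> g then insert (K + nW k) g else g - {K + nW k})"
| "cell_step K (W x c # k) a b g = ((a, b \<or> x \<in> g), if b then g else g - {x})"
| "cell_step K [] a b g = ((a, b \<or> 5 \<in> g), g)"

fun up_var :: "'a item list \<Rightarrow> nat option" where
  "up_var (C (Up x) # k) = Some x"
| "up_var k = None"

fun dn_var :: "'a item list \<Rightarrow> nat option" where
  "dn_var (C (Dn x) # k) = Some x"
| "dn_var k = None"

text \<open>\<open>Left\<close> already carries the next control; before it stand the variable to be
  shifted down, if any, and the bit of this variable in the cell just left.\<close>

datatype 'a state = Start | Accept | Reject | Init | Right "'a item list" 'a bool | Left "nat option" bool "'a item list"

text \<open>The alphabet consists of the sets of tracks, the blank being the empty set; track \<open>N\<close>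
  marks all visited cells. A command of the program is executed by a sweep to the right followed by
  a sweep to the left, which ends at the cell marked on track 3.\<close>
fun step_fun :: "nat \<Rightarrow> nat \<Rightarrow> 'a com \<Rightarrow> 'a state \<Rightarrow> nat set \<Rightarrow> 'a state \<times> nat set \<times> move" where
  "step_fun K N c Start g = (Init, g \<union> {3, 4, N}, MoveR)"
| "step_fun K N c Init g =
    (if g = {} then (Left None False [C c], {}, MoveL) else (Init, g \<union> {4, N}, MoveR))"
| "step_fun K N c (Right k a b) g =
    (if g = {} then
       (if k = [] then (if b then Accept else Reject, {}, MoveN)
        else (Left (dn_var k) False (next_ctl K k b),
          (case up_var k of Some x \<Rightarrow> if b then {x, N} else {} | None \<Rightarrow> {}), MoveL))
     else (case cell_step K k a b g of ((a', b'), g') \<Rightarrow> (Right k a' b', g', MoveR)))"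
| "step_fun K N c (Left v b k) g =
    (let g' = (case v of None \<Rightarrow> g | Some x \<Rightarrow> if b then insert x g else g - {x}) in
     if 3 \<in> g then (Right k (start_state k) False, g', MoveN)
     else (Left v (\<exists>x\<in>g. v = Some x) k, g', MoveL))"
| "step_fun K N c q g = (q, g, MoveN)"

text \<open>The stacks that can occur while \<open>c\<close> runs on top of \<open>k\<close>. They
  follow the nesting of the program, so there are finitely many and they can serve as
  states.\<close>

fun ctls :: "nat \<Rightarrow> 'a com \<Rightarrow> 'a item list \<Rightarrow> 'a item list set" where
  "ctls K (c ;; d) k = {C (c ;; d) # k} \<union> ctls K c (C d # k) \<union> ctls K d k"
| "ctls K (If x c d) k = {C (If x c d) # k} \<union> ctls K c k \<union> ctls K d k"
| "ctls K (Rep c) k = {C (Rep c) # k, W (K + nW k) c # k} \<union> ctls K c (W (K + nW k) c # k)"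
| "ctls K c k = {C c # k}"

lemma finite_ctls: "finite (ctls K c k)"
  by (induction K c k rule: ctls.induct) auto

lemma head_in_ctls: "C c # k \<in> ctls K c k"
  by (cases c) auto

lemma next_ctl_in_ctls: "r \<in> ctls K c k \<Longrightarrow> next_ctl K r b \<in> ctls K c k \<union> {k}"
proof (induction K c k rule: ctls.induct)
  case (1 K c d k)
  then show ?case using head_in_ctls[of c "C d # k" K] head_in_ctls[of d k K] by auto
next
  case (2 K x c d k)
  then show ?case using head_in_ctls[of c k K] head_in_ctls[of d k K] by auto
next
  case (3 K c k)
  show ?case
  proof (cases "r \<in> ctls K c (W (K + nW k) c # k)")
    case True
    then show ?thesis using 3(1) by auto
  next
    case False
    then show ?thesis using 3(2) head_in_ctls[of c "W (K + nW k) c # k" K] by (cases b) auto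
  qed
qed auto

fun wf_head :: "nat \<Rightarrow> 'a item list \<Rightarrow> bool" where
  "wf_head K [] = True"
| "wf_head K (C c # k) = wf_com K c"
| "wf_head K (W x c # k) = (x = K + nW k)"

lemma wf_head_ctls: "r \<in> ctls K c k \<Longrightarrow> wf_com K c \<Longrightarrow> wf_head K r"
  by (induction K c k rule: ctls.induct) auto

locale simulation =
  fixes K :: nat and c0 :: "'a::finite com"
  assumes wf: "wf_com K c0" and K: "6 \<le> K"
begin

definition ctl :: "'a item list set" where "ctl = ctls K c0 [] \<union> {[]}"

text \<open>Lies above all variables and counters; a mark on this track distinguishes a visited cell
  without other marks from a blank.\<close>

definition N :: nat where "N = K + Suc (Max (nW ` ctl))"

definition states :: "'a state set" where
  "states = {q. case q of Right k a b \<Rightarrow> k \<in> ctl | Left v b k \<Rightarrow> k \<in> ctl \<and> v \<in> insert None (Some ` {..<N})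
    | _ \<Rightarrow> True}"

lemma states_simps [simp]:
  "Start \<in> states" "Accept \<in> states" "Reject \<in> states" "Init \<in> states"
  "Right k a b \<in> states \<longleftrightarrow> k \<in> ctl"
  "Left v b k \<in> states \<longleftrightarrow> k \<in> ctl \<and> (v = None \<or> (\<exists>x<N. v = Some x))"
  by (auto simp: states_def)

lemma finite_ctl: "finite ctl"
  by (simp add: ctl_def finite_ctls)

lemma finite_states: "finite states"
proof -
  let ?R = "(\<lambda>(k, a, b). Right k a b) ` (ctl \<times> UNIV)"
  let ?L = "(\<lambda>(v, b, k). Left v b k) ` (insert None (Some ` {..<N}) \<times> UNIV \<times> ctl)"
  have "q \<in> {Start, Accept, Reject, Init} \<union> ?R \<union> ?L" if "q \<in> states" for q
  proof (cases q)
    case (Right k a b)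
    then have "q \<in> ?R" using that by (intro image_eqI[of _ _ "(k, a, b)"]) simp_all
    then show ?thesis by (rule UnI1[OF UnI2])
  next
    case (Left v b k)
    then have "q \<in> ?L" using that by (intro image_eqI[of _ _ "(v, b, k)"]) (auto simp: image_iff)
    then show ?thesis by (rule UnI2)
  qed simp_all
  moreover have "finite ({Start, Accept, Reject, Init} \<union> ?R \<union> ?L)"
    by (simp add: finite_ctl)
  ultimately show ?thesis by (meson finite_subset subsetI)
qed

lemma nW_less: "k \<in> ctl \<Longrightarrow> K + nW k < N"
  unfolding N_def using finite_ctl by (auto simp: less_Suc_eq_le)

lemma next_in_ctl: "k \<in> ctl \<Longrightarrow> next_ctl K k b \<in> ctl"
  using next_ctl_in_ctls[of k K c0 "[]" b] unfolding ctl_def by auto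

lemma wf_head_ctl: "k \<in> ctl \<Longrightarrow> wf_head K k"
  using wf_head_ctls[of k K c0 "[]"] wf unfolding ctl_def by auto

lemma K_less_N: "K < N" by (simp add: N_def)

lemma trans_states: "q \<in> states \<Longrightarrow> fst (step_fun K N c0 q g) \<in> states"
proof -
  assume q: "q \<in> states"
  have c0: "[C c0] \<in> ctl" by (simp add: ctl_def head_in_ctls)
  have dn: "dn_var k = None \<or> (\<exists>x<N. dn_var k = Some x)" if "k \<in> ctl" for k
    using wf_head_ctl[OF that] K_less_N by (cases k rule: dn_var.cases) auto
  show ?thesis
  proof (cases q)
    case (Right k a b)
    then have "k \<in> ctl" using q by simp
    moreover obtain a' b' g' where "cell_step K k a b g = ((a', b'), g')"
      by (metis surj_pair)
    ultimately show ?thesis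
      unfolding Right using dn[of k] next_in_ctl[of k b] by (cases "k = []"; cases b) simp_all
  next
    case (Left v b k)
    then show ?thesis using q by (cases "3 \<in> g") (simp_all add: Let_def)
  next
    case Init
    then show ?thesis using c0 by (cases "g = {}") simp_all
  qed simp_all
qed

text \<open>Only the three distinguished numbers and bijectivity matter, so the numbering is left
  abstract.\<close>

definition code :: "'a state \<Rightarrow> nat" where
  "code = (SOME f. f Start = 0 \<and> f Accept = 1 \<and> f Reject = 2 \<and> bij_betw f states {..<card states})"

lemma code: "code Start = 0" "code Accept = 1" "code Reject = 2" "bij_betw code states {..<card states}"
  and card_states: "3 \<le> card states"
proof -
  let ?T = "states - {Start, Accept, Reject}"
  have sub: "{Start, Accept, Reject} \<subseteq> states" by (auto simp: states_def)
  have card: "card states = card ?T + 3"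
    using card_Diff_subset[OF _ sub] card_mono[OF finite_states sub] by simp
  then show "3 \<le> card states" by simp
  obtain f where f: "bij_betw f ?T {0..<card ?T}"
    using ex_bij_betw_finite_nat[of ?T] finite_states by blast
  define g where "g = (\<lambda>q. if q = Start then 0 else if q = Accept then 1 else if q = Reject then 2 else f q + 3)"
  have "bij_betw (\<lambda>i. i + 3) {0..<card ?T} {3..<card states}"
    using card by (auto simp: bij_betw_def image_add_atLeastLessThan)
  then have "bij_betw (\<lambda>q. f q + 3) ?T {3..<card states}"
    using bij_betw_trans[OF f] by (simp add: o_def)
  then have 1: "bij_betw g ?T {3..<card states}"
    by (rule bij_betw_cong[THEN iffD1, rotated]) (auto simp: g_def)
  have 2: "bij_betw g {Start, Accept, Reject} {..<3}"
    by (auto simp: bij_betw_def g_def inj_on_def)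
  have "bij_betw g (?T \<union> {Start, Accept, Reject}) ({3..<card states} \<union> {..<3})"
    by (rule bij_betw_combine[OF 1 2]) auto
  moreover have "?T \<union> {Start, Accept, Reject} = states" using sub by auto
  moreover have "{3..<card states} \<union> {..<3} = {..<card states}" using card by auto
  ultimately have "\<exists>f. f Start = 0 \<and> f Accept = 1 \<and> f Reject = (2::nat) \<and> bij_betw f states {..<card states}"
    by (intro exI[of _ g]) (auto simp: g_def)
  note c = someI_ex[OF this, folded code_def]
  show "code Start = 0" by (rule c[THEN conjunct1])
  show "code Accept = 1" by (rule c[THEN conjunct2, THEN conjunct1])
  show "code Reject = 2" by (rule c[THEN conjunct2, THEN conjunct2, THEN conjunct1])
  show "bij_betw code states {..<card states}"
    by (rule c[THEN conjunct2, THEN conjunct2, THEN conjunct2])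
qed

text \<open>Symbols are binary codes of sets of tracks, so the input symbols 1 to 4 have their bits
  on tracks 0 to 2. The intersection with \<open>{..N}\<close> keeps every written code below
  \<open>2 ^ Suc N\<close>.\<close>

definition machine :: tm where
  "machine = \<lparr>nst = card states, nsym = 2 ^ Suc N,
     delta = (\<lambda>q s. case step_fun K N c0 (inv_into states code q) (set_decode s) of
       (q', g, m) \<Rightarrow> (code q', set_encode (g \<inter> {..N}), m))\<rparr>"

lemma wf_machine: "wf_tm machine"
proof -
  have "(2::nat) ^ Suc N \<ge> 2 ^ 3" using K K_less_N by (intro power_increasing) auto
  then have "5 \<le> nsym machine" unfolding machine_def by simp
  moreover have "fst (delta machine q s) < nst machine" if "q < nst machine" for q s
  proof -
    have "inv_into states code q \<in> states"
      using code(4) that by (intro inv_into_into) (auto simp: bij_betw_def machine_def)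
    then have "code (fst (step_fun K N c0 (inv_into states code q) (set_decode s))) < card states"
      using trans_states code(4) by (auto simp: bij_betw_def)
    then show ?thesis by (simp add: machine_def split_beta)
  qed
  moreover have "fst (snd (delta machine q s)) < nsym machine" for q s
  proof -
    have "set_encode (g \<inter> {..N}) < 2 ^ Suc N" for g by (rule set_encode_less) auto
    then show ?thesis by (simp add: machine_def split_beta del: power.simps)
  qed
  moreover have "3 \<le> nst machine" using card_states by (simp add: machine_def)
  ultimately show ?thesis unfolding wf_tm_def by blast
qed

fun move_head :: "nat \<Rightarrow> nat \<Rightarrow> move \<Rightarrow> nat list \<Rightarrow> nat list \<Rightarrow> tmconf" where
  "move_head q s MoveN l r = (q, l, s # tl r)"
| "move_head q s MoveR l r = (q, s # l, tl r)"
| "move_head q s MoveL l r = (case l of [] \<Rightarrow> (q, [], 0 # s # tl r) | x # l' \<Rightarrow> (q, l', x # s # tl r))"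

lemma halted_code: "q \<in> states \<Longrightarrow> halted (code q, l, r) \<longleftrightarrow> q = Accept \<or> q = Reject"
proof -
  assume q: "q \<in> states"
  have "code q = 1 \<longleftrightarrow> q = Accept" "code q = 2 \<longleftrightarrow> q = Reject"
    using code q inj_onD[of code states q Accept] inj_onD[of code states q Reject]
    by (auto simp: bij_betw_def)
  then show ?thesis by (simp add: halted_def)
qed

lemma step_machine:
  assumes "q \<in> states" "q \<noteq> Accept" "q \<noteq> Reject" "step_fun K N c0 q (set_decode (head_sym r)) = (q', g, m)"
  shows "tm_step machine (code q, l, r) = move_head (code q') (set_encode (g \<inter> {..N})) m l r"
proof -
  have "inv_into states code (code q) = q"
    using code(4) assms(1) by (simp add: bij_betw_def inv_into_f_f)
  moreover have "\<not> halted (code q, l, r)" using halted_code assms by auto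
  moreover have "delta machine (code q) (head_sym r) = (code q', set_encode (g \<inter> {..N}), m)"
    using calculation(1) assms(4) by (simp add: machine_def)
  ultimately show ?thesis
    unfolding tm_step_def by (cases m) (simp_all add: Let_def split: list.split)
qed

definition cell :: "store \<Rightarrow> nat \<Rightarrow> nat set" where "cell s p = insert N (tracks N s p)"

definition sym :: "store \<Rightarrow> nat \<Rightarrow> nat" where "sym s p = set_encode (cell s p)"

lemma finite_cell: "finite (cell s p)"
  by (rule finite_subset[of _ "{..N}"]) (auto simp: cell_def tracks_def)

lemma decode_sym: "set_decode (sym s p) = cell s p"
  by (simp add: sym_def finite_cell)

lemma cell_Int: "cell s p \<inter> {..N} = cell s p"
  by (auto simp: cell_def tracks_def)

lemma cell_ne: "cell s p \<noteq> {}"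
  by (simp add: cell_def)

lemma head_sym_zeros: "head_sym (replicate j 0) = 0"
  by (cases j) (auto simp: head_sym_def)

lemma right_sweep:
  assumes "\<And>p. p < n \<Longrightarrow> cell_step K k (fst (st p)) (snd (st p)) (cell s p) = (st (Suc p), cell s' p)"
    "k \<in> ctl" "i \<le> n"
  shows "(tm_step machine ^^ i) (code (Right k (fst (st 0)) (snd (st 0))), [], map (sym s) [0..<n] @ z)
    = (code (Right k (fst (st i)) (snd (st i))), rev (map (sym s') [0..<i]), map (sym s) [i..<n] @ z)"
  using assms(3)
proof (induction i)
  case (Suc i)
  have up: "[i..<n] = i # [Suc i..<n]" using Suc.prems by (simp add: upt_conv_Cons)
  have "Right k (fst (st i)) (snd (st i)) \<in> states" using assms(2) by simp
  moreover have "step_fun K N c0 (Right k (fst (st i)) (snd (st i))) (set_decode (head_sym (map (sym s) [i..<n] @ z)))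
    = (Right k (fst (st (Suc i))) (snd (st (Suc i))), cell s' i, MoveR)"
    using assms(1)[of i] Suc.prems by (cases "st (Suc i)") (simp add: up head_sym_def decode_sym cell_ne)
  ultimately have "tm_step machine (code (Right k (fst (st i)) (snd (st i))), rev (map (sym s') [0..<i]), map (sym s) [i..<n] @ z)
    = (code (Right k (fst (st (Suc i))) (snd (st (Suc i)))), rev (map (sym s') [0..<Suc i]), map (sym s) [Suc i..<n] @ z)"
    by (subst step_machine) (auto simp: up cell_Int sym_def)
  then show ?case unfolding funpow.simps o_apply Suc.IH[OF Suc_leD[OF Suc.prems]] .
qed simp

definition dn_store :: "nat option \<Rightarrow> store \<Rightarrow> store" where
  "dn_store v s = (case v of None \<Rightarrow> s | Some x \<Rightarrow> s(x := {p. Suc p \<in> s x}))"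

text \<open>Cells to the right of the head are already shifted, and \<open>b\<close> is the old bit
  of the cell just left. Cell 0 is rewritten without a move, hence \<open>Suc i\<close> steps from
  cell \<open>i\<close>.\<close>

lemma left_sweep:
  assumes "k \<in> ctl" "v = None \<or> (\<exists>x<N. v = Some x \<and> x \<noteq> 3)" "s 3 = {0}" "i < n"
    "b = (\<exists>x. v = Some x \<and> Suc i \<in> s x)"
  shows "(tm_step machine ^^ Suc i) (code (Left v b k), rev (map (sym s) [0..<i]),
      sym s i # map (sym (dn_store v s)) [Suc i..<n] @ z)
    = (code (Right k (start_state k) False), [], map (sym (dn_store v s)) [0..<n] @ z)"
  using assms(4,5)
proof (induction i arbitrary: b)
  case (0 b)
  let ?r = "sym s 0 # map (sym (dn_store v s)) [Suc 0..<n] @ z"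
  have "3 \<in> cell s 0" using assms(3) K K_less_N by (simp add: cell_def tracks_def)
  moreover have "(case v of None \<Rightarrow> cell s 0 | Some x \<Rightarrow> if b then insert x (cell s 0) else cell s 0 - {x}) = cell (dn_store v s) 0"
    using assms(2) 0 by (auto simp: cell_def tracks_def dn_store_def split: option.splits)
  ultimately have "step_fun K N c0 (Left v b k) (set_decode (head_sym ?r)) = (Right k (start_state k) False, cell (dn_store v s) 0, MoveN)"
    by (simp add: head_sym_def decode_sym)
  moreover have "Left v b k \<in> states" using assms(1,2) by auto
  ultimately have "tm_step machine (code (Left v b k), [], ?r)
    = (code (Right k (start_state k) False), [], sym (dn_store v s) 0 # map (sym (dn_store v s)) [Suc 0..<n] @ z)"
    by (subst step_machine) (auto simp: cell_Int sym_def)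
  moreover have "[0..<n] = 0 # [Suc 0..<n]" using 0 by (simp add: upt_conv_Cons)
  ultimately show ?case by simp
next
  case (Suc i b)
  let ?r = "sym s (Suc i) # map (sym (dn_store v s)) [Suc (Suc i)..<n] @ z"
  let ?b = "\<exists>x\<in>cell s (Suc i). v = Some x"
  have "3 \<notin> cell s (Suc i)" using assms(3) K K_less_N by (simp add: cell_def tracks_def)
  moreover have "(case v of None \<Rightarrow> cell s (Suc i) | Some x \<Rightarrow> if b then insert x (cell s (Suc i)) else cell s (Suc i) - {x}) = cell (dn_store v s) (Suc i)"
    using assms(2) Suc by (auto simp: cell_def tracks_def dn_store_def split: option.splits)
  ultimately have "step_fun K N c0 (Left v b k) (set_decode (head_sym ?r)) = (Left v ?b k, cell (dn_store v s) (Suc i), MoveL)"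
    by (simp add: head_sym_def decode_sym)
  moreover have "Left v b k \<in> states" using assms(1,2) by auto
  ultimately have step: "tm_step machine (code (Left v b k), rev (map (sym s) [0..<Suc i]), ?r)
    = (code (Left v ?b k), rev (map (sym s) [0..<i]), sym s i # sym (dn_store v s) (Suc i) # map (sym (dn_store v s)) [Suc (Suc i)..<n] @ z)"
    by (subst step_machine) (auto simp: cell_Int sym_def)
  have up: "[Suc i..<n] = Suc i # [Suc (Suc i)..<n]" using Suc.prems(1) by (simp add: upt_conv_Cons)
  have b: "?b = (\<exists>x. v = Some x \<and> Suc i \<in> s x)"
    using assms(2) by (auto simp: cell_def tracks_def)
  have "i < n" using Suc.prems(1) by simp
  from Suc.IH[OF this b] have ih: "(tm_step machine ^^ Suc i) (code (Left v ?b k), rev (map (sym s) [0..<i]),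
      sym s i # sym (dn_store v s) (Suc i) # map (sym (dn_store v s)) [Suc (Suc i)..<n] @ z)
    = (code (Right k (start_state k) False), [], map (sym (dn_store v s)) [0..<n] @ z)"
    by (simp only: up list.map append_Cons)
  have "(tm_step machine ^^ Suc (Suc i)) X = (tm_step machine ^^ Suc i) (tm_step machine X)" for X
    by (simp only: funpow_Suc_right o_apply)
  then show ?case by (simp only: step ih)
qed

end

context simulation begin

text \<open>Closed form of the bit carried by the right sweep on arrival at cell
  \<open>p\<close>.\<close>

definition pos_flag :: "'a item list \<Rightarrow> store \<Rightarrow> nat \<Rightarrow> bool" where
  "pos_flag k s p = (case up_var k of Some x \<Rightarrow> 0 < p \<and> p - 1 \<in> s x
     | None \<Rightarrow> (case flag_var k of Some x \<Rightarrow> (\<exists>i<p. i \<in> s x) | None \<Rightarrow> False))"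

fun pos_state :: "'a item list \<Rightarrow> store \<Rightarrow> nat \<Rightarrow> 'a" where
  "pos_state (C (Scan h q) # k) s p = scan_state h q s p"
| "pos_state k s p = undefined"

definition right_store :: "'a item list \<Rightarrow> store \<Rightarrow> store" where
  "right_store k s = (if dn_var k = None then next_store K k s else s)"

lemma cell_Int_3: "cell s p \<inter> {..<3} = tracks 3 s p"
  using K K_less_N by (auto simp: cell_def tracks_def)

lemma cell_fun_upd: "x < N \<Longrightarrow> cell (s(x := A)) p = (if p \<in> A then insert x (cell s p) else cell s p - {x})"
  by (auto simp: cell_def tracks_def)

lemma in_cell: "x < N \<Longrightarrow> x \<in> cell s p \<longleftrightarrow> p \<in> s x"
  by (auto simp: cell_def tracks_def)

lemma holds_cell: "evars e \<subseteq> {..<K} \<Longrightarrow> holds e (cell s p) \<longleftrightarrow> p \<in> ev e s"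
  unfolding cell_def using holds_tracks[of e K N s p] K_less_N by simp

lemma Suc_image_iff: "p \<in> Suc ` A \<longleftrightarrow> 0 < p \<and> p - 1 \<in> A"
  by (cases p) auto

lemma ex_less_Suc_iff: "(\<exists>i<Suc p. i \<in> A) \<longleftrightarrow> (\<exists>i<p. i \<in> A) \<or> p \<in> A"
  by (auto simp: less_Suc_eq)

lemma cell_step:
  assumes "k \<in> ctl"
  shows "cell_step K k (pos_state k s p) (pos_flag k s p) (cell s p)
    = ((pos_state k s (Suc p), pos_flag k s (Suc p)), cell (right_store k s) p)"
proof (cases k)
  case Nil
  then show ?thesis using K K_less_N
    by (simp add: pos_flag_def right_store_def in_cell ex_less_Suc_iff)
next
  case (Cons it r)
  show ?thesis
  proof (cases it)
    case (W x c)
    then have k: "k = W x c # r" using Cons by simp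
    then have x: "x = K + nW r" using wf_head_ctl[OF assms] by simp
    then have xN: "x < N" using nW_less[OF assms] k by simp
    have "cell (s(x := s x - {LEAST p. p \<in> s x})) p = (if \<exists>i<p. i \<in> s x then cell s p else cell s p - {x})"
    proof (cases "p \<in> s x")
      case True
      \<comment> \<open>An element of the counter survives iff it is not the least, that is, iff the
        carried bit is already set.\<close>
      have "p \<noteq> (LEAST p. p \<in> s x) \<longleftrightarrow> (\<exists>i<p. i \<in> s x)"
        by (metis LeastI Least_le True le_less_linear not_less_Least order_le_imp_less_or_eq)
      then show ?thesis using True xN by (auto simp: cell_fun_upd in_cell)
    next
      case False
      then show ?thesis using xN by (auto simp: cell_fun_upd in_cell)
    qed
    then show ?thesis using xN
      by (simp add: k pos_flag_def right_store_def in_cell ex_less_Suc_iff)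
  next
    case (C c)
    note k = Cons[unfolded C]
    have wf: "wf_com K c" using wf_head_ctl[OF assms] k by simp
    show ?thesis
    proof (cases c)
      case (Scan h q)
      let ?o = "snd (h (scan_state h q s p) (tracks 3 s p))"
      have o: "?o \<subseteq> {5..<K}" using wf Scan by simp
      have "cell (next_store K k s) p = insert N (tracks N s p \<union> {x \<in> ?o. x < N})"
        using k Scan by (auto simp: cell_def tracks_def)
      also have "\<dots> = cell s p \<union> ?o" using o K_less_N by (auto simp: cell_def)
      finally show ?thesis using k Scan by (simp add: pos_flag_def right_store_def cell_Int_3)
    next
      case (Rep d)
      have "K + nW r < N" using nW_less[OF assms] k by simp
      then show ?thesis using k Rep K K_less_N
        by (simp add: pos_flag_def right_store_def in_cell cell_fun_upd)
    qed (use wf k K_less_N in \<open>simp_all add: pos_flag_def right_store_def in_cell holds_cell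
        cell_fun_upd Suc_image_iff ex_less_Suc_iff\<close>)
  qed
qed

lemma dn_right_store: "dn_store (dn_var k) (right_store k s) = next_store K k s"
  by (cases k rule: dn_var.cases) (auto simp: dn_store_def right_store_def)

lemma pos_state_0: "pos_state k s 0 = start_state k"
  by (cases k rule: start_state.cases) auto

lemma pos_flag_0: "pos_flag k s 0 = False"
  by (auto simp: pos_flag_def split: option.splits)

definition bounded :: "nat \<Rightarrow> store \<Rightarrow> bool" where
  "bounded n s \<longleftrightarrow> (\<forall>x. s x \<subseteq> {..<n}) \<and> s 3 = {0}"

lemma bounded_pos: "bounded n s \<Longrightarrow> 0 < n"
  unfolding bounded_def by (metis insert_subset lessThan_iff)

lemma up_flag_var: "up_var k \<noteq> None \<Longrightarrow> flag_var k = None"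
  by (cases k rule: up_var.cases) auto

text \<open>Where \<open>next_ctl\<close> branches, the sweep has met every element of the tested
  set; elsewhere, as for \<open>Up\<close>, the result of \<open>next_ctl\<close> does not depend on
  the bit.\<close>

lemma pos_flag_end:
  assumes "bounded n s"
  shows "next_ctl K k (pos_flag k s n) = next_ctl K k (flag k s)"
proof (cases "flag_var k")
  case None
  then show ?thesis by (cases k rule: flag_var.cases) (auto elim: next_ctl.elims)
next
  case (Some x)
  moreover have "up_var k = None" using up_flag_var[of k] Some by (cases "up_var k") auto
  moreover have "(\<exists>i<n. i \<in> s x) \<longleftrightarrow> s x \<noteq> {}" using assms by (auto simp: bounded_def)
  ultimately show ?thesis by (simp add: pos_flag_def flag_def)
qed

text \<open>The situation between two commands: head on cell 0, \<open>n\<close> visited cells, and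
  \<open>j\<close> blanks stored explicitly behind them.\<close>

definition tape :: "nat \<Rightarrow> 'a item list \<Rightarrow> store \<Rightarrow> nat \<Rightarrow> tmconf" where
  "tape n k s j = (code (Right k (start_state k) False), [], map (sym s) [0..<n] @ replicate j 0)"

lemma right_sweep':
  assumes "k \<in> ctl"
  shows "(tm_step machine ^^ n) (tape n k s j) = (code (Right k (pos_state k s n) (pos_flag k s n)),
    rev (map (sym (right_store k s)) [0..<n]), replicate j 0)"
  unfolding tape_def using right_sweep[of n k "\<lambda>p. (pos_state k s p, pos_flag k s p)" s "right_store k s" n "replicate j 0"]
    cell_step[OF assms] assms
  by (simp add: pos_state_0 pos_flag_0)

lemma blank_head: "set_decode (head_sym (replicate j 0)) = {}"
  by (simp add: head_sym_zeros)

lemma ev_bounded: "bounded n s \<Longrightarrow> ev e s \<subseteq> {..<n}"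
  by (induction e) (auto simp: bounded_def)

lemma bounded_fun_upd: "bounded n s \<Longrightarrow> x \<noteq> 3 \<Longrightarrow> A \<subseteq> {..<n} \<Longrightarrow> bounded n (s(x := A))"
  by (simp add: bounded_def)

lemma bounded_mono: "bounded n s \<Longrightarrow> n \<le> m \<Longrightarrow> bounded m s"
  unfolding bounded_def by (metis lessThan_subset_iff order_trans)

text \<open>Only \<open>Up\<close> can leave the first \<open>n\<close> cells, by at most one cell,
  and not if the carried bit is unset at the end of the sweep.\<close>

lemma next_store_bounded:
  assumes "k \<in> ctl" "bounded n s"
  shows "up_var k = None \<or> \<not> pos_flag k s n \<Longrightarrow> bounded n (next_store K k s)" (is "?up \<Longrightarrow> _")
    and "bounded (Suc n) (next_store K k s)"
proof -
  have sub: "s x \<subseteq> {..<n}" for x using assms(2) by (simp add: bounded_def)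
  have "(?up \<longrightarrow> bounded n (next_store K k s)) \<and> bounded (Suc n) (next_store K k s)"
  proof (cases "up_var k")
    case None
    have "bounded n (next_store K k s)"
    proof (cases k)
      case (Cons it r)
      show ?thesis
      proof (cases it)
        case (W x c)
        then have "x \<noteq> 3" using wf_head_ctl[OF assms(1)] Cons K by simp
        moreover have "s x - A \<subseteq> {..<n}" for A using sub[of x] by blast
        ultimately show ?thesis using Cons W assms(2) by (simp add: bounded_fun_upd)
      next
        case (C c)
        then have wf: "wf_com K c" using wf_head_ctl[OF assms(1)] Cons by simp
        note k = Cons[unfolded C]
        show ?thesis
        proof (cases c)
          case (Up x)
          then show ?thesis using None k by simp
        next
          case (Dn x)
          have "{p. Suc p \<in> s x} \<subseteq> {..<n}" using sub[of x] by auto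
          then show ?thesis using Dn k wf assms(2) by (simp add: bounded_fun_upd)
        next
          case (Scan h q)
          have "exec 0 c s 3 = {0}" using exec_const[of K c 3 0 s] wf assms(2) by (simp add: bounded_def)
          moreover have "exec 0 c s x \<subseteq> {..<n}" for x
          proof
            fix p assume p: "p \<in> exec 0 c s x"
            show "p \<in> {..<n}"
            proof (rule ccontr)
              assume "p \<notin> {..<n}"
              then have "p \<notin> s y" for y using sub[of y] by blast
              then show False using p Scan wf by (auto simp: tracks_def)
            qed
          qed
          ultimately show ?thesis using Scan k by (simp add: bounded_def)
        qed (use k wf assms(2) K ev_bounded[OF assms(2)] sub in \<open>simp_all add: bounded_fun_upd\<close>)
      qed
    qed (use assms(2) in simp)
    then show ?thesis using bounded_mono[of n _ "Suc n"] by simp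
  next
    case (Some x)
    then obtain r where k: "k = C (Up x) # r" by (cases k rule: up_var.cases) auto
    then have "x \<noteq> 3" using wf_head_ctl[OF assms(1)] by simp
    moreover have "Suc ` s x \<subseteq> {..<Suc n}" using sub[of x] by auto
    moreover have "Suc ` s x \<subseteq> {..<n}" if "\<not> pos_flag k s n"
    proof -
      have "n - 1 \<notin> s x" using that bounded_pos[OF assms(2)] k by (simp add: pos_flag_def)
      moreover have "i < n" if "i \<in> s x" for i using sub[of x] that by auto
      ultimately have "Suc i < n" if "i \<in> s x" for i
        using that by (metis Suc_lessI diff_Suc_1)
      then show ?thesis by auto
    qed
    ultimately show ?thesis using k assms(2) bounded_mono[OF assms(2), of "Suc n"]
      by (auto intro!: bounded_fun_upd)
  qed
  then show "?up \<Longrightarrow> bounded n (next_store K k s)" "bounded (Suc n) (next_store K k s)" by auto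
qed

text \<open>One command takes \<open>n\<close> steps to the right, one for turning at the first
  blank and \<open>n\<close> steps back. At the turn \<open>Up\<close> may fill this blank, which
  lengthens the visited part by one.\<close>

lemma simulate_step:
  assumes "k \<in> ctl" "k \<noteq> []" "bounded n s" "ctl_step K (k, s) = (k', s')"
  shows "\<exists>n' j'. (tm_step machine ^^ (2 * n + 1)) (tape n k s j) = tape n' k' s' j'
    \<and> n' \<le> Suc n \<and> bounded n' s' \<and> k' \<in> ctl"
proof -
  obtain m where m: "n = Suc m" using bounded_pos[OF assms(3)] gr0_implies_Suc by blast
  let ?b = "pos_flag k s n"
  let ?w = "case up_var k of Some x \<Rightarrow> if ?b then {x, N} else {} | None \<Rightarrow> {}"
  let ?s1 = "right_store k s"
  have k': "k' = next_ctl K k ?b" and s': "s' = next_store K k s"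
    using assms(4) pos_flag_end[OF assms(3)] by (auto simp: ctl_step_def)
  have k'ctl: "k' \<in> ctl" using k' next_in_ctl assms(1) by simp
  let ?c1 = "(code (Right k (pos_state k s n) ?b), rev (map (sym ?s1) [0..<n]), replicate j 0)"
  let ?z = "set_encode (?w \<inter> {..N}) # replicate (j - 1) 0"
  let ?c2 = "(code (Left (dn_var k) False k'), rev (map (sym ?s1) [0..<m]), sym ?s1 m # ?z)"
  have c1: "(tm_step machine ^^ n) (tape n k s j) = ?c1" by (rule right_sweep'[OF assms(1)])
  have "step_fun K N c0 (Right k (pos_state k s n) ?b) (set_decode (head_sym (replicate j 0)))
    = (Left (dn_var k) False k', ?w, MoveL)"
    unfolding blank_head using assms(2) k' by simp
  moreover have "Right k (pos_state k s n) ?b \<in> states" using assms(1) by simp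
  moreover have "rev (map (sym ?s1) [0..<n]) = sym ?s1 m # rev (map (sym ?s1) [0..<m])" by (simp add: m)
  ultimately have c2: "tm_step machine ?c1 = ?c2"
    by (subst step_machine) (auto simp: tl_replicate)
  have dn: "dn_var k = None \<or> (\<exists>x<N. dn_var k = Some x \<and> x \<noteq> 3)"
    using wf_head_ctl[OF assms(1)] K_less_N by (cases k rule: dn_var.cases) auto
  have s1: "?s1 3 = {0}"
    using next_store_bounded(2)[OF assms(1,3)] assms(3) by (simp add: right_store_def bounded_def)
  have "(tm_step machine ^^ Suc m) ?c2 = (code (Right k' (start_state k') False), [], map (sym s') [0..<n] @ ?z)"
  proof -
    have "False = (\<exists>x. dn_var k = Some x \<and> Suc m \<in> ?s1 x)"
      using assms(3) m by (auto simp: right_store_def bounded_def)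
    moreover have "m < n" "[Suc m..<n] = []" using m by auto
    ultimately show ?thesis using left_sweep[where v="dn_var k" and s="?s1" and z="?z", OF k'ctl dn s1, of m n False]
      by (simp add: dn_right_store s' del: funpow.simps)
  qed
  moreover have "(tm_step machine ^^ (2 * n + 1)) X
    = (tm_step machine ^^ Suc m) (tm_step machine ((tm_step machine ^^ n) X))" for X
  proof -
    have "2 * n + 1 = Suc m + Suc n" using m by simp
    then show ?thesis by (simp only: funpow_add o_apply funpow.simps(2))
  qed
  ultimately have run: "(tm_step machine ^^ (2 * n + 1)) (tape n k s j)
    = (code (Right k' (start_state k') False), [], map (sym s') [0..<n] @ ?z)"
    by (simp only: c1 c2)
  show ?thesis
  proof (cases "\<exists>x. up_var k = Some x \<and> ?b")
    case True
    then obtain x where x: "up_var k = Some x" "?b" by blast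
    then obtain r where k: "k = C (Up x) # r" by (cases k rule: up_var.cases) auto
    then have "x < N" using wf_head_ctl[OF assms(1)] K_less_N by simp
    moreover have "n \<in> s' x" using x k s' by (simp add: pos_flag_def Suc_image_iff)
    moreover have "n \<notin> s' y" if "y \<noteq> x" for y
      using that k s' assms(3) by (auto simp: bounded_def)
    \<comment> \<open>The former blank receives \<open>x\<close> and nothing else but the mark, as
      no other set reaches cell \<open>n\<close>.\<close>
    ultimately have "?w \<inter> {..N} = cell s' n"
      using x by (auto simp: cell_def tracks_def)
    then have "tape (Suc n) k' s' (j - 1) = (code (Right k' (start_state k') False), [], map (sym s') [0..<n] @ ?z)"
      unfolding tape_def by (simp add: sym_def)
    then have "(tm_step machine ^^ (2 * n + 1)) (tape n k s j) = tape (Suc n) k' s' (j - 1)"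
      using run by (simp only:)
    then show ?thesis using k'ctl next_store_bounded(2)[OF assms(1,3)] s' by blast
  next
    case False
    then have "?w = {}" by (auto split: option.splits)
    then have "tape n k' s' (Suc (j - 1)) = (code (Right k' (start_state k') False), [], map (sym s') [0..<n] @ ?z)"
      unfolding tape_def by simp
    then have "(tm_step machine ^^ (2 * n + 1)) (tape n k s j) = tape n k' s' (Suc (j - 1))"
      using run by (simp only:)
    moreover have "up_var k = None \<or> \<not> ?b" using False by (cases "up_var k") auto
    then have "bounded n s'" using next_store_bounded(1)[OF assms(1,3)] s' by simp
    ultimately show ?thesis using k'ctl le_SucI[OF le_refl] by blast
  qed
qed

text \<open>Each command adds at most one visited cell, so no sweep of the \<open>i\<close> commands
  exceeds \<open>n + i\<close> cells.\<close>

lemma simulate_steps: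
  assumes "k \<in> ctl" "bounded n s" "(ctl_step K ^^ i) (k, s) = ([], s')"
  shows "\<exists>t n' j'. t \<le> i * (2 * (n + i) + 1) \<and> (tm_step machine ^^ t) (tape n k s j) = tape n' [] s' j'
    \<and> n' \<le> n + i \<and> bounded n' s'"
  using assms
proof (induction i arbitrary: k s n j)
  case 0
  then show ?case by (intro exI[of _ 0] exI[of _ n] exI[of _ j]) simp
next
  case (Suc i)
  show ?case
  proof (cases "k = []")
    case True
    have "(ctl_step K ^^ m) ([], s) = ([], s)" for m
      by (induction m) (auto simp: ctl_step_def)
    then have "s' = s" using Suc.prems(3) True by (metis prod.inject)
    then show ?thesis using True Suc.prems
      by (intro exI[of _ 0] exI[of _ n] exI[of _ j]) simp
  next
    case False
    obtain k1 s1 where 1: "ctl_step K (k, s) = (k1, s1)" by (cases "ctl_step K (k, s)")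
    obtain n1 j1 where run1: "(tm_step machine ^^ (2 * n + 1)) (tape n k s j) = tape n1 k1 s1 j1"
      and n1: "n1 \<le> Suc n" and b1: "bounded n1 s1" and k1: "k1 \<in> ctl"
      using simulate_step[OF Suc.prems(1) False Suc.prems(2) 1] by blast
    have "(ctl_step K ^^ i) (k1, s1) = ([], s')"
      using Suc.prems(3) 1 unfolding funpow_Suc_right o_apply by simp
    from Suc.IH[OF k1 b1 this, of j1] obtain t n' j' where
      t: "t \<le> i * (2 * (n1 + i) + 1)" and run2: "(tm_step machine ^^ t) (tape n1 k1 s1 j1) = tape n' [] s' j'"
      and n': "n' \<le> n1 + i" and b': "bounded n' s'" by blast
    have "(tm_step machine ^^ (t + (2 * n + 1))) (tape n k s j) = tape n' [] s' j'"
      unfolding funpow_add[of t] o_apply run1 run2 ..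
    moreover have "i * (2 * (n1 + i) + 1) \<le> i * (2 * (n + Suc i) + 1)"
      using n1 by (intro mult_le_mono) auto
    then have "t + (2 * n + 1) \<le> Suc i * (2 * (n + Suc i) + 1)" using t by simp
    moreover have "n' \<le> n + Suc i" using n' n1 by simp
    ultimately show ?thesis using b' by blast
  qed
qed

lemma simulate_halt:
  assumes "bounded n s"
  shows "\<exists>l r. (tm_step machine ^^ (n + 1)) (tape n [] s j) = (if s 5 \<noteq> {} then 1 else 2, l, r)"
proof -
  have k: "[] \<in> ctl" by (simp add: ctl_def)
  have f: "pos_flag [] s n \<longleftrightarrow> s 5 \<noteq> {}" using assms by (auto simp: pos_flag_def bounded_def)
  let ?q = "Right [] (pos_state [] s n) (pos_flag [] s n)"
  let ?l = "rev (map (sym (right_store [] s)) [0..<n])"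
  have "step_fun K N c0 ?q (set_decode (head_sym (replicate j 0))) = (if s 5 \<noteq> {} then Accept else Reject, {}, MoveN)"
    unfolding blank_head by (simp add: f)
  moreover have "?q \<in> states" using k by simp
  ultimately have "tm_step machine (code ?q, ?l, replicate j 0)
    = (code (if s 5 \<noteq> {} then Accept else Reject), ?l, 0 # tl (replicate j 0))"
    by (subst step_machine[where q' = "if s 5 \<noteq> {} then Accept else Reject" and g = "{}" and m = MoveN]) simp_all
  then have "tm_step machine (code ?q, ?l, replicate j 0)
    = (if s 5 \<noteq> {} then 1 else 2, ?l, 0 # tl (replicate j 0))"
    by (simp add: code)
  then have "(tm_step machine ^^ Suc n) (tape n [] s j) = (if s 5 \<noteq> {} then 1 else 2, ?l, 0 # tl (replicate j 0))"
    unfolding funpow.simps o_apply right_sweep'[OF k] by simp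
  then show ?thesis by auto
qed

end

section \<open>Loading the input and the running time of the machine\<close>

definition input_store :: "nat list \<Rightarrow> store" where
  "input_store w = (\<lambda>x. if x < 3 then {p. p < length w \<and> x \<in> set_decode (w ! p)}
     else if x = 3 then {0} else if x = 4 then {..<length w} else {})"

lemma set_decode_less: "a < 2 ^ n \<Longrightarrow> set_decode a \<subseteq> {..<n}"
proof
  fix i assume a: "a < 2 ^ n" and i: "i \<in> set_decode a"
  show "i \<in> {..<n}"
  proof (rule ccontr)
    assume "i \<notin> {..<n}"
    then have "(2::nat) ^ n \<le> 2 ^ i" by (intro power_increasing) auto
    then have "a < 2 ^ i" using a by linarith
    then have "a div 2 ^ i = 0" by simp
    then show False using i by (simp add: set_decode_def)
  qed
qed

lemma set_decode_empty: "set_decode a = {} \<Longrightarrow> a = 0"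
  by (metis set_decode_inverse set_encode_empty)

context simulation begin

lemma cell_input:
  assumes "set w \<subseteq> {1..4}" "p < length w"
  shows "(set_decode (w ! p) \<union> (if p = 0 then {3, 4, N} else {4, N})) \<inter> {..N} = cell (input_store w) p"
proof -
  have "w ! p \<in> {1..4}" using assms nth_mem by blast
  then have "set_decode (w ! p) \<subseteq> {..<3}" by (intro set_decode_less) auto
  then show ?thesis using assms(2) K K_less_N by (auto simp: cell_def tracks_def input_store_def)
qed

lemma init_sweep:
  assumes "set w \<subseteq> {1..4}" "i < length w"
  shows "(tm_step machine ^^ Suc i) (0, [], w) = (code Init, rev (map (sym (input_store w)) [0..<Suc i]), drop (Suc i) w)"
  using assms(2)
proof (induction i)
  case 0
  have w: "w = w ! 0 # drop (Suc 0) w" using 0 by (cases w) auto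
  have "tm_step machine (code Start, [], w) = (code Init, [sym (input_store w) 0], drop (Suc 0) w)"
  proof (subst step_machine)
    show "step_fun K N c0 Start (set_decode (head_sym w)) = (Init, set_decode (w ! 0) \<union> {3, 4, N}, MoveR)"
      by (subst w) (simp add: head_sym_def)
  qed (use cell_input[OF assms(1) 0] in \<open>auto simp: sym_def drop_Suc\<close>)
  then show ?case by (simp add: code)
next
  case (Suc i)
  have w: "drop (Suc i) w = w ! Suc i # drop (Suc (Suc i)) w" using Suc.prems by (simp add: Cons_nth_drop_Suc)
  have "w ! Suc i \<in> {1..4}" using assms(1) Suc.prems nth_mem by blast
  then have ne: "set_decode (w ! Suc i) \<noteq> {}" using set_decode_empty by fastforce
  let ?l = "rev (map (sym (input_store w)) [0..<Suc i])"
  have "tm_step machine (code Init, ?l, drop (Suc i) w)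
    = (code Init, sym (input_store w) (Suc i) # ?l, drop (Suc (Suc i)) w)"
  proof (subst step_machine)
    show "step_fun K N c0 Init (set_decode (head_sym (drop (Suc i) w))) = (Init, set_decode (w ! Suc i) \<union> {4, N}, MoveR)"
      using ne by (subst w) (simp add: head_sym_def)
  qed (use cell_input[OF assms(1) Suc.prems] w in \<open>auto simp: sym_def\<close>)
  then show ?case using Suc.IH Suc.prems unfolding funpow.simps(2)[where n = "Suc i"] o_apply by simp
qed

lemma bounded_input: "w \<noteq> [] \<Longrightarrow> bounded (length w) (input_store w)"
  by (auto simp: bounded_def input_store_def)

text \<open>Marking all cells, turning at the first blank and returning takes
  \<open>2 * length w + 1\<close> steps; the blank is written back at the turn, whence the final
  1.\<close>

lemma init_run:
  assumes "set w \<subseteq> {1..4}" "w \<noteq> []"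
  shows "(tm_step machine ^^ (2 * length w + 1)) (0, [], w) = tape (length w) [C c0] (input_store w) 1"
proof -
  obtain m where m: "length w = Suc m" using assms(2) by (cases w) auto
  let ?s = "input_store w"
  have k: "[C c0] \<in> ctl" by (simp add: ctl_def head_in_ctls)
  let ?c1 = "(code Init, rev (map (sym ?s) [0..<Suc m]), [])"
  have c1: "(tm_step machine ^^ Suc m) (0, [], w) = ?c1"
    using init_sweep[OF assms(1), of m] m by simp
  let ?c2 = "(code (Left None False [C c0]), rev (map (sym ?s) [0..<m]), sym ?s m # [0])"
  have c2: "tm_step machine ?c1 = ?c2"
  proof (subst step_machine)
    show "step_fun K N c0 Init (set_decode (head_sym [])) = (Left None False [C c0], {}, MoveL)"
      by (simp add: head_sym_def)
  qed auto
  have "?s 3 = {0}" by (simp add: input_store_def)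
  then have c3: "(tm_step machine ^^ Suc m) ?c2 = tape (length w) [C c0] ?s 1"
    using left_sweep[where v=None and s="?s" and z="[0]", OF k disjI1[OF refl], of m "Suc m" False]
    by (simp add: dn_store_def m tape_def del: funpow.simps)
  have "2 * length w + 1 = Suc m + Suc (Suc m)" using m by simp
  then show ?thesis by (simp only: funpow_add[of "Suc m"] funpow.simps(2)[where n = "Suc m"] o_apply c1 c2 c3)
qed

lemma machine_correct:
  assumes "set w \<subseteq> {1..4}" "w \<noteq> []"
  defines "L \<equiv> length w" and "e \<equiv> cost (length w) c0"
  shows "\<exists>t. t \<le> 3 * L + e + 2 + e * (2 * (L + e) + 1) \<and> halted (tm_run machine t w) \<and>
    (fst (tm_run machine t w) = 1 \<longleftrightarrow> exec L c0 (input_store w) 5 \<noteq> {})"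
proof -
  have k: "[C c0] \<in> ctl" by (simp add: ctl_def head_in_ctls)
  have K5: "5 \<le> K" using K by simp
  have "input_store w 4 = {..<L}" by (simp add: input_store_def L_def)
  from ctl_exec[where k="[]" and s="input_store w", OF wf K5 this] obtain s' where
    r: "reaches K e ([C c0], input_store w) ([], s')" and s': "\<forall>x<K. s' x = exec L c0 (input_store w) x"
    unfolding e_def L_def by blast
  then obtain i where i: "i \<le> e" "(ctl_step K ^^ i) ([C c0], input_store w) = ([], s')"
    unfolding reaches_def by blast
  obtain t n j where t: "t \<le> i * (2 * (L + i) + 1)"
    and run: "(tm_step machine ^^ t) (tape L [C c0] (input_store w) 1) = tape n [] s' j"
    and n: "n \<le> L + i" and b: "bounded n s'"
    using simulate_steps[OF k bounded_input[OF assms(2)] i(2), of 1] unfolding L_def by blast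
  obtain l r where halt: "(tm_step machine ^^ (n + 1)) (tape n [] s' j) = (if s' 5 \<noteq> {} then 1 else 2, l, r)"
    using simulate_halt[OF b] by blast
  let ?t = "(n + 1) + (t + (2 * L + 1))"
  have "tm_run machine ?t w = (if s' 5 \<noteq> {} then 1 else 2, l, r)"
    unfolding tm_run_def funpow_add[of "n + 1"] funpow_add[of t] o_apply
    using init_run[OF assms(1,2)] run halt by (simp only: L_def)
  moreover have "s' 5 = exec L c0 (input_store w) 5" using s' K by simp
  moreover have "i * (2 * (L + i) + 1) \<le> e * (2 * (L + e) + 1)"
    using i(1) by (intro mult_le_mono) auto
  then have "?t \<le> 3 * L + e + 2 + e * (2 * (L + e) + 1)" using t n i(1) by simp
  ultimately show ?thesis by (intro exI[of _ ?t]) (auto simp: halted_def)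
qed

end

theorem decides_if_exec:
  fixes c :: "'a::finite com"
  assumes "wf_com K c" "6 \<le> K"
    and "\<And>x. Q x \<Longrightarrow> enc x \<noteq> [] \<and> set (enc x) \<subseteq> {1..4}"
    and "\<And>x. Q x \<Longrightarrow> exec (length (enc x)) c (input_store (enc x)) 5 \<noteq> {} \<longleftrightarrow> P x"
  shows "\<exists>M. wf_tm M \<and> decides_in_polytime M Q enc P"
proof -
  interpret simulation K c by unfold_locales (use assms in auto)
  obtain a d where c: "\<And>L. cost L c \<le> a * (L + 1) ^ d" using cost_poly[of c] by blast
  define A where "A = a + 1"
  have bound: "3 * L + cost L c + 2 + cost L c * (2 * (L + cost L c) + 1) \<le> 10 * A ^ 2 * 2 ^ (2 * d + 2) * L ^ (2 * d + 2) + 10 * A ^ 2 * 2 ^ (2 * d + 2)"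
    if L: "1 \<le> L" for L :: nat
  proof -
    \<comment> \<open>A common bound for \<open>L + 1\<close> and the cost, in which the running
      time is quadratic. Later \<open>L + 1 \<le> 2 * L\<close> turns powers of \<open>L + 1\<close>
      into powers of \<open>L\<close>.\<close>
    let ?X = "A * (L + 1) ^ (d + 1)"
    have "cost L c \<le> A * (L + 1) ^ d"
      using c[of L] unfolding A_def by (simp add: algebra_simps)
    also have "\<dots> \<le> ?X" by (intro mult_le_mono power_increasing) auto
    finally have cX: "cost L c \<le> ?X" .
    have "(L + 1) ^ 1 \<le> (L + 1) ^ (d + 1)" by (intro power_increasing) auto
    then have "L + 1 \<le> (L + 1) ^ (d + 1)" by simp
    also have "\<dots> \<le> ?X" by (simp add: A_def)
    finally have LX: "L + 1 \<le> ?X" .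
    have X1: "1 \<le> ?X" using LX by linarith
    have "cost L c * (2 * (L + cost L c) + 1) \<le> ?X * (2 * (?X + ?X) + ?X)"
      using cX LX X1 by (intro mult_le_mono add_mono) auto
    then have "3 * L + cost L c + 2 + cost L c * (2 * (L + cost L c) + 1) \<le> 5 * ?X + 5 * (?X * ?X)"
      using cX LX by simp
    also have "?X \<le> ?X * ?X" by (rule le_square)
    then have "5 * ?X + 5 * (?X * ?X) \<le> 10 * (?X * ?X)" by simp
    also have "?X * ?X = A ^ 2 * (L + 1) ^ (2 * d + 2)"
    proof -
      have "(2 * d + 2) = (d + 1) * 2" by simp
      then have "(L + 1) ^ (2 * d + 2) = ((L + 1) ^ (d + 1)) ^ 2" by (simp only: power_mult)
      then show ?thesis by (simp only: power2_eq_square mult_ac)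
    qed
    also have "10 * (A ^ 2 * (L + 1) ^ (2 * d + 2)) \<le> 10 * (A ^ 2 * (2 * L) ^ (2 * d + 2))"
      using L by (intro mult_le_mono2 power_mono) auto
    finally show ?thesis
      unfolding power_mult_distrib mult.assoc by (rule trans_le_add1)
  qed
  let ?c = "10 * A ^ 2 * 2 ^ (2 * d + 2)"
  have "decides_in_polytime machine Q enc P"
    unfolding decides_in_polytime_def
  proof (rule exI[of _ ?c], rule exI[of _ "2 * d + 2"], intro allI impI)
    fix x assume x: "Q x"
    then have "1 \<le> length (enc x)" using assms(3) by (simp add: Suc_leI)
    moreover obtain t where t: "t \<le> 3 * length (enc x) + cost (length (enc x)) c + 2
        + cost (length (enc x)) c * (2 * (length (enc x) + cost (length (enc x)) c) + 1)"
      "halted (tm_run machine t (enc x))"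
      "fst (tm_run machine t (enc x)) = 1 \<longleftrightarrow> exec (length (enc x)) c (input_store (enc x)) 5 \<noteq> {}"
      using machine_correct[of "enc x"] assms(3)[OF x] by blast
    ultimately have "t \<le> ?c * length (enc x) ^ (2 * d + 2) + ?c"
      using bound le_trans by blast
    then show "\<exists>t. t \<le> ?c * length (enc x) ^ (2 * d + 2) + ?c \<and> halted (tm_run machine t (enc x)) \<and>
      (fst (tm_run machine t (enc x)) = 1) = P x"
      using t(2,3) assms(4)[OF x] by (intro exI[of _ t]) simp
  qed
  then show ?thesis using wf_machine by blast
qed

subsection \<open>Program fragments\<close>

text \<open>A point of the path is represented by the tape position at which its encoding ends, and a point
  of the plane by its index in the grid. The variables of the program are

  5: nonempty if no violation has been found;
  6 to 9: points of the path entered by a step to the right, up, left, down;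
  10: all points of the path; 11: the origin; 12: the box; 13: the first point of the path, as an index;
  14, 15: the bounds of the current segment, the lower one excluded;
  16, 17, 18: the segment, its predecessor and its successor; 24, 25, 26: the same as indices;
  19, 20, 21: auxiliary values; 22, 23: current point and tape position when drawing the path;
  27: the unblocked indices; 28, 29: the indices reached from the predecessor and from the successor;
  30: nonempty if noninterference fails; 31: nonempty if the set of extensions of the segment, or of one
  of its enlargements by one point, is finite; 32, 33, 34: copies of 16, 17, 18; 35: the set being flooded.\<close>

primrec writes :: "'a com \<Rightarrow> nat set" where
  "writes (Asn x e) = {x}"
| "writes (Up x) = {x}"
| "writes (Dn x) = {x}"
| "writes (Scan h q) = UNIV"
| "writes (c ;; d) = writes c \<union> writes d"
| "writes (If x c d) = writes c \<union> writes d"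
| "writes (Rep c) = writes c"

lemma exec_frame: "x \<notin> writes c \<Longrightarrow> exec L c s x = s x"
proof (induction c arbitrary: s)
  case (Rep c)
  have "(exec L c ^^ n) s x = s x" for n by (induction n) (use Rep in auto)
  then show ?case by simp
qed auto

lemma funpow_frame: "x \<notin> writes c \<Longrightarrow> (exec L c ^^ n) s x = s x"
  by (induction n) (auto simp: exec_frame)

definition nop :: "'a com" where "nop = Asn 19 (V 19)"

text \<open>Moves grid indices by one row of length \<open>3 * L\<close>: three shifts in each of
  \<open>L\<close> rounds.\<close>

definition up3 :: "nat \<Rightarrow> 'a com" where "up3 x = Rep (Up x ;; Up x ;; Up x)"

definition dn3 :: "nat \<Rightarrow> 'a com" where "dn3 x = Rep (Dn x ;; Dn x ;; Dn x)"

lemma exec_nop [simp]: "exec L nop s = s"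
  by (simp add: nop_def)

lemma funpow_fun_upd: "(\<And>s. f s = s(x := g (s x))) \<Longrightarrow> (f ^^ n) s = s(x := (g ^^ n) (s x))"
  by (induction n) (auto simp: fun_eq_iff)

lemma funpow_add_image: "((`) (\<lambda>p. p + k) ^^ n) X = (\<lambda>p. p + k * n) ` X" for X :: "nat set"
  by (induction n) (auto simp: image_image algebra_simps)

lemma funpow_add_vimage: "((\<lambda>X. {p. p + k \<in> X}) ^^ n) X = {p. p + k * n \<in> X}" for X :: "nat set"
  by (induction n) (auto simp: algebra_simps)

lemma exec_up3 [simp]: "exec L (up3 x) s = s(x := (\<lambda>p. p + 3 * L) ` s x)"
proof -
  have "exec L (Up x ;; Up x ;; Up x) s = s(x := (\<lambda>p. p + 3) ` s x)" for s
    by (simp add: image_image eval_nat_numeral)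
  note funpow_fun_upd[OF this, of L s]
  then show ?thesis unfolding up3_def exec.simps(7) funpow_add_image .
qed

lemma exec_dn3 [simp]: "exec L (dn3 x) s = s(x := {p. p + 3 * L \<in> s x})"
proof -
  have "exec L (Dn x ;; Dn x ;; Dn x) s = s(x := {p. p + 3 \<in> s x})" for s
    by (simp add: eval_nat_numeral)
  note funpow_fun_upd[OF this, of L s]
  then show ?thesis unfolding dn3_def exec.simps(7) funpow_add_vimage .
qed

lemma writes_simps [simp]: "writes nop = {19}" "writes (up3 x) = {x}" "writes (dn3 x) = {x}"
  by (simp_all add: nop_def up3_def dn3_def)

definition nbh_com :: "nat \<Rightarrow> nat \<Rightarrow> 'a com" where
  "nbh_com y x = (
     Asn y (V x) ;;
     Asn 19 (V x) ;; Up 19 ;; Asn y (Or (V y) (V 19)) ;;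
     Asn 19 (V x) ;; Dn 19 ;; Asn y (Or (V y) (V 19)) ;;
     Asn 19 (V x) ;; up3 19 ;; Asn y (Or (V y) (V 19)) ;;
     Asn 19 (V x) ;; dn3 19 ;; Asn y (Or (V y) (V 19)))"

lemma writes_nbh_com [simp]: "writes (nbh_com y x) = {y, 19}"
  by (auto simp: nbh_com_def)

lemma exec_nbh_com [simp]:
  "x \<noteq> y \<Longrightarrow> x \<noteq> 19 \<Longrightarrow> y \<noteq> 19 \<Longrightarrow> exec L (nbh_com y x) s y = nbh (3 * L) (s x)"
  "z \<noteq> y \<Longrightarrow> z \<noteq> 19 \<Longrightarrow> exec L (nbh_com y x) s z = s z"
proof -
  assume "x \<noteq> y" "x \<noteq> 19" "y \<noteq> 19"
  then show "exec L (nbh_com y x) s y = nbh (3 * L) (s x)"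
    by (auto simp: nbh_com_def nbh_def nbr_def)
next
  assume "z \<noteq> y" "z \<noteq> 19"
  then show "exec L (nbh_com y x) s z = s z" by (simp add: exec_frame)
qed

text \<open>Five nested loops give \<open>L ^ 5\<close> rounds, enough for the
  \<open>L ^ 4 + 1\<close> cells of the box.\<close>

definition flood_com :: "'a com" where
  "flood_com = Rep (Rep (Rep (Rep (Rep (nbh_com 20 35 ;; Asn 35 (Or (V 35) (And (V 20) (V 27))))))))"

lemma writes_flood_com [simp]: "writes flood_com = {19, 20, 35}"
  by (auto simp: flood_com_def)

lemma exec_flood_com [simp]:
  "exec L (flood_com :: 'a com) s 35 = ((\<lambda>M. M \<union> (nbh (3 * L) M \<inter> s 27)) ^^ (L ^ 5)) (s 35)"
  "z \<noteq> 19 \<Longrightarrow> z \<noteq> 20 \<Longrightarrow> z \<noteq> 35 \<Longrightarrow> exec L (flood_com :: 'a com) s z = s z"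
proof -
  let ?c = "nbh_com 20 35 ;; Asn 35 (Or (V 35) (And (V 20) (V 27))) :: 'a com"
  have power5: "L ^ 5 = L * L * L * L * L" by (simp add: eval_nat_numeral mult.assoc)
  have c: "exec L ?c s 35 = s 35 \<union> (nbh (3 * L) (s 35) \<inter> s 27)" "exec L ?c s 27 = s 27" for s
    by simp_all
  have *: "(f ^^ n) s 35 = ((\<lambda>M. M \<union> (nbh (3 * L) M \<inter> s 27)) ^^ n) (s 35) \<and> (f ^^ n) s 27 = s 27"
    if "\<And>s. f s 35 = s 35 \<union> (nbh (3 * L) (s 35) \<inter> s 27)" "\<And>s. f s 27 = s 27" for f :: "store \<Rightarrow> store" and n
    by (induction n) (simp_all add: that)
  have "exec L (flood_com :: 'a com) s = (exec L ?c ^^ (L ^ 5)) s"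
    unfolding flood_com_def exec.simps(7) funpow_mult power5 ..
  then show "exec L (flood_com :: 'a com) s 35 = ((\<lambda>M. M \<union> (nbh (3 * L) M \<inter> s 27)) ^^ (L ^ 5)) (s 35)"
    using *[of "exec L ?c", OF c] by (simp only:)
next
  assume "z \<noteq> 19" "z \<noteq> 20" "z \<noteq> 35"
  then show "exec L (flood_com :: 'a com) s z = s z" by (simp add: exec_frame)
qed

definition box_com :: "'a com" where
  "box_com = (Asn 12 (V 3) ;; Rep (Rep (Rep (Rep (Asn 19 (V 12) ;; Up 19 ;; Asn 12 (Or (V 12) (V 19)))))))"

lemma writes_box_com [simp]: "writes box_com = {12, 19}"
  by (auto simp: box_com_def)

lemma exec_box_com [simp]:
  "s 3 = {0} \<Longrightarrow> exec L (box_com :: 'a com) s 12 = {..L ^ 4}"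
  "z \<noteq> 12 \<Longrightarrow> z \<noteq> 19 \<Longrightarrow> exec L (box_com :: 'a com) s z = s z"
proof -
  let ?c = "Asn 19 (V 12) ;; Up 19 ;; Asn 12 (Or (V 12) (V 19)) :: 'a com"
  assume s: "s 3 = {0}"
  have c: "exec L ?c s 12 = s 12 \<union> Suc ` s 12" for s by simp
  have "(f ^^ n) (s(12 := {0})) 12 = {..n}" if "\<And>s. f s 12 = s 12 \<union> Suc ` s 12" for f :: "store \<Rightarrow> store" and n
  proof (induction n)
    case (Suc n)
    have "{..n} \<union> Suc ` {..n} = {..Suc n}" by (auto simp: image_Suc_atMost)
    then show ?case using Suc by (simp add: that)
  qed simp
  from this[of "exec L ?c", OF c] have "(exec L ?c ^^ (L ^ 4)) (s(12 := {0})) 12 = {..L ^ 4}" .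
  moreover have "exec L (box_com :: 'a com) s = (exec L ?c ^^ (L ^ 4)) (s(12 := {0}))"
    unfolding box_com_def exec.simps(5,7) funpow_mult
      exec.simps(1) ev.simps s power4_eq_xxxx ..
  ultimately show "exec L (box_com :: 'a com) s 12 = {..L ^ 4}" by (simp only:)
next
  assume "z \<noteq> 12" "z \<noteq> 19"
  then show "exec L (box_com :: 'a com) s z = s z" by (simp add: exec_frame)
qed

text \<open>The first point of the path is the base of the grid, in column \<open>L\<close> of row
  \<open>L\<close>.\<close>

definition start_com :: "'a com" where
  "start_com = (Asn 13 (V 3) ;; Rep (Up 13) ;; Rep (up3 13))"

lemma exec_start_com [simp]:
  "s 3 = {0} \<Longrightarrow> exec L start_com s = s(13 := {L + 3 * L * L})"
proof -
  assume s: "s 3 = {0}"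
  have "exec L (Up 13) s = s(13 := (\<lambda>p. p + 1) ` s 13)" for s by simp
  note 1 = funpow_fun_upd[OF this, of L]
  note 2 = funpow_fun_upd[OF exec_up3[of L 13], of L]
  show ?thesis
    unfolding start_com_def exec.simps(5,7) 1 2 funpow_add_image by (simp add: s)
qed

text \<open>The order on positions as far as one loop can follow it; path points are represented by
  positions below \<open>L\<close>, so among them it is the full order.\<close>

definition above :: "nat \<Rightarrow> nat set \<Rightarrow> nat set" where
  "above L X = {p. \<exists>q\<in>X. q < p \<and> p \<le> q + L}"

definition below :: "nat \<Rightarrow> nat set \<Rightarrow> nat set" where
  "below L X = {p. \<exists>q\<in>X. p < q \<and> q \<le> p + L}"

definition above_com :: "nat \<Rightarrow> nat \<Rightarrow> 'a com" where
  "above_com y x = (Asn 19 (V x) ;; Asn y (Diff (V x) (V x)) ;; Rep (Up 19 ;; Asn y (Or (V y) (V 19))))"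

definition below_com :: "nat \<Rightarrow> nat \<Rightarrow> 'a com" where
  "below_com y x = (Asn 19 (V x) ;; Asn y (Diff (V x) (V x)) ;; Rep (Dn 19 ;; Asn y (Or (V y) (V 19))))"

lemma writes_above_below [simp]: "writes (above_com y x) = {y, 19}" "writes (below_com y x) = {y, 19}"
  by (auto simp: above_com_def below_com_def)

lemma exec_above_com [simp]:
  "y \<noteq> 19 \<Longrightarrow> exec L (above_com y x :: 'a com) s y = above L (s x)"
  "z \<noteq> y \<Longrightarrow> z \<noteq> 19 \<Longrightarrow> exec L (above_com y x :: 'a com) s z = s z"
proof -
  assume y: "y \<noteq> 19"
  let ?s = "s(19 := s x, y := {})"
  let ?c = "Up 19 ;; Asn y (Or (V y) (V 19)) :: 'a com"
  have "(f ^^ n) ?s 19 = {p. \<exists>q\<in>s x. p = q + n} \<and> (f ^^ n) ?s y = above n (s x)"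
    if f: "\<And>s. f s 19 = Suc ` s 19" "\<And>s. f s y = s y \<union> f s 19" for f :: "store \<Rightarrow> store" and n
  proof (induction n)
    case 0
    then show ?case using y by (auto simp: above_def)
  next
    case (Suc n)
    have "Suc ` {p. \<exists>q\<in>s x. p = q + n} = {p. \<exists>q\<in>s x. p = q + Suc n}" by auto
    moreover have "above n (s x) \<union> {p. \<exists>q\<in>s x. p = q + Suc n} = above (Suc n) (s x)"
    proof -
      have "q < p \<and> p \<le> q + Suc n \<longleftrightarrow> q < p \<and> p \<le> q + n \<or> p = q + Suc n" for p q by auto
      then show ?thesis unfolding above_def by blast
    qed
    ultimately show ?case using Suc by (simp add: f)
  qed
  from this[of "exec L ?c" L] have "(exec L ?c ^^ L) ?s y = above L (s x)"
    using y by simp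
  moreover have "exec L (above_com y x :: 'a com) s = (exec L ?c ^^ L) ?s" using y by (simp add: above_com_def fun_upd_twist)
  ultimately show "exec L (above_com y x :: 'a com) s y = above L (s x)" by (simp only:)
next
  assume "z \<noteq> y" "z \<noteq> 19"
  then show "exec L (above_com y x) s z = s z" by (simp add: exec_frame)
qed

lemma exec_below_com [simp]:
  "y \<noteq> 19 \<Longrightarrow> exec L (below_com y x :: 'a com) s y = below L (s x)"
  "z \<noteq> y \<Longrightarrow> z \<noteq> 19 \<Longrightarrow> exec L (below_com y x :: 'a com) s z = s z"
proof -
  assume y: "y \<noteq> 19"
  let ?s = "s(19 := s x, y := {})"
  let ?c = "Dn 19 ;; Asn y (Or (V y) (V 19)) :: 'a com"
  have "(f ^^ n) ?s 19 = {p. p + n \<in> s x} \<and> (f ^^ n) ?s y = below n (s x)"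
    if f: "\<And>s. f s 19 = {p. Suc p \<in> s 19}" "\<And>s. f s y = s y \<union> f s 19" for f :: "store \<Rightarrow> store" and n
  proof (induction n)
    case 0
    then show ?case using y by (auto simp: below_def)
  next
    case (Suc n)
    have "below n (s x) \<union> {p. Suc (p + n) \<in> s x} = below (Suc n) (s x)"
    proof -
      have "p < q \<and> q \<le> p + Suc n \<longleftrightarrow> p < q \<and> q \<le> p + n \<or> q = Suc (p + n)" for p q by auto
      then show ?thesis unfolding below_def by blast
    qed
    then show ?case using Suc by (simp add: f)
  qed
  from this[of "exec L ?c" L] have "(exec L ?c ^^ L) ?s y = below L (s x)"
    using y by simp
  moreover have "exec L (below_com y x :: 'a com) s = (exec L ?c ^^ L) ?s" using y by (simp add: below_com_def fun_upd_twist)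
  ultimately show "exec L (below_com y x :: 'a com) s y = below L (s x)" by (simp only:)
next
  assume "z \<noteq> y" "z \<noteq> 19"
  then show "exec L (below_com y x) s z = s z" by (simp add: exec_frame)
qed

subsection \<open>Drawing the path\<close>

definition move_com :: "'a com" where
  "move_com = (
     Asn 19 (And (V 23) (V 6)) ;; If 19 (Up 22) nop ;;
     Asn 19 (And (V 23) (V 7)) ;; If 19 (up3 22) nop ;;
     Asn 19 (And (V 23) (V 8)) ;; If 19 (Dn 22) nop ;;
     Asn 19 (And (V 23) (V 9)) ;; If 19 (dn3 22) nop)"

definition record_com :: "nat \<Rightarrow> nat \<Rightarrow> 'a com" where
  "record_com g i = (Asn 19 (And (V 23) (V i)) ;; If 19 (Asn g (Or (V g) (V 22))) nop)"

definition draw_com :: "'a com" where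
  "draw_com = (Asn 22 (V 13) ;; Asn 23 (V 3) ;;
     Asn 24 (Diff (V 3) (V 3)) ;; Asn 25 (Diff (V 3) (V 3)) ;; Asn 26 (Diff (V 3) (V 3)) ;;
     Rep (move_com ;; record_com 24 16 ;; record_com 25 17 ;; record_com 26 18 ;; Up 23))"

definition move_set :: "nat \<Rightarrow> store \<Rightarrow> nat \<Rightarrow> nat set \<Rightarrow> nat set" where
  "move_set L s t X =
    (let X = if t \<in> s 6 then Suc ` X else X;
         X = if t \<in> s 7 then (\<lambda>p. p + 3 * L) ` X else X;
         X = if t \<in> s 8 then {p. Suc p \<in> X} else X
     in if t \<in> s 9 then {p. p + 3 * L \<in> X} else X)"

text \<open>The current point after tape position \<open>t\<close>: the move marked at
  \<open>t\<close> is made before the point is recorded.\<close>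

primrec walker :: "nat \<Rightarrow> store \<Rightarrow> nat \<Rightarrow> nat set" where
  "walker L s 0 = move_set L s 0 (s 13)"
| "walker L s (Suc t) = move_set L s (Suc t) (walker L s t)"

lemma writes_draw [simp]:
  "writes move_com = {19, 22}" "writes (record_com g i) = {19, g}"
  "writes draw_com = {19, 22, 23, 24, 25, 26}"
  by (auto simp: move_com_def record_com_def draw_com_def)

lemma exec_move_com: "s 23 = {t} \<Longrightarrow> exec L move_com s 22 = move_set L s t (s 22)"
  by (simp add: move_com_def move_set_def Let_def)

lemma exec_record_com:
  "s 23 = {t} \<Longrightarrow> g \<noteq> 19 \<Longrightarrow> i \<noteq> 19 \<Longrightarrow> exec L (record_com g i) s g = (if t \<in> s i then s g \<union> s 22 else s g)"
  by (simp add: record_com_def)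

lemma exec_draw_com:
  assumes "s 3 = {0}"
  shows "exec L (draw_com :: 'a com) s 24 = \<Union> (walker L s ` (s 16 \<inter> {..<L}))"
    "exec L (draw_com :: 'a com) s 25 = \<Union> (walker L s ` (s 17 \<inter> {..<L}))"
    "exec L (draw_com :: 'a com) s 26 = \<Union> (walker L s ` (s 18 \<inter> {..<L}))"
proof -
  let ?mv = "move_com :: 'a com" and ?r24 = "record_com 24 16 :: 'a com"
    and ?r25 = "record_com 25 17 :: 'a com" and ?r26 = "record_com 26 18 :: 'a com"
  let ?c = "?mv ;; ?r24 ;; ?r25 ;; ?r26 ;; Up 23"
  define s0 where "s0 = s(22 := s 13, 23 := {0}, 24 := {}, 25 := {}, 26 := {})"
  \<comment> \<open>The current point before position \<open>n\<close> is treated, which is what the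
    loop invariant speaks about.\<close>
  define cur where "cur n = (case n of 0 \<Rightarrow> s 13 | Suc t \<Rightarrow> walker L s t)" for n
  have cur: "move_set L s n (cur n) = walker L s n" for n
    by (cases n) (simp_all add: cur_def)
  have less_Suc: "A \<inter> {..<Suc n} = (if n \<in> A then insert n (A \<inter> {..<n}) else A \<inter> {..<n})" for A :: "nat set" and n
    by (auto simp: less_Suc_eq)
  define f where "f = exec L ?c"
  have f: "f s = (exec L ?r26 (exec L ?r25 (exec L ?r24 (exec L ?mv s))))
    (23 := Suc ` exec L ?r26 (exec L ?r25 (exec L ?r24 (exec L ?mv s))) 23)" for s
    by (simp add: f_def)
  have f_frame: "x \<notin> writes ?c \<Longrightarrow> (f ^^ n) s x = s x" for x n s
    unfolding f_def by (rule funpow_frame)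
  have "(f ^^ n) s0 23 = {n} \<and> (f ^^ n) s0 22 = cur n \<and>
    (f ^^ n) s0 24 = \<Union> (walker L s ` (s 16 \<inter> {..<n})) \<and>
    (f ^^ n) s0 25 = \<Union> (walker L s ` (s 17 \<inter> {..<n})) \<and>
    (f ^^ n) s0 26 = \<Union> (walker L s ` (s 18 \<inter> {..<n}))" for n
  proof (induction n)
    case 0
    then show ?case by (simp add: s0_def cur_def)
  next
    case (Suc n)
    define s1 where "s1 = (f ^^ n) s0"
    have fr: "s1 x = s x" if "x \<in> {6, 7, 8, 9, 16, 17, 18}" for x
    proof -
      have "x \<notin> writes ?c" using that by auto
      then have "s1 x = s0 x" unfolding s1_def by (rule f_frame)
      then show ?thesis using that by (auto simp: s0_def)
    qed
    have mv: "move_set L s1 n X = move_set L s n X" for X by (simp add: move_set_def fr)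
    define s2 where "s2 = exec L ?mv s1"
    have s2f: "s2 x = s1 x" if "x \<noteq> 19" "x \<noteq> 22" for x
      unfolding s2_def using that by (simp add: exec_frame)
    have s2: "s2 22 = walker L s n"
      unfolding s2_def using Suc
      by (subst exec_move_com[of s1 n]) (simp_all add: s1_def[symmetric] mv cur)
    define s3 where "s3 = exec L ?r24 s2"
    have s3f: "s3 x = s2 x" if "x \<noteq> 19" "x \<noteq> 24" for x
      unfolding s3_def using that by (simp add: exec_frame)
    have s3: "s3 24 = (if n \<in> s 16 then s1 24 \<union> walker L s n else s1 24)"
      unfolding s3_def using Suc
      by (subst exec_record_com[of s2 n]) (simp_all add: s1_def[symmetric] fr s2 s2f)
    define s4 where "s4 = exec L ?r25 s3"
    have s4f: "s4 x = s3 x" if "x \<noteq> 19" "x \<noteq> 25" for x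
      unfolding s4_def using that by (simp add: exec_frame)
    have s4: "s4 25 = (if n \<in> s 17 then s1 25 \<union> walker L s n else s1 25)"
      unfolding s4_def using Suc
      by (subst exec_record_com[of s3 n]) (simp_all add: s1_def[symmetric] fr s2 s2f s3f)
    define s5 where "s5 = exec L ?r26 s4"
    have s5f: "s5 x = s4 x" if "x \<noteq> 19" "x \<noteq> 26" for x
      unfolding s5_def using that by (simp add: exec_frame)
    have s5: "s5 26 = (if n \<in> s 18 then s1 26 \<union> walker L s n else s1 26)"
      unfolding s5_def using Suc
      by (subst exec_record_com[of s4 n]) (simp_all add: s1_def[symmetric] fr s2 s2f s3f s4f)
    have "(f ^^ Suc n) s0 = s5(23 := Suc ` s5 23)"
      by (simp add: f s1_def s2_def s3_def s4_def s5_def)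
    then show ?case using Suc
      by (simp add: s1_def[symmetric] cur_def less_Suc Un_commute s2 s3 s4 s5 s2f s3f s4f s5f)
  qed
  moreover have "exec L (draw_com :: 'a com) s = (f ^^ L) s0"
    unfolding f_def by (simp add: draw_com_def s0_def assms)
  ultimately show "exec L (draw_com :: 'a com) s 24 = \<Union> (walker L s ` (s 16 \<inter> {..<L}))"
    "exec L (draw_com :: 'a com) s 25 = \<Union> (walker L s ` (s 17 \<inter> {..<L}))"
    "exec L (draw_com :: 'a com) s 26 = \<Union> (walker L s ` (s 18 \<inter> {..<L}))"
    by simp_all
qed

subsection \<open>Scanning the input\<close>

text \<open>The automaton reads every coordinate modulo 3, which determines the direction of each step
  of the path. The components of a state: which number is being read (\<open>None\<close> for the index of the
  origin, otherwise whether it is a second coordinate), its sign, whether a nonzero digit has occurred in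
  the current position, the value of the digits read so far, the first coordinate, and the previous position.\<close>
type_synonym scan = "bool option \<times> bool \<times> bool \<times> 3 \<times> 3 \<times> (3 \<times> 3) option"

definition dir_tracks :: "3 \<Rightarrow> 3 \<Rightarrow> nat set" where
  "dir_tracks a b = (if a = 1 \<and> b = 0 then {6} else if a = 0 \<and> b = 1 then {7}
     else if a = -1 \<and> b = 0 then {8} else if a = 0 \<and> b = -1 then {9} else {})"

text \<open>Track 11 recognises the origin by the absence of nonzero digits in both coordinates. The
  first point has no previous position and hence no direction.\<close>

definition marks :: "(3 \<times> 3) option \<Rightarrow> bool \<Rightarrow> 3 \<Rightarrow> 3 \<Rightarrow> nat set" where
  "marks prev nz x y = {10} \<union> (if nz then {} else {11}) \<union>
     (case prev of None \<Rightarrow> {} | Some (x', y') \<Rightarrow> dir_tracks (x - x') (y - y'))"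

text \<open>The four sets are the codes of digit 0, digit 1, minus sign and separator. Digits come
  most significant first, so the value modulo 3 follows by Horner's rule. \<open>nz\<close> is kept
  from the first coordinate to the second, so that in the end it concerns the whole point.\<close>

fun scan_step :: "scan \<Rightarrow> nat set \<Rightarrow> scan \<times> nat set" where
  "scan_step (ph, neg, nz, v, cx, prev) g =
    (if g = {0} then ((ph, neg, nz, 2 * v, cx, prev), {})
     else if g = {1} then ((ph, neg, True, 2 * v + 1, cx, prev), {})
     else if g = {2} then ((ph, True, nz, v, cx, prev), {})
     else if g = {0, 1} then
       (let n = if neg then - v else v in
        case ph of
          None \<Rightarrow> ((Some False, False, False, 0, 0, None), {})
        | Some b \<Rightarrow> if b then ((Some False, False, False, 0, 0, Some (cx, n)), marks prev nz cx n)
            else ((Some True, False, nz, 0, n, prev), {}))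
     else ((ph, neg, nz, v, cx, prev), {}))"

declare scan_step.simps [simp del]

definition scan_start :: scan where "scan_start = (None, False, False, 0, 0, None)"

lemma scan_step_marks: "snd (scan_step q g) \<subseteq> {6..<12}" "snd (scan_step q {}) = {}"
  by (cases q; simp add: scan_step.simps marks_def dir_tracks_def Let_def split: option.split)+

lemma decode_symbols [simp]: "set_decode (Suc 0) = {0}" "set_decode 2 = {1}" "set_decode 3 = {0, 1}" "set_decode 4 = {2}"
  using set_encode_inverse[of "{0}"] set_encode_inverse[of "{1}"] set_encode_inverse[of "{0, 1}"] set_encode_inverse[of "{2}"]
  by (simp_all add: set_encode_insert numeral_3_eq_3)

primrec run :: "scan \<Rightarrow> nat list \<Rightarrow> scan" where
  "run q [] = q"
| "run q (a # u) = run (fst (scan_step q (set_decode a))) u"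

primrec outs :: "scan \<Rightarrow> nat list \<Rightarrow> nat set list" where
  "outs q [] = []"
| "outs q (a # u) = snd (scan_step q (set_decode a)) # outs (fst (scan_step q (set_decode a))) u"

lemma run_append [simp]: "run q (u @ v) = run (run q u) v"
  by (induction u arbitrary: q) auto

lemma outs_append [simp]: "outs q (u @ v) = outs q u @ outs (run q u) v"
  by (induction u arbitrary: q) auto

lemma length_outs [simp]: "length (outs q u) = length u"
  by (induction u arbitrary: q) auto

lemma outs_nth: "p < length u \<Longrightarrow> outs q u ! p = snd (scan_step (run q (take p u)) (set_decode (u ! p)))"
proof (induction u arbitrary: q p)
  case (Cons a u)
  then show ?case by (cases p) simp_all
qed simp

lemma tracks_input: "set w \<subseteq> {1..4} \<Longrightarrow> p < length w \<Longrightarrow> tracks 3 (input_store w) p = set_decode (w ! p)"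
proof -
  assume w: "set w \<subseteq> {1..4}" and p: "p < length w"
  then have "w ! p \<in> {1..4}" using nth_mem by blast
  then have "set_decode (w ! p) \<subseteq> {..<3}" by (intro set_decode_less) auto
  then show ?thesis using p by (auto simp: tracks_def input_store_def)
qed

lemma scan_state_run: "set w \<subseteq> {1..4} \<Longrightarrow> p \<le> length w \<Longrightarrow>
  scan_state scan_step q (input_store w) p = run q (take p w)"
  by (induction p) (simp_all add: tracks_input take_Suc_conv_app_nth)

lemma exec_scan:
  assumes "set w \<subseteq> {1..4}" "3 \<le> x"
  shows "exec L (Scan scan_step q) (input_store w) x = input_store w x \<union> {p. p < length w \<and> x \<in> outs q w ! p}"
proof -
  have "tracks 3 (input_store w) p = {}" if "\<not> p < length w" for p
    using that by (auto simp: tracks_def input_store_def)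
  then have "snd (scan_step (scan_state scan_step q (input_store w) p) (tracks 3 (input_store w) p))
    = (if p < length w then outs q w ! p else {})" for p
    using assms(1) by (simp add: scan_state_run tracks_input outs_nth scan_step_marks)
  then show ?thesis by auto
qed

declare bits.simps [simp del]

text \<open>Induction along \<open>bits\<close>, which appends the least significant digit; this is
  one step of Horner's rule.\<close>

lemma run_bits: "run (ph, neg, nz, 0, cx, prev) (bits n) = (ph, neg, nz \<or> n \<noteq> 0, of_nat n, cx, prev)
  \<and> set (outs (ph, neg, nz, 0, cx, prev) (bits n)) \<subseteq> {{}}"
proof (induction n rule: bits.induct)
  case (1 n)
  show ?case
  proof (cases "n < 2")
    case True
    then have "n = 0 \<or> n = 1" by auto
    then show ?thesis by (auto simp: scan_step.simps bits.simps[of 0] bits.simps[of 1] bits.simps[of "Suc 0"] numeral_2_eq_2[symmetric])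
  next
    case False
    have b: "bits n = bits (n div 2) @ [Suc (n mod 2)]" using False by (subst bits.simps) simp
    have nz: "n \<noteq> 0" "n div 2 \<noteq> 0" using False by auto
    have n: "(of_nat n :: 3) = 2 * of_nat (n div 2) + of_nat (n mod 2)"
      by (metis mult_div_mod_eq of_nat_add of_nat_mult of_nat_numeral)
    have "n mod 2 = 0 \<or> n mod 2 = 1" by auto
    then show ?thesis
      unfolding b using 1[OF False] nz n by (elim disjE) (simp_all add: scan_step.simps numeral_2_eq_2[symmetric])
  qed
qed

definition body :: "int \<Rightarrow> nat list" where
  "body z = (if z < 0 then [4] else []) @ bits (nat \<bar>z\<bar>)"

lemma enc_int_body: "enc_int z = body z @ [3]"
  by (simp add: enc_int_def body_def)

lemma run_body: "run (ph, False, nz, 0, cx, prev) (body z) = (ph, z < 0, nz \<or> z \<noteq> 0, of_nat (nat \<bar>z\<bar>), cx, prev)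
  \<and> set (outs (ph, False, nz, 0, cx, prev) (body z)) \<subseteq> {{}}"
  using run_bits[of ph "z < 0" nz cx prev "nat \<bar>z\<bar>"] by (auto simp: body_def scan_step.simps)

lemma of_int_signed: "(if z < 0 then - of_nat (nat \<bar>z\<bar>) else of_nat (nat \<bar>z\<bar>)) = (of_int z :: 3)"
  by (cases "z < 0") (simp_all add: of_nat_nat)

lemma bits_symbols: "set (bits n) \<subseteq> {1..4}"
  by (induction n rule: bits.induct) (subst bits.simps, auto)

lemma enc_int_symbols: "set (enc_int z) \<subseteq> {1..4}"
  using bits_symbols by (auto simp: enc_int_def)

text \<open>The closing separator is left out, so that \<open>loc\<close> becomes the position of
  this separator, where the scan emits the marks of the point.\<close>

definition block :: "pos \<Rightarrow> nat list" where
  "block p = body (fst p) @ [3] @ body (snd p)"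

lemma run_block:
  "run (Some False, False, False, 0, 0, prev) (block p) =
     (Some True, snd p < 0, p \<noteq> (0, 0), of_nat (nat \<bar>snd p\<bar>), of_int (fst p), prev)"
  "set (outs (Some False, False, False, 0, 0, prev) (block p)) \<subseteq> {{}}"
proof -
  note x = run_body[of "Some False" False 0 prev "fst p"]
  note y = run_body[of "Some True" "fst p \<noteq> 0" "of_int (fst p)" prev "snd p"]
  have 1: "scan_step (run (Some False, False, False, 0, 0, prev) (body (fst p))) {0, 1}
    = ((Some True, False, fst p \<noteq> 0, 0, of_int (fst p), prev), {})"
    using x of_int_signed[of "fst p"] by (simp add: scan_step.simps Let_def)
  show "run (Some False, False, False, 0, 0, prev) (block p) =
     (Some True, snd p < 0, p \<noteq> (0, 0), of_nat (nat \<bar>snd p\<bar>), of_int (fst p), prev)"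
    using y 1 by (cases p) (simp add: block_def)
  show "set (outs (Some False, False, False, 0, 0, prev) (block p)) \<subseteq> {{}}"
    using x y 1 by (simp add: block_def)
qed

section \<open>Positions of the path points in the encoding\<close>

context config begin

definition prefix :: "nat \<Rightarrow> nat list" where
  "prefix l = enc_int (int og) @ concat (map (\<lambda>p. block p @ [3]) (take l ps))"

definition loc :: "nat \<Rightarrow> nat" where "loc l = length (prefix l @ block (ps ! l))"

definition prev :: "nat \<Rightarrow> (3 \<times> 3) option" where
  "prev l = (if l = 0 then None else Some (of_int (fst (ps ! (l - 1))), of_int (snd (ps ! (l - 1)))))"

definition marks_at :: "nat \<Rightarrow> nat set" where
  "marks_at l = marks (prev l) (ps ! l \<noteq> (0, 0)) (of_int (fst (ps ! l))) (of_int (snd (ps ! l)))"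

abbreviation "inp \<equiv> enc_config ps og"

abbreviation "L \<equiv> length (enc_config ps og)"

lemma prefix_Suc: "l < m \<Longrightarrow> prefix (Suc l) = prefix l @ block (ps ! l) @ [3]"
  by (simp add: prefix_def take_Suc_conv_app_nth)

lemma prefix_m: "prefix m = inp"
  by (simp add: prefix_def enc_config_def enc_int_body block_def)

lemma inp_symbols: "set inp \<subseteq> {1..4}"
  using enc_int_symbols by (fastforce simp: enc_config_def)

lemma length_prefix_Suc: "l < m \<Longrightarrow> length (prefix (Suc l)) = Suc (loc l)"
  by (simp add: prefix_Suc loc_def)

lemma length_prefix_mono: "l \<le> l' \<Longrightarrow> l' \<le> m \<Longrightarrow> length (prefix l) \<le> length (prefix l')"
proof (induction l' rule: dec_induct)
  case (step n)
  then show ?case using prefix_Suc[of n] by simp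
qed simp

lemma loc_less: "l < m \<Longrightarrow> loc l < L"
  using length_prefix_mono[of "Suc l" m] length_prefix_Suc[of l] prefix_m by simp

lemma loc_mono: "i < j \<Longrightarrow> j < m \<Longrightarrow> loc i < loc j"
  using length_prefix_mono[of "Suc i" j] length_prefix_Suc[of i] by (simp add: loc_def)

lemma loc_inj: "i < m \<Longrightarrow> j < m \<Longrightarrow> loc i = loc j \<longleftrightarrow> i = j"
  using loc_mono[of i j] loc_mono[of j i] by (cases i j rule: linorder_cases) auto

text \<open>Together with \<open>loc l < L\<close> this gives \<open>m < L\<close> and
  \<open>3 \<le> L\<close>, the room required around the path in the grid.\<close>

lemma loc_ge: "l < m \<Longrightarrow> l + 2 \<le> loc l"
proof (induction l)
  case 0
  have "enc_int z \<noteq> []" for z by (simp add: enc_int_def)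
  then have "1 \<le> length (prefix 0)" by (simp add: prefix_def Suc_le_eq)
  moreover have "1 \<le> length (block (ps ! 0))" by (simp add: block_def)
  ultimately show ?case by (simp add: loc_def)
next
  case (Suc l)
  then show ?case using loc_mono[of l "Suc l"] by simp
qed

lemma m_less_L: "m < L" and L_ge: "3 \<le> L"
proof -
  have "m \<noteq> 0" using og by auto
  then have "m - 1 + 2 < L" using loc_ge[of "m - 1"] loc_less[of "m - 1"] by simp
  then show "m < L" "3 \<le> L" by auto
qed

text \<open>After each complete point the automaton is in the same state again, except for the
  remembered position, so the induction proceeds point by point.\<close>

lemma run_prefix:
  assumes "l \<le> m"
  shows "run scan_start (prefix l) = (Some False, False, False, 0, 0, prev l) \<and>
    (\<forall>j<l. outs scan_start (prefix l) ! loc j = marks_at j) \<and>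
    (\<forall>t<length (prefix l). t \<notin> loc ` {..<l} \<longrightarrow> outs scan_start (prefix l) ! t = {})"
  using assms
proof (induction l)
  case 0
  have b: "run scan_start (body (int og)) = (None, False, og \<noteq> 0, of_nat og, 0, None)"
    "set (outs scan_start (body (int og))) \<subseteq> {{}}"
    using run_body[of None False 0 None "int og"] by (simp_all add: scan_start_def)
  have "set (outs scan_start (prefix 0)) \<subseteq> {{}}"
    using b by (simp add: prefix_def enc_int_body scan_step.simps)
  then have "outs scan_start (prefix 0) ! t = {}" if "t < length (prefix 0)" for t
    using that subsetD[OF _ nth_mem, of "outs scan_start (prefix 0)" "{{}}" t] by simp
  then show ?case using b(1) by (simp add: prefix_def enc_int_body prev_def scan_step.simps)
next
  case (Suc l)
  then have l: "l < m" by simp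
  note IH = Suc.IH[OF less_imp_le[OF l]]
  let ?q = "(Some False, False, False, 0, 0, prev l) :: scan"
  note blk = run_block[of "prev l" "ps ! l"]
  have last: "scan_step (run ?q (block (ps ! l))) {0, 1}
    = ((Some False, False, False, 0, 0, prev (Suc l)), marks_at l)"
    unfolding blk(1) using of_int_signed[of "snd (ps ! l)"]
    by (simp add: scan_step.simps Let_def prev_def marks_at_def)
  have run: "run scan_start (prefix (Suc l)) = (Some False, False, False, 0, 0, prev (Suc l))"
    using IH last by (simp add: prefix_Suc[OF l])
  have outs: "outs scan_start (prefix (Suc l)) = outs scan_start (prefix l) @ outs ?q (block (ps ! l)) @ [marks_at l]"
    using IH last by (simp add: prefix_Suc[OF l])
  have new: "outs scan_start (prefix (Suc l)) ! loc l = marks_at l"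
    unfolding outs loc_def by (simp add: nth_append)
  have old: "outs scan_start (prefix (Suc l)) ! t = outs scan_start (prefix l) ! t" if "t < length (prefix l)" for t
    unfolding outs using that by (simp add: nth_append)
  have blank: "outs scan_start (prefix (Suc l)) ! t = {}" if "length (prefix l) \<le> t" "t < loc l" for t
  proof -
    have i: "t - length (prefix l) < length (block (ps ! l))" using that by (simp add: loc_def)
    then have "outs scan_start (prefix (Suc l)) ! t = outs ?q (block (ps ! l)) ! (t - length (prefix l))"
      unfolding outs using that by (simp add: nth_append)
    moreover have "outs ?q (block (ps ! l)) ! (t - length (prefix l)) \<in> set (outs ?q (block (ps ! l)))"
      using i by (intro nth_mem) simp
    ultimately show ?thesis using blk(2) by auto
  qed
  have lt: "loc j < length (prefix l)" if "j < l" for j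
    using that length_prefix_mono[of "Suc j" l] length_prefix_Suc[of j] l by simp
  have "outs scan_start (prefix (Suc l)) ! loc j = marks_at j" if "j < Suc l" for j
    using that new old[OF lt] IH by (cases "j = l") auto
  moreover have "outs scan_start (prefix (Suc l)) ! t = {}"
    if "t < length (prefix (Suc l))" "t \<notin> loc ` {..<Suc l}" for t
  proof -
    have "t \<noteq> loc l" "t < Suc (loc l)" using that length_prefix_Suc[OF l] by auto
    then have "t < loc l" by simp
    then show ?thesis using that(2) old[of t] blank[of t] IH
      by (cases "t < length (prefix l)") (auto simp: lessThan_Suc)
  qed
  ultimately show ?case using run by blast
qed

definition scanned :: store where
  "scanned = exec L (Scan scan_step scan_start) (input_store inp)"

lemma scanned: "3 \<le> x \<Longrightarrow> scanned x = input_store inp x \<union> {loc l | l. l < m \<and> x \<in> marks_at l}"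
proof -
  assume x: "3 \<le> x"
  have "p < L \<and> x \<in> outs scan_start inp ! p \<longleftrightarrow> (\<exists>l<m. p = loc l \<and> x \<in> marks_at l)" for p
  proof
    assume p: "p < L \<and> x \<in> outs scan_start inp ! p"
    then have "p \<in> loc ` {..<m}" using run_prefix[of m] unfolding prefix_m by auto
    then show "\<exists>l<m. p = loc l \<and> x \<in> marks_at l" using p run_prefix[of m] unfolding prefix_m by auto
  next
    assume "\<exists>l<m. p = loc l \<and> x \<in> marks_at l"
    then show "p < L \<and> x \<in> outs scan_start inp ! p"
      using run_prefix[of m] loc_less unfolding prefix_m by auto
  qed
  then show ?thesis unfolding scanned_def exec_scan[OF inp_symbols x] by blast
qed

definition step_x :: "nat \<Rightarrow> int" where "step_x l = fst (ps ! l) - fst (ps ! (l - 1))"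

definition step_y :: "nat \<Rightarrow> int" where "step_y l = snd (ps ! l) - snd (ps ! (l - 1))"

definition steps :: "int \<Rightarrow> int \<Rightarrow> nat set" where
  "steps a b = {loc l | l. 0 < l \<and> l < m \<and> step_x l = a \<and> step_y l = b}"

lemma scanned_simps:
  "scanned 3 = {0}" "scanned 10 = loc ` {..<m}" "scanned 11 = {loc og}"
  "scanned 6 = steps 1 0" "scanned 7 = steps 0 1" "scanned 8 = steps (-1) 0" "scanned 9 = steps 0 (-1)"
proof -
  have dist: "distinct ps" using chordless_ps chordless_distinct by blast
  have "ps ! l = (0, 0) \<longleftrightarrow> l = og" if "l < m" for l
    using dist that og by (metis nth_eq_iff_index_eq)
  moreover have "{3, 10, 11} \<inter> dir_tracks a b = {}" for a b by (auto simp: dir_tracks_def)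
  ultimately have "3 \<notin> marks_at l" "10 \<in> marks_at l" "l < m \<Longrightarrow> 11 \<in> marks_at l \<longleftrightarrow> l = og" for l
    unfolding marks_at_def marks_def by (auto split: option.splits if_splits)
  then show "scanned 3 = {0}" "scanned 10 = loc ` {..<m}" "scanned 11 = {loc og}"
    using og by (auto simp: scanned input_store_def)
  have d: "marks_at l \<inter> {6, 7, 8, 9} = (if l = 0 then {} else
      if step_x l = 1 \<and> step_y l = 0 then {6}
      else if step_x l = 0 \<and> step_y l = 1 then {7}
      else if step_x l = -1 \<and> step_y l = 0 then {8} else {9})"
    if "l < m" for l
  proof (cases l)
    case 0
    then show ?thesis by (simp add: marks_at_def marks_def prev_def)
  next
    case (Suc k)
    define a b where "a = fst (ps ! l) - fst (ps ! k)" and "b = snd (ps ! l) - snd (ps ! k)"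
    have "marks_at l = {10} \<union> (if ps ! l \<noteq> (0, 0) then {} else {11}) \<union> dir_tracks (of_int a) (of_int b)"
      by (simp add: marks_at_def marks_def prev_def Suc a_def b_def)
    moreover have "dir_tracks (of_int a) (of_int b) \<subseteq> {6, 7, 8, 9}" by (simp add: dir_tracks_def)
    ultimately have "marks_at l \<inter> {6, 7, 8, 9} = dir_tracks (of_int a) (of_int b)"
      by (cases "ps ! l \<noteq> (0, 0)") (simp_all only: if_True if_False if_not_P, auto)
    moreover have "adj (ps ! k) (ps ! l)"
      using chordless_ps that Suc unfolding chordless_iff_nth[symmetric] by blast
    then have "\<bar>a\<bar> + \<bar>b\<bar> = 1" by (simp add: adj_def a_def b_def)
    then consider "a = 1" "b = 0" | "a = 0" "b = 1" | "a = -1" "b = 0" | "a = 0" "b = -1"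
      unfolding abs_sum_eq_1 by blast
    then have "dir_tracks (of_int a) (of_int b) = (if a = 1 \<and> b = 0 then {6} else if a = 0 \<and> b = 1 then {7}
      else if a = -1 \<and> b = 0 then {8} else {9})"
      by cases (simp_all add: dir_tracks_def)
    ultimately show ?thesis using Suc by (simp add: a_def b_def step_x_def step_y_def)
  qed
  have s: "scanned x = {loc l | l. l < m \<and> x \<in> marks_at l \<inter> {6, 7, 8, 9}}" if "x \<in> {6, 7, 8, 9}" for x
    using that by (auto simp: scanned input_store_def)
  have adj: "\<bar>step_x l\<bar> + \<bar>step_y l\<bar> = 1" if "0 < l" "l < m" for l
  proof -
    have "Suc (l - 1) < m \<longrightarrow> adj (ps ! (l - 1)) (ps ! Suc (l - 1))"
      using chordless_ps unfolding chordless_iff_nth[symmetric] by blast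
    then show ?thesis using that by (simp add: adj_def step_x_def step_y_def)
  qed
  have 6: "l < m \<Longrightarrow> 6 \<in> marks_at l \<inter> {6, 7, 8, 9} \<longleftrightarrow> 0 < l \<and> step_x l = 1 \<and> step_y l = 0"
    and 7: "l < m \<Longrightarrow> 7 \<in> marks_at l \<inter> {6, 7, 8, 9} \<longleftrightarrow> 0 < l \<and> step_x l = 0 \<and> step_y l = 1"
    and 8: "l < m \<Longrightarrow> 8 \<in> marks_at l \<inter> {6, 7, 8, 9} \<longleftrightarrow> 0 < l \<and> step_x l = -1 \<and> step_y l = 0" for l
    by (simp_all only: d) auto
  \<comment> \<open>Direction 9 is the remaining case of \<open>d\<close>, so the unit length of the
    step enters here.\<close>
  have 9: "l < m \<Longrightarrow> 9 \<in> marks_at l \<inter> {6, 7, 8, 9} \<longleftrightarrow> 0 < l \<and> step_x l = 0 \<and> step_y l = -1" for l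
    using adj[of l] unfolding abs_sum_eq_1 by (simp only: d) auto
  show "scanned 6 = steps 1 0" "scanned 7 = steps 0 1" "scanned 8 = steps (-1) 0" "scanned 9 = steps 0 (-1)"
    unfolding steps_def using 6 7 8 9 by (subst s, simp, blast)+
qed

end

subsection \<open>The decision procedure\<close>

text \<open>The points before the segment lie below some point of it and outside it; the predecessor
  is the one among them that lies below no other.\<close>

definition pre_com :: "'a com" where
  "pre_com = (below_com 20 16 ;; Asn 17 (Diff (And (V 10) (V 20)) (V 16)) ;;
     below_com 20 17 ;; Asn 17 (Diff (V 17) (V 20)))"

definition post_com :: "'a com" where
  "post_com = (above_com 20 16 ;; Asn 18 (Diff (And (V 10) (V 20)) (V 16)) ;;
     above_com 20 18 ;; Asn 18 (Diff (V 18) (V 20)))"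

text \<open>Floods from the points in \<open>i\<close>, keeping away from the segment in 24 and from
  the prescribed point \<open>k\<close> on the other side.\<close>

definition reach_com :: "nat \<Rightarrow> nat \<Rightarrow> nat \<Rightarrow> 'a com" where
  "reach_com i k r = (Asn 20 (Or (V 24) (V k)) ;; nbh_com 21 20 ;; Asn 27 (Diff (V 12) (V 21)) ;;
     Asn 35 (V i) ;; flood_com ;; Asn r (V 35))"

definition ext_com :: "'a com" where
  "ext_com = (pre_com ;; post_com ;; draw_com ;; reach_com 25 26 28 ;; reach_com 26 25 29)"

text \<open>Variable 30 holds the contacts of the two floods. If the segment is the origin alone, it
  holds instead the other points of the path, since noninterference then fails iff there are any.
  Variable 31 is nonempty iff neither flood contains cell 0.\<close>

definition test_com :: "'a com" where
  "test_com = (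
     nbh_com 20 28 ;; Asn 30 (And (V 20) (V 29)) ;;
     Asn 20 (Diff (V 32) (V 11)) ;; If 20 nop (Asn 30 (Diff (V 10) (V 11))) ;;
     Asn 31 (Diff (V 3) (Or (V 28) (V 29))) ;; Asn 33 (V 17) ;; Asn 34 (V 18))"

definition bounded_com :: "'a com" where
  "bounded_com = Asn 31 (Or (V 31) (Diff (V 3) (Or (V 28) (V 29))))"

text \<open>The segment is treated as it is, enlarged by its predecessor and enlarged by its
  successor. At an end of the path the enlargement is the segment itself, which leaves variable 31
  as it was.\<close>

definition segment_com :: "'a com" where
  "segment_com = (
     Asn 32 (V 16) ;; ext_com ;; test_com ;;
     Asn 16 (Or (V 32) (V 33)) ;; ext_com ;; bounded_com ;;
     Asn 16 (Or (V 32) (V 34)) ;; ext_com ;; bounded_com ;;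
     If 30 (Asn 5 (Diff (V 5) (V 31))) nop)"

text \<open>Two tape positions describe the segment of points after the first position and up to the
  second; it is examined only if it contains the origin.\<close>

definition pair_com :: "'a com" where
  "pair_com = (above_com 20 14 ;; above_com 21 15 ;; Asn 16 (Diff (And (V 10) (V 20)) (V 21)) ;;
     Asn 20 (And (V 16) (V 11)) ;; If 20 segment_com nop)"

definition program :: "scan com" where
  "program = (Scan scan_step scan_start ;; box_com ;; start_com ;; Asn 5 (V 3) ;; Asn 14 (V 3) ;;
     Rep (Asn 15 (V 3) ;; Rep (pair_com ;; Up 15) ;; Up 14))"

lemma wf_program: "wf_com 36 program"
proof -
  have "snd (scan_step q g) \<subseteq> {5..<36}" for q g
    using scan_step_marks(1)[of q g] by fastforce
  then show ?thesis
    by (simp add: program_def pair_com_def segment_com_def bounded_com_def test_com_def ext_com_def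
        reach_com_def post_com_def pre_com_def draw_com_def record_com_def move_com_def above_com_def
        below_com_def start_com_def box_com_def flood_com_def nbh_com_def up3_def dn3_def nop_def
        scan_step_marks)
qed

lemma writes_ext_com [simp]:
  "writes pre_com = {17, 19, 20}" "writes post_com = {18, 19, 20}"
  "writes (reach_com i k r) = {19, 20, 21, 27, 35, r}"
  "writes ext_com = {17, 18, 19, 20, 21, 22, 23, 24, 25, 26, 27, 28, 29, 35}"
  "writes test_com = {19, 20, 30, 31, 33, 34}" "writes bounded_com = {31}"
  "writes segment_com = {5, 16, 17, 18, 19, 20, 21, 22, 23, 24, 25, 26, 27, 28, 29, 30, 31, 32, 33, 34, 35}"
  "writes pair_com = {5, 16, 17, 18, 19, 20, 21, 22, 23, 24, 25, 26, 27, 28, 29, 30, 31, 32, 33, 34, 35}"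
  by (auto simp: pre_com_def post_com_def reach_com_def ext_com_def test_com_def bounded_com_def segment_com_def pair_com_def)

section \<open>The path in the grid and the correctness of the procedure\<close>

context config begin

sublocale grid "length (enc_config ps og)" "ps ! 0"
  by unfold_locales (rule L_ge)

lemma path_adj: "Suc l < m \<Longrightarrow> adj (ps ! l) (ps ! Suc l)"
  using chordless_ps unfolding chordless_iff_nth[symmetric] by blast

lemma path_dist: "l < m \<Longrightarrow> \<bar>dx (ps ! l)\<bar> \<le> int l \<and> \<bar>dy (ps ! l)\<bar> \<le> int l"
proof (induction l)
  case 0
  then show ?case by (simp add: dx_def dy_def)
next
  case (Suc l)
  have "adj (ps ! l) (ps ! Suc l)" using Suc.prems by (rule path_adj)
  then have "\<bar>dx (ps ! Suc l) - dx (ps ! l)\<bar> + \<bar>dy (ps ! Suc l) - dy (ps ! l)\<bar> = 1" by (simp add: adj_iff)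
  then show ?case using Suc by auto
qed

lemma path_core: "l < m \<Longrightarrow> ps ! l \<in> core"
  using path_dist[of l] m_less_L by (auto simp: core_def)

text \<open>The point with list index \<open>l\<close> is within \<open>l\<close> of the base in
  each coordinate, and \<open>l + 1 < L\<close>, so everything touching the path is still in the
  core.\<close>

lemma far_separate: "B \<subseteq> set ps \<Longrightarrow> p \<notin> core \<Longrightarrow> separate {p} B"
proof -
  assume B: "B \<subseteq> set ps" and p: "p \<notin> core"
  have "\<not> touch p b" if "b \<in> B" for b
  proof
    assume t: "touch p b"
    have "b \<in> set ps" using that B by blast
    then obtain l where l: "l < m" "b = ps ! l" unfolding in_set_conv_nth by blast
    have "\<bar>dx b - dx p\<bar> + \<bar>dy b - dy p\<bar> \<le> 1" using t by (simp add: touch_iff)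
    then have "\<bar>dx p\<bar> \<le> int l + 1" "\<bar>dy p\<bar> \<le> int l + 1" using path_dist[OF l(1)] l(2) by auto
    then have "p \<in> core" unfolding core_def using l(1) m_less_L by simp
    then show False using p by contradiction
  qed
  then show ?thesis by (simp add: separate_def)
qed

lemma index_step:
  assumes "0 < l" "l < m"
  shows "int (index (ps ! l)) - int (index (ps ! (l - 1)))
    = step_x l + 3 * int L * step_y l"
proof -
  have "ps ! l \<in> window" "ps ! (l - 1) \<in> window" using path_core core_window assms by auto
  then show ?thesis by (simp add: index_int dx_def dy_def step_x_def step_y_def algebra_simps)
qed

text \<open>What is computed before the main loops; the fragments inside them write none of these
  variables.\<close>

definition ready :: "store \<Rightarrow> bool" where
  "ready s \<longleftrightarrow> s 3 = {0} \<and> s 6 = steps 1 0 \<and> s 7 = steps 0 1 \<and> s 8 = steps (-1) 0 \<and> s 9 = steps 0 (-1) \<and>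
     s 10 = loc ` {..<m} \<and> s 11 = {loc og} \<and> s 12 = {..L ^ 4} \<and> s 13 = {index (ps ! 0)}"

lemma ready_exec: "writes c \<inter> {3, 6, 7, 8, 9, 10, 11, 12, 13} = {} \<Longrightarrow> ready (exec n c s) \<longleftrightarrow> ready s"
  unfolding ready_def by (simp add: exec_frame)

lemma loc_steps: "l < m \<Longrightarrow> loc l \<in> steps a b \<longleftrightarrow>
   0 < l \<and> step_x l = a \<and> step_y l = b"
  unfolding steps_def using loc_inj by blast

lemma move_set_step:
  assumes "ready s" "0 < l" "l < m"
  shows "move_set L s (loc l) {index (ps ! (l - 1))} = {index (ps ! l)}"
proof -
  define a b where "a = step_x l" and "b = step_y l"
  have "adj (ps ! (l - 1)) (ps ! Suc (l - 1))" using assms(2,3) by (intro path_adj) simp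
  then have "\<bar>a\<bar> + \<bar>b\<bar> = 1" using assms(2) by (simp add: adj_def a_def b_def step_x_def step_y_def)
  then consider "a = 1" "b = 0" | "a = 0" "b = 1" | "a = -1" "b = 0" | "a = 0" "b = -1"
    unfolding abs_sum_eq_1 by blast
  moreover have st: "loc l \<in> s 6 \<longleftrightarrow> a = 1 \<and> b = 0" "loc l \<in> s 7 \<longleftrightarrow> a = 0 \<and> b = 1"
    "loc l \<in> s 8 \<longleftrightarrow> a = -1 \<and> b = 0" "loc l \<in> s 9 \<longleftrightarrow> a = 0 \<and> b = -1"
    using assms loc_steps[OF assms(3)] by (auto simp: ready_def a_def b_def)
  moreover have i: "int (index (ps ! l)) - int (index (ps ! (l - 1))) = a + 3 * int L * b"
    unfolding a_def b_def by (rule index_step[OF assms(2,3)])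
  ultimately show ?thesis
  proof cases
    case 1
    then have "index (ps ! l) = Suc (index (ps ! (l - 1)))" using i by simp
    then show ?thesis using 1 st by (simp add: move_set_def)
  next
    case 2
    then have "index (ps ! l) = index (ps ! (l - 1)) + 3 * L" using i by simp
    then show ?thesis using 2 st by (simp add: move_set_def)
  next
    case 3
    then have "index (ps ! (l - 1)) = Suc (index (ps ! l))" using i by simp
    then show ?thesis using 3 st by (simp add: move_set_def)
  next
    case 4
    then have "index (ps ! (l - 1)) = index (ps ! l) + 3 * L" using i by simp
    then show ?thesis using 4 st by (simp add: move_set_def)
  qed
qed

lemma move_set_stay: "ready s \<Longrightarrow> t \<notin> loc ` {1..<m} \<Longrightarrow> move_set L s t X = X"
proof -
  assume s: "ready s" and t: "t \<notin> loc ` {1..<m}"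
  have "t \<notin> steps a b" for a b using t unfolding steps_def by force
  then show ?thesis using s by (simp add: ready_def move_set_def)
qed

text \<open>The current point changes only at marked positions: it is the first point from the
  beginning, and later the point whose encoding ended last. Stating this for all positions makes it
  inductive.\<close>

lemma walker_between:
  assumes "ready s"
  shows "(t < loc 0 \<longrightarrow> walker L s t = {index (ps ! 0)}) \<and>
    (\<forall>l<m. loc l \<le> t \<and> (Suc l < m \<longrightarrow> t < loc (Suc l)) \<longrightarrow> walker L s t = {index (ps ! l)})"
proof (induction t)
  case 0
  have pos: "0 < loc l" if "l < m" for l using loc_ge[OF that] by simp
  then have "0 \<notin> loc ` {1..<m}" by force
  then have "walker L s 0 = {index (ps ! 0)}"
    using assms move_set_stay[OF assms, of 0] by (simp add: ready_def)
  then show ?case using pos by (metis leD)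
next
  case (Suc t)
  have m: "0 < m" using og by auto
  show ?case
  proof (intro conjI allI impI)
    assume t: "Suc t < loc 0"
    have "loc 0 < loc j" if "j \<in> {1..<m}" for j using loc_mono[of 0 j] that by simp
    then have "Suc t \<notin> loc ` {1..<m}" using t by force
    then show "walker L s (Suc t) = {index (ps ! 0)}" using move_set_stay[OF assms] Suc t by simp
  next
    fix l assume l: "l < m" and t: "loc l \<le> Suc t \<and> (Suc l < m \<longrightarrow> Suc t < loc (Suc l))"
    show "walker L s (Suc t) = {index (ps ! l)}"
    proof (cases "loc l = Suc t")
      case False
      have "Suc t \<noteq> loc j" if "j < m" for j
      proof (cases "j \<le> l")
        case True
        then show ?thesis using loc_mono[of j l] l False t by (cases "j = l") auto
      next
        case False
        then show ?thesis using loc_mono[of "Suc l" j] that t by (cases "j = Suc l") auto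
      qed
      then have "Suc t \<notin> loc ` {1..<m}" by (metis atLeastLessThan_iff imageE)
      moreover have "loc l \<le> t \<and> (Suc l < m \<longrightarrow> t < loc (Suc l))" using t False by auto
      then have "walker L s t = {index (ps ! l)}" using Suc l by blast
      ultimately show ?thesis using move_set_stay[OF assms] by simp
    next
      case True
      show ?thesis
      proof (cases "l = 0")
        case True0: True
        have "loc 0 \<noteq> loc j" if "1 \<le> j" "j < m" for j using loc_mono[of 0 j] that by simp
        then have "Suc t \<notin> loc ` {1..<m}" using True True0 by (metis atLeastLessThan_iff imageE)
        moreover have "t < loc 0" using True True0 by simp
        then have "walker L s t = {index (ps ! 0)}" using Suc by blast
        ultimately show ?thesis using move_set_stay[OF assms] True0 by simp
      next
        case False
        then have "loc (l - 1) \<le> t" "t < loc (Suc (l - 1))" using loc_mono[of "l - 1" l] l True by auto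
        moreover have "l - 1 < m" using l by simp
        ultimately have "walker L s t = {index (ps ! (l - 1))}" using Suc by blast
        then show ?thesis using move_set_step[OF assms, of l] False l True by simp
      qed
    qed
  qed
qed

lemma walker_loc: "ready s \<Longrightarrow> l < m \<Longrightarrow> walker L s (loc l) = {index (ps ! l)}"
  using walker_between[of s "loc l"] loc_mono[of l "Suc l"] by auto

lemma Union_walker:
  assumes "ready s" "A \<subseteq> {..<m}"
  shows "\<Union> (walker L s ` (loc ` A \<inter> {..<L})) = index ` ((!) ps ` A)"
proof -
  have "loc ` A \<inter> {..<L} = loc ` A" using assms(2) loc_less by auto
  moreover have "walker L s (loc l) = {index (ps ! l)}" if "l \<in> A" for l
    using walker_loc assms that by auto
  ultimately show ?thesis by (auto simp: image_image)
qed

definition pre_idx :: "nat \<Rightarrow> nat set" where "pre_idx a = (if a = 0 then {} else {a - 1})"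

definition post_idx :: "nat \<Rightarrow> nat set" where "post_idx b = (if Suc b < m then {Suc b} else {})"

lemma set_pre: "set (pre a) = (!) ps ` pre_idx a" and set_post: "set (post b) = (!) ps ` post_idx b"
  by (auto simp: pre_def post_def pre_idx_def post_idx_def)

lemma loc_less_iff: "i < m \<Longrightarrow> j < m \<Longrightarrow> loc i < loc j \<longleftrightarrow> i < j"
  using loc_mono[of i j] loc_mono[of j i] by (cases i j rule: linorder_cases) auto

lemma above_loc: "A \<subseteq> {..<m} \<Longrightarrow> loc ` {..<m} \<inter> above L (loc ` A) = loc ` {l. l < m \<and> (\<exists>k\<in>A. k < l)}"
proof -
  assume A: "A \<subseteq> {..<m}"
  have "loc l \<in> above L (loc ` A) \<longleftrightarrow> (\<exists>k\<in>A. k < l)" if "l < m" for l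
  proof -
    have "loc k < loc l \<and> loc l \<le> loc k + L \<longleftrightarrow> k < l" if "k \<in> A" for k
      using that A \<open>l < m\<close> loc_less[of l] loc_less_iff[of k l] by auto
    then show ?thesis by (simp add: above_def)
  qed
  then show ?thesis by auto
qed

lemma below_loc: "A \<subseteq> {..<m} \<Longrightarrow> loc ` {..<m} \<inter> below L (loc ` A) = loc ` {l. l < m \<and> (\<exists>k\<in>A. l < k)}"
proof -
  assume A: "A \<subseteq> {..<m}"
  have "loc l \<in> below L (loc ` A) \<longleftrightarrow> (\<exists>k\<in>A. l < k)" if "l < m" for l
  proof -
    have "loc l < loc k \<and> loc k \<le> loc l + L \<longleftrightarrow> l < k" if "k \<in> A" for k
      using that A \<open>l < m\<close> loc_less[of k] loc_less_iff[of l k] by auto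
    then show ?thesis by (simp add: below_def)
  qed
  then show ?thesis by auto
qed

lemma loc_image_diff: "A \<subseteq> {..<m} \<Longrightarrow> B \<subseteq> {..<m} \<Longrightarrow> loc ` A - loc ` B = loc ` (A - B)"
  using loc_inj by (auto simp: subset_iff)

lemma exec_pre_com:
  assumes "ready s" "s 16 = loc ` {a..b}" "a \<le> b" "b < m"
  shows "exec L pre_com s 17 = loc ` pre_idx a"
proof -
  have "loc ` {..<m} \<inter> below L (loc ` {a..b}) - loc ` {a..b} = loc ` ({l. l < m \<and> (\<exists>k\<in>{a..b}. l < k)} - {a..b})"
    using assms by (subst below_loc, force, intro loc_image_diff) auto
  also have "{l. l < m \<and> (\<exists>k\<in>{a..b}. l < k)} - {a..b} = {..<a}" using assms by auto
  finally have 1: "loc ` {..<m} \<inter> below L (loc ` {a..b}) - loc ` {a..b} = loc ` {..<a}" .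
  have "loc ` {..<a} - below L (loc ` {..<a}) = loc ` {..<a} - loc ` {..<m} \<inter> below L (loc ` {..<a})"
    using assms by auto
  also have "\<dots> = loc ` ({..<a} - {l. l < m \<and> (\<exists>k\<in>{..<a}. l < k)})"
    using assms by (subst below_loc, force, intro loc_image_diff) auto
  also have "{..<a} - {l. l < m \<and> (\<exists>k\<in>{..<a}. l < k)} = pre_idx a"
    using assms by (auto simp: pre_idx_def)
  finally show ?thesis using assms(1,2) 1 by (simp add: pre_com_def ready_def)
qed

lemma exec_post_com:
  assumes "ready s" "s 16 = loc ` {a..b}" "a \<le> b" "b < m"
  shows "exec L post_com s 18 = loc ` post_idx b"
proof -
  have "loc ` {..<m} \<inter> above L (loc ` {a..b}) - loc ` {a..b} = loc ` ({l. l < m \<and> (\<exists>k\<in>{a..b}. k < l)} - {a..b})"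
    using assms by (subst above_loc, force, intro loc_image_diff) auto
  also have "{l. l < m \<and> (\<exists>k\<in>{a..b}. k < l)} - {a..b} = {b<..<m}" using assms by auto
  finally have 1: "loc ` {..<m} \<inter> above L (loc ` {a..b}) - loc ` {a..b} = loc ` {b<..<m}" .
  have "loc ` {b<..<m} - above L (loc ` {b<..<m}) = loc ` {b<..<m} - loc ` {..<m} \<inter> above L (loc ` {b<..<m})"
    using assms by auto
  also have "\<dots> = loc ` ({b<..<m} - {l. l < m \<and> (\<exists>k\<in>{b<..<m}. k < l)})"
    by (subst above_loc, force, intro loc_image_diff) auto
  also have "{b<..<m} - {l. l < m \<and> (\<exists>k\<in>{b<..<m}. k < l)} = post_idx b"
  proof (intro set_eqI iffI)
    fix x assume x: "x \<in> {b<..<m} - {l. l < m \<and> (\<exists>k\<in>{b<..<m}. k < l)}"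
    then have "b < x" "x < m" by simp_all
    moreover have "\<not> Suc b < x"
    proof
      assume "Suc b < x"
      then have "Suc b \<in> {b<..<m}" using \<open>x < m\<close> by simp
      then show False using x \<open>Suc b < x\<close> \<open>x < m\<close> by auto
    qed
    ultimately have "x = Suc b" by simp
    then show "x \<in> post_idx b" using \<open>x < m\<close> by (simp add: post_idx_def)
  next
    fix x assume "x \<in> post_idx b"
    then show "x \<in> {b<..<m} - {l. l < m \<and> (\<exists>k\<in>{b<..<m}. k < l)}"
      by (auto simp: post_idx_def split: if_splits)
  qed
  finally show ?thesis using assms(1,2) 1 by (simp add: post_com_def ready_def)
qed

end

context config begin

lemma exec_reach_com:
  assumes "ready s" "s i = index ` S" "s k = index ` B'" "s 24 = index ` B" "S \<subseteq> core"
    "i \<in> {25, 26}" "k \<in> {25, 26}"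
  shows "exec L (reach_com i k r) s r = flood (3 * L) (index ` S) (free (B \<union> B'))"
proof -
  have "exec L (reach_com i k r) s r =
    ((\<lambda>M. M \<union> (nb M \<inter> ({..L ^ 4} - nb (index ` B \<union> index ` B')))) ^^ (L ^ 5)) (index ` S)"
    using assms by (auto simp: reach_com_def ready_def)
  also have "index ` B \<union> index ` B' = index ` (B \<union> B')" by auto
  also have "{..L ^ 4} - nb \<dots> = free (B \<union> B')" by (simp add: free_def)
  also have "((\<lambda>M. M \<union> (nb M \<inter> free (B \<union> B'))) ^^ (L ^ 5)) (index ` S) = flood (3 * L) (index ` S) (free (B \<union> B'))"
  proof (rule flood_iterate)
    show "index ` S \<subseteq> {..L ^ 4}" using assms(5) core_window index_le by blast
    show "free (B \<union> B') \<subseteq> {..L ^ 4}" by (simp add: free_def)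
    have "1 \<le> L ^ 4" using L_ge by simp
    then have "Suc (L ^ 4) \<le> 2 * L ^ 4" by simp
    also have "\<dots> \<le> L * L ^ 4" using L_ge by (intro mult_le_mono1) simp
    also have "\<dots> = L ^ 5" by (simp add: eval_nat_numeral)
    finally show "card {..L ^ 4} \<le> L ^ 5" by simp
  qed simp
  finally show ?thesis .
qed

definition flood_pre :: "nat \<Rightarrow> nat \<Rightarrow> nat set" where
  "flood_pre a b = flood (3 * L) (index ` set (pre a)) (free (set (seg a b) \<union> set (post b)))"

definition flood_post :: "nat \<Rightarrow> nat \<Rightarrow> nat set" where
  "flood_post a b = flood (3 * L) (index ` set (post b)) (free (set (seg a b) \<union> set (pre a)))"

lemma subset_ps:
  assumes "a \<le> b" "b < m"
  shows "set (pre a) \<subseteq> set ps" "set (post b) \<subseteq> set ps" "set (seg a b) \<subseteq> set ps" "set ps \<subseteq> core"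
proof -
  show "set (pre a) \<subseteq> set ps" "set (post b) \<subseteq> set ps" using assms by (auto simp: pre_def post_def)
  show "set (seg a b) \<subseteq> set ps" using set_seg[OF assms] assms by auto
  show "set ps \<subseteq> core" using path_core by (metis in_set_conv_nth subsetI)
qed

lemma bounded_ext_iff:
  assumes "a \<le> b" "b < m"
  shows "bounded_ext a b \<longleftrightarrow> 0 \<notin> flood_pre a b \<and> 0 \<notin> flood_post a b"
proof -
  note sub = subset_ps[OF assms]
  have "finite (ext_pre a b) \<longleftrightarrow> 0 \<notin> flood_pre a b" unfolding ext_pre_def flood_pre_def
    using sub by (intro finite_reach_iff far_separate) blast+
  moreover have "finite (ext_post a b) \<longleftrightarrow> 0 \<notin> flood_post a b" unfolding ext_post_def flood_post_def
    using sub by (intro finite_reach_iff far_separate) blast+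
  ultimately show ?thesis by (simp add: bounded_ext_def)
qed

lemma separate_ext_iff:
  assumes "a \<le> b" "b < m"
  shows "separate (ext_pre a b) (ext_post a b) \<longleftrightarrow> nb (flood_pre a b) \<inter> flood_post a b = {}"
proof -
  note sub = subset_ps[OF assms]
  have core: "set (pre a) \<subseteq> core" "set (post b) \<subseteq> core"
    "set (seg a b) \<union> set (post b) \<subseteq> core" "set (seg a b) \<union> set (pre a) \<subseteq> core"
    using sub by blast+
  have far: "p \<notin> core \<Longrightarrow> separate {p} (set (seg a b) \<union> set (post b))"
    "p \<notin> core \<Longrightarrow> separate {p} (set (seg a b) \<union> set (pre a))" for p
    by (rule far_separate, use sub in blast, assumption)+
  show ?thesis unfolding ext_pre_def ext_post_def flood_pre_def flood_post_def
    by (rule separate_reach_iff[OF core(1,3) far(1) core(2,4) far(2)])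
qed

lemma exec_ext_com:
  assumes "ready s" "s 16 = loc ` {a..b}" "a \<le> b" "b < m"
  shows "exec L (ext_com :: 'a com) s 17 = loc ` pre_idx a" "exec L (ext_com :: 'a com) s 18 = loc ` post_idx b"
    "exec L (ext_com :: 'a com) s 28 = flood_pre a b" "exec L (ext_com :: 'a com) s 29 = flood_post a b"
proof -
  define s1 where "s1 = exec L (pre_com :: 'a com) s"
  define s2 where "s2 = exec L (post_com :: 'a com) s1"
  define s3 where "s3 = exec L (draw_com :: 'a com) s2"
  define s4 where "s4 = exec L (reach_com 25 26 28 :: 'a com) s3"
  have r1: "ready s1" unfolding s1_def using assms(1) by (subst ready_exec) auto
  have r2: "ready s2" unfolding s2_def using r1 by (subst ready_exec) auto
  have r3: "ready s3" unfolding s3_def using r2 by (subst ready_exec) auto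
  have r4: "ready s4" unfolding s4_def using r3 by (subst ready_exec) auto
  have 16: "s1 16 = loc ` {a..b}" "s2 16 = loc ` {a..b}"
    using assms(2) by (simp_all add: s1_def s2_def exec_frame)
  have 17: "s2 17 = loc ` pre_idx a"
    unfolding s2_def using exec_pre_com[OF assms] by (simp add: exec_frame s1_def)
  have 18: "s2 18 = loc ` post_idx b"
    unfolding s2_def by (rule exec_post_com[OF r1 16(1) assms(3,4)])
  have pi: "pre_idx a \<subseteq> {..<m}" "post_idx b \<subseteq> {..<m}" "{a..b} \<subseteq> {..<m}"
    using assms(3,4) by (auto simp: pre_idx_def post_idx_def)
  have "s2 3 = {0}" using r2 by (simp add: ready_def)
  note draw = exec_draw_com[where s = s2 and L = L, OF this]
  have 24: "s3 24 = index ` set (seg a b)" and 25: "s3 25 = index ` set (pre a)" and 26: "s3 26 = index ` set (post b)"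
    unfolding s3_def draw 16 17 18 Union_walker[OF r2 pi(1)] Union_walker[OF r2 pi(2)] Union_walker[OF r2 pi(3)]
    using set_seg[OF assms(3,4)] set_pre set_post by simp_all
  note sub = subset_ps[OF assms(3,4)]
  have 28: "s4 28 = flood_pre a b" unfolding s4_def flood_pre_def
    by (rule exec_reach_com[OF r3 25 26 24]) (use sub in auto)
  have eq: "s4 x = s3 x" if "x \<in> {24, 25, 26}" for x
    unfolding s4_def using that by (auto intro!: exec_frame)
  have 29: "exec L (reach_com 26 25 29 :: 'a com) s4 29 = flood_post a b" unfolding flood_post_def
    by (rule exec_reach_com[OF r4]) (use sub eq 24 25 26 in auto)
  have e: "exec L (ext_com :: 'a com) s = exec L (reach_com 26 25 29 :: 'a com) s4"
    by (simp add: ext_com_def s1_def s2_def s3_def s4_def)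
  show "exec L (ext_com :: 'a com) s 17 = loc ` pre_idx a" "exec L (ext_com :: 'a com) s 18 = loc ` post_idx b"
    using 17 18 unfolding e by (simp_all add: exec_frame s4_def s3_def)
  show "exec L (ext_com :: 'a com) s 28 = flood_pre a b" "exec L (ext_com :: 'a com) s 29 = flood_post a b"
    using 28 29 unfolding e by (simp_all add: exec_frame)
qed

text \<open>The negation of one instance of \<open>CNI_iff\<close>.\<close>

definition violation :: "nat \<Rightarrow> nat \<Rightarrow> bool" where
  "violation a b \<longleftrightarrow>
     (bounded_ext a b \<or> (1 \<le> a \<and> bounded_ext (a - 1) b) \<or> (Suc b < m \<and> bounded_ext a (Suc b))) \<and>
     \<not> (if a = b then m = 1 else separate (ext_pre a b) (ext_post a b))"

lemma exec_segment_com: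
  assumes "ready s" "s 16 = loc ` {a..b}" "a \<le> og" "og \<le> b" "b < m" "s 5 \<subseteq> {0}"
  shows "exec L (segment_com :: 'a com) s 5 = (if violation a b then {} else s 5)"
proof -
  have ab: "a \<le> b" using assms by simp
  define s1 where "s1 = exec L (ext_com :: 'a com) (s(32 := s 16))"
  define s2 where "s2 = exec L (test_com :: 'a com) s1"
  define s3 where "s3 = exec L (ext_com :: 'a com) (s2(16 := s2 32 \<union> s2 33))"
  define s4 where "s4 = exec L (bounded_com :: 'a com) s3"
  define s5 where "s5 = exec L (ext_com :: 'a com) (s4(16 := s4 32 \<union> s4 34))"
  define s6 where "s6 = exec L (bounded_com :: 'a com) s5"
  have r0: "ready (s(32 := s 16))" using assms(1) by (simp add: ready_def)
  have r1: "ready s1" unfolding s1_def using r0 by (subst ready_exec) auto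
  have r2: "ready s2" unfolding s2_def using r1 by (subst ready_exec) auto
  then have r2': "ready (s2(16 := X))" for X by (simp add: ready_def)
  have r3: "ready s3" unfolding s3_def using r2' by (subst ready_exec) auto
  have r4: "ready s4" unfolding s4_def using r3 by (subst ready_exec) auto
  then have r4': "ready (s4(16 := X))" for X by (simp add: ready_def)
  have r5: "ready s5" unfolding s5_def using r4' by (subst ready_exec) auto
  have ext1: "s1 17 = loc ` pre_idx a" "s1 18 = loc ` post_idx b" "s1 28 = flood_pre a b" "s1 29 = flood_post a b"
    unfolding s1_def by (rule exec_ext_com[OF r0 _ ab assms(5)]; use assms(2) in simp)+
  have s1: "s1 5 = s 5" "s1 32 = loc ` {a..b}"
    unfolding s1_def using assms(2) by (simp_all add: exec_frame)
  have s1r: "s1 3 = {0}" "s1 10 = loc ` {..<m}" "s1 11 = {loc og}" using r1 by (simp_all add: ready_def)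
  have diff: "loc ` {a..b} - {loc og} = {} \<longleftrightarrow> a = b"
  proof -
    have "loc ` {a..b} - {loc og} = loc ` ({a..b} - {og})"
    proof -
      have "{a..b} \<subseteq> {..<m}" "{og} \<subseteq> {..<m}" using assms by auto
      from loc_image_diff[OF this] show ?thesis by simp
    qed
    also have "\<dots> = {} \<longleftrightarrow> a = b"
    proof
      assume "loc ` ({a..b} - {og}) = {}"
      then have e: "{a..b} - {og} = {}" by (simp only: image_is_empty)
      have "a \<in> {a..b}" "b \<in> {a..b}" using ab by auto
      then have "a = og" "b = og" using e by blast+
      then show "a = b" by simp
    next
      assume "a = b"
      then show "loc ` ({a..b} - {og}) = {}" using assms(3,4) by auto
    qed
    finally show ?thesis .
  qed
  have diff_m: "loc ` {..<m} - {loc og} = {} \<longleftrightarrow> m = 1"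
  proof -
    have "loc ` {..<m} - {loc og} = loc ` ({..<m} - {og})"
    proof -
      have "{og} \<subseteq> {..<m}" using og by auto
      from loc_image_diff[OF subset_refl this] show ?thesis by simp
    qed
    also have "\<dots> = {} \<longleftrightarrow> {..<m} \<subseteq> {og}" by simp
    also have "\<dots> \<longleftrightarrow> m = 1"
    proof
      assume sub: "{..<m} \<subseteq> {og}"
      have "card {..<m} \<le> card {og}" using sub by (intro card_mono) auto
      then show "m = 1" using og by simp
    next
      assume "m = 1"
      then show "{..<m} \<subseteq> {og}" using og by auto
    qed
    finally show ?thesis .
  qed
  have s2: "s2 5 = s 5" "s2 32 = loc ` {a..b}" "s2 33 = loc ` pre_idx a" "s2 34 = loc ` post_idx b"
    "s2 31 = {0} - (flood_pre a b \<union> flood_post a b)"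
    "s2 30 = (if a = b then loc ` {..<m} - {loc og} else nb (flood_pre a b) \<inter> flood_post a b)"
    unfolding s2_def test_com_def using ext1 s1 s1r diff by simp_all
  have 30: "s2 30 \<noteq> {} \<longleftrightarrow> \<not> (if a = b then m = 1 else separate (ext_pre a b) (ext_post a b))"
    using s2(6) diff_m separate_ext_iff[OF ab assms(5)] by simp
  \<comment> \<open>\<open>b'\<close> and the truncated \<open>a - 1\<close> bound the enlargements
    as the program computes them; at the ends of the path they fall back to \<open>b\<close> and
    \<open>a\<close>.\<close>
  define b' where "b' = (if Suc b < m then Suc b else b)"
  have "{a..b} \<union> pre_idx a = {a - 1..b}" using ab by (auto simp: pre_idx_def)
  then have 16: "s2 32 \<union> s2 33 = loc ` {a - 1..b}" unfolding s2 image_Un[symmetric] by simp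
  have "{a..b} \<union> post_idx b = {a..b'}" using ab by (auto simp: post_idx_def b'_def)
  then have seg': "s2 32 \<union> s2 34 = loc ` {a..b'}" unfolding s2 image_Un[symmetric] by simp
  have ext3: "s3 28 = flood_pre (a - 1) b" "s3 29 = flood_post (a - 1) b"
    unfolding s3_def by (rule exec_ext_com[OF r2']; use 16 ab assms(5) in simp)+
  have s3: "s3 5 = s 5" "s3 30 = s2 30" "s3 31 = s2 31" "s3 32 = s2 32" "s3 34 = s2 34" "s3 3 = {0}"
    unfolding s3_def using s2 r2 by (simp_all add: exec_frame ready_def)
  have s4: "s4 5 = s 5" "s4 30 = s2 30" "s4 32 = s2 32" "s4 34 = s2 34" "s4 3 = {0}"
    "s4 31 = s2 31 \<union> ({0} - (flood_pre (a - 1) b \<union> flood_post (a - 1) b))"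
    unfolding s4_def bounded_com_def using s3 ext3 by simp_all
  have ext5: "s5 28 = flood_pre a b'" "s5 29 = flood_post a b'"
    unfolding s5_def by (rule exec_ext_com[OF r4']; use s4 seg' ab assms(5) in \<open>simp add: b'_def\<close>)+
  have s5: "s5 5 = s 5" "s5 30 = s2 30" "s5 31 = s4 31" "s5 3 = {0}"
    unfolding s5_def using s4 by (simp_all add: exec_frame)
  have s6: "s6 5 = s 5" "s6 30 = s2 30" "s6 31 = s4 31 \<union> ({0} - (flood_pre a b' \<union> flood_post a b'))"
    unfolding s6_def bounded_com_def using s5 ext5 by simp_all
  have b': "a \<le> b'" "b' < m" "a - 1 \<le> b" using ab assms(5) by (auto simp: b'_def)
  have "s6 31 = (if bounded_ext a b \<or> bounded_ext (a - 1) b \<or> bounded_ext a b' then {0} else {})"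
    unfolding s6 s4 s2 bounded_ext_iff[OF ab assms(5)] bounded_ext_iff[OF b'(3) assms(5)] bounded_ext_iff[OF b'(1,2)]
    by auto
  also have "bounded_ext a b \<or> bounded_ext (a - 1) b \<or> bounded_ext a b' \<longleftrightarrow>
    bounded_ext a b \<or> (1 \<le> a \<and> bounded_ext (a - 1) b) \<or> (Suc b < m \<and> bounded_ext a (Suc b))"
    by (cases a) (auto simp: b'_def)
  finally have 31: "s6 31 = (if bounded_ext a b \<or> (1 \<le> a \<and> bounded_ext (a - 1) b) \<or> (Suc b < m \<and> bounded_ext a (Suc b)) then {0} else {})" .
  have "exec L (segment_com :: 'a com) s = exec L (If 30 (Asn 5 (Diff (V 5) (V 31))) nop :: 'a com) s6"
    by (simp add: segment_com_def s1_def s2_def s3_def s4_def s5_def s6_def)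
  then show ?thesis using s6 30 31 assms(6) by (auto simp: violation_def)
qed

lemma exec_pair_com:
  assumes "ready s" "s 14 = {t}" "s 15 = {u}" "u < L" "s 5 \<subseteq> {0}"
  shows "exec L (pair_com :: 'a com) s 5 = (if \<exists>a b. a \<le> og \<and> og \<le> b \<and> b < m \<and>
     {l. l < m \<and> t < loc l \<and> loc l \<le> u} = {a..b} \<and> violation a b then {} else s 5)"
proof -
  let ?A = "{l. l < m \<and> t < loc l \<and> loc l \<le> u}"
  define s1 where "s1 = exec L (above_com 20 14 ;; above_com 21 15 ;; Asn 16 (Diff (And (V 10) (V 20)) (V 21)) ;;
     Asn 20 (And (V 16) (V 11)) :: 'a com) s"
  have r1: "ready s1" unfolding s1_def using assms(1) by (subst ready_exec) auto
  have "loc ` {..<m} \<inter> above L {t} - above L {u} = loc ` ?A"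
    using loc_less by (fastforce simp: above_def)
  then have s1: "s1 16 = loc ` ?A" "s1 5 = s 5" "s1 20 = loc ` ?A \<inter> {loc og}"
    unfolding s1_def using assms(1-3) by (simp_all add: ready_def)
  have og_mem: "s1 20 \<noteq> {} \<longleftrightarrow> og \<in> ?A" unfolding s1 using loc_inj og by auto
  have e: "exec L (pair_com :: 'a com) s = exec L (If 20 segment_com nop :: 'a com) s1"
    by (simp add: pair_com_def s1_def)
  show ?thesis
  proof (cases "og \<in> ?A")
    case False
    have "s1 20 = {}" using og_mem False by blast
    then have "exec L (If 20 segment_com nop :: 'a com) s1 5 = s 5" using s1(2) by simp
    moreover have "?A \<noteq> {a..b}" if "a \<le> og" "og \<le> b" for a b
    proof -
      have "og \<in> {a..b}" using that by simp
      then show ?thesis using False by blast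
    qed
    then have "\<not> (\<exists>a b. a \<le> og \<and> og \<le> b \<and> b < m \<and> ?A = {a..b} \<and> violation a b)" by blast
    ultimately show ?thesis unfolding e by (simp only: if_False)
  next
    case True
    have fin: "finite ?A" by simp
    \<comment> \<open>As \<open>loc\<close> is increasing, the selected points form an interval; it
      contains the origin, so it is nonempty and determines its bounds.\<close>
    let ?a = "Min ?A" and ?b = "Max ?A"
    have a: "?a \<in> ?A" "?a \<le> og" using Min_in[OF fin] Min_le[OF fin True] True by blast+
    have b: "?b \<in> ?A" "og \<le> ?b" using Max_in[OF fin] Max_ge[OF fin True] True by blast+
    have A: "?A = {?a..?b}"
    proof
      show "?A \<subseteq> {?a..?b}" using fin by auto
      show "{?a..?b} \<subseteq> ?A"
      proof
        fix l assume l: "l \<in> {?a..?b}"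
        then have lm: "l < m" using b(1) by auto
        moreover have "loc ?a \<le> loc l" using loc_mono[of ?a l] l lm by (cases "l = ?a") auto
        moreover have "loc l \<le> loc ?b" using loc_mono[of l ?b] l b(1) by (cases "l = ?b") auto
        ultimately show "l \<in> ?A" using a(1) b(1) by auto
      qed
    qed
    have bm: "?b < m" using b(1) by simp
    have uniq: "x = ?a \<and> y = ?b" if "?A = {x..y}" "x \<le> og" "og \<le> y" for x y
    proof -
      have "{x..y} = {?a..?b}" using that(1) A by simp
      moreover have "x \<le> y" using that(2,3) by simp
      ultimately show ?thesis by (simp only: Icc_eq_Icc) simp
    qed
    have "exec L (segment_com :: 'a com) s1 5 = (if violation ?a ?b then {} else s 5)"
    proof -
      have "s1 16 = loc ` {?a..?b}" unfolding A[symmetric] by (rule s1(1))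
      moreover have "s1 5 \<subseteq> {0}" using s1(2) assms(5) by simp
      ultimately show ?thesis
        using exec_segment_com[where 'a = 'a, OF r1 _ a(2) b(2) bm] s1(2) by simp
    qed
    moreover have "(\<exists>a b. a \<le> og \<and> og \<le> b \<and> b < m \<and> ?A = {a..b} \<and> violation a b) \<longleftrightarrow> violation ?a ?b"
    proof
      assume "\<exists>a b. a \<le> og \<and> og \<le> b \<and> b < m \<and> ?A = {a..b} \<and> violation a b"
      then obtain x y where xy: "x \<le> og" "og \<le> y" "?A = {x..y}" "violation x y" by blast
      have "x = ?a" "y = ?b"
        by (rule uniq[OF xy(3,1,2), THEN conjunct1], rule uniq[OF xy(3,1,2), THEN conjunct2])
      then show "violation ?a ?b" using xy(4) by (simp only:)
    next
      assume "violation ?a ?b"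
      then show "\<exists>a b. a \<le> og \<and> og \<le> b \<and> b < m \<and> ?A = {a..b} \<and> violation a b"
        by (intro exI conjI) (rule a(2), rule b(2), rule bm, rule A)
    qed
    moreover have "exec L (If 20 segment_com nop :: 'a com) s1 = exec L (segment_com :: 'a com) s1"
      using og_mem True by simp
    ultimately show ?thesis unfolding e by (simp only:)
  qed
qed

definition pair_violation :: "nat \<Rightarrow> nat \<Rightarrow> bool" where
  "pair_violation t u \<longleftrightarrow> (\<exists>a b. a \<le> og \<and> og \<le> b \<and> b < m \<and>
     {l. l < m \<and> t < loc l \<and> loc l \<le> u} = {a..b} \<and> violation a b)"

lemma exec_seq_rep: "exec L (c ;; Rep d ;; e) s = exec L e ((exec L d ^^ L) (exec L c s))"
  by (simp only: exec.simps)

lemma exec_inner_loop: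
  assumes "ready s" "s 14 = {t}" "s 15 = {0}" "s 5 \<subseteq> {0}" "j \<le> L"
  shows "let r = (exec L (pair_com ;; Up 15 :: 'a com) ^^ j) s in
    ready r \<and> r 14 = {t} \<and> r 15 = {j} \<and> r 5 = (if \<exists>u<j. pair_violation t u then {} else s 5)"
  using assms(5)
proof (induction j)
  case 0
  then show ?case using assms by simp
next
  case (Suc j)
  define r where "r = (exec L (pair_com ;; Up 15 :: 'a com) ^^ j) s"
  have r: "ready r" "r 14 = {t}" "r 15 = {j}" "r 5 = (if \<exists>u<j. pair_violation t u then {} else s 5)"
    using Suc.IH[OF Suc_leD[OF Suc.prems]] unfolding r_def Let_def by blast+
  define r' where "r' = exec L (pair_com :: 'a com) r"
  have r': "ready r'" unfolding r'_def using r(1) by (subst ready_exec) auto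
  have r'14: "r' 14 = {t}" "r' 15 = {j}" using r by (simp_all add: r'_def exec_frame)
  have r'5: "r' 5 = (if pair_violation t j then {} else r 5)"
    unfolding r'_def pair_violation_def using Suc.prems assms(4) r by (intro exec_pair_com) auto
  have e: "(exec L (pair_com ;; Up 15 :: 'a com) ^^ Suc j) s = r'(15 := Suc ` r' 15)"
    by (simp add: r_def r'_def)
  have "ready (r'(15 := Suc ` r' 15))" using r' by (simp add: ready_def)
  then show ?case unfolding e Let_def using r(4) r'14 r'5 by (simp add: less_Suc_eq) blast
qed

lemma exec_outer_loop:
  fixes row :: "'a com"
  assumes "ready s" "s 14 = {0}" "s 5 = {0}"
  defines "row \<equiv> Asn 15 (V 3) ;; Rep (pair_com ;; Up 15) ;; Up 14"
  shows "let r = (exec L row ^^ i) s in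
    ready r \<and> r 14 = {i} \<and> r 5 = (if \<exists>t<i. \<exists>u<L. pair_violation t u then {} else {0})"
proof (induction i)
  case 0
  then show ?case using assms by simp
next
  case (Suc i)
  define r where "r = (exec L row ^^ i) s"
  have r: "ready r" "r 14 = {i}" "r 5 = (if \<exists>t<i. \<exists>u<L. pair_violation t u then {} else {0})"
    using Suc by (simp_all add: r_def Let_def)
  define r0 where "r0 = r(15 := r 3)"
  have r0: "ready r0" "r0 14 = {i}" "r0 15 = {0}" "r0 5 \<subseteq> {0}" "r0 5 = r 5"
    using r by (simp_all add: r0_def ready_def)
  define r' where "r' = (exec L (pair_com ;; Up 15 :: 'a com) ^^ L) r0"
  have r': "ready r'" "r' 14 = {i}" "r' 5 = (if \<exists>u<L. pair_violation i u then {} else r 5)"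
    using exec_inner_loop[where 'a = 'a, OF r0(1-4) le_refl] unfolding r'_def Let_def r0(5) by simp_all
  have "exec L row r = exec L (Up 14 :: 'a com) ((exec L (pair_com ;; Up 15 :: 'a com) ^^ L) (exec L (Asn 15 (V 3) :: 'a com) r))"
    unfolding row_def by (rule exec_seq_rep)
  then have "exec L row r = r'(14 := Suc ` r' 14)"
    by (simp only: exec.simps(1,2) ev.simps(1) r'_def r0_def)
  then have e: "(exec L row ^^ Suc i) s = r'(14 := Suc ` r' 14)"
    by (simp only: funpow.simps o_apply r_def)
  have "ready (r'(14 := Suc ` r' 14))" using r'(1) by (simp add: ready_def)
  then show ?case unfolding e Let_def using r(3) r'(2,3) by (simp add: less_Suc_eq) blast
qed

lemma violation_iff: "(\<exists>t<L. \<exists>u<L. pair_violation t u) \<longleftrightarrow> \<not> CNI ps og"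
proof -
  have "\<exists>t<L. \<exists>u<L. {l. l < m \<and> t < loc l \<and> loc l \<le> u} = {a..b}" if "a \<le> b" "b < m" for a b
  proof (intro exI conjI)
    \<comment> \<open>The lower bound is excluded, so it is the position of the preceding point; for
      \<open>a = 0\<close> position 0 serves, because every \<open>loc l\<close> is at least
      2.\<close>
    let ?t = "if a = 0 then 0 else loc (a - 1)"
    show "?t < L" using loc_less[of "a - 1"] that L_ge by auto
    show "loc b < L" using loc_less that by simp
    have "loc l \<le> loc b \<longleftrightarrow> l \<le> b" if "l < m" for l
      using loc_less_iff[of b l] that \<open>b < m\<close> by (simp add: not_less[symmetric])
    moreover have "?t < loc l \<longleftrightarrow> a \<le> l" if "l < m" for l
      using loc_less_iff[of "a - 1" l] loc_ge[OF that] that \<open>a \<le> b\<close> \<open>b < m\<close> by auto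
    ultimately show "{l. l < m \<and> ?t < loc l \<and> loc l \<le> loc b} = {a..b}"
      using that by auto
  qed
  then have "(\<exists>t<L. \<exists>u<L. pair_violation t u) \<longleftrightarrow> (\<exists>a b. a \<le> og \<and> og \<le> b \<and> b < m \<and> violation a b)"
    unfolding pair_violation_def by (meson le_trans)
  then show ?thesis unfolding CNI_iff violation_def by blast
qed

lemma exec_program: "exec L program (input_store inp) 5 \<noteq> {} \<longleftrightarrow> CNI ps og"
proof -
  define s where "s = exec L (box_com ;; start_com ;; Asn 5 (V 3) ;; Asn 14 (V 3) :: scan com) scanned"
  have "index (ps ! 0) = L + 3 * L * L"
    by (simp add: index_def dx_def dy_def nat_add_distrib nat_mult_distrib)
  then have s: "ready s" "s 14 = {0}" "s 5 = {0}"
    unfolding s_def ready_def by (simp_all add: scanned_simps)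
  have e: "exec L program (input_store inp)
    = (exec L (Asn 15 (V 3) ;; Rep (pair_com ;; Up 15) ;; Up 14 :: scan com) ^^ L) s"
    unfolding program_def exec.simps(5)[of _ "Scan _ _"] scanned_def[symmetric] s_def by simp
  show ?thesis
    using exec_outer_loop[where 'a = scan, OF s, of L] violation_iff unfolding e Let_def by simp
qed

end

theorem theorem14:
  shows "\<exists>M. wf_tm M \<and>
           decides_in_polytime M (\<lambda>(ps, og). is_config ps og)
             (\<lambda>(ps, og). enc_config ps og) (\<lambda>(ps, og). CNI ps og)"
proof (rule decides_if_exec[OF wf_program])
  fix x :: "pos list \<times> nat"
  assume x: "case x of (ps, og) \<Rightarrow> is_config ps og"
  obtain ps og where [simp]: "x = (ps, og)" by (cases x)
  interpret config ps og by unfold_locales (use x in simp)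
  show "(case x of (ps, og) \<Rightarrow> enc_config ps og) \<noteq> [] \<and> set (case x of (ps, og) \<Rightarrow> enc_config ps og) \<subseteq> {1..4}"
    using inp_symbols L_ge by auto
  show "exec (length (case x of (ps, og) \<Rightarrow> enc_config ps og)) program
      (input_store (case x of (ps, og) \<Rightarrow> enc_config ps og)) 5 \<noteq> {} \<longleftrightarrow> (case x of (ps, og) \<Rightarrow> CNI ps og)"
    using exec_program by simp
qed simp

end
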